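(* Let $\mathbf a\in L^\infty((0,T)\times\mathbb R^N;\mathbb R^N)$ and let $p_1,\dots,p_N\in\mathrm{Lip}_{loc}([0,T]\times\mathbb R^N)$ be real-valued functions with $\partial_tp_i+\mathbf a\cdot\nabla p_i=0$ a.e. in $(0,T)\times\mathbb R^N$ for $i=1,\dots,N$. Then the jacobian determinant $\pi=J(p_1,\dots,p_N)=\det(\nabla p_1,\dots,\nabla p_N)$ belongs to $C([0,T],L^\infty_{loc}(\mathbb R^N)\text{ weak-*})$ and is a weak (distributional) solution of $\partial_t\pi+\operatorname{div}(\mathbf a\pi)=0$ in $(0,T)\times\mathbb R^N$, i.e. $\pi\in\mathcal W^T$.
   Context: $\nabla$ denotes the spatial gradient in $x\in\mathbb R^N$, so $J(p)$ is the spatial Jacobian determinant. $\mathcal W^T$ denotes the set of $\pi\in C([0,T],L^\infty_{loc}(\mathbb R^N)\text{ weak-*})$ which satisfy $\partial_t\pi+\operatorname{div}(\mathbf a\pi)=0$ in the sense of distributions on $(0,T)\times\mathbb R^N$. The set of all such jacobians $J(p)$ is denoted $\mathcal J^T$ (jacobian solutions). *)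

theory Defs
  imports "HOL-Analysis.Analysis"
begin

text \<open>Spatial gradient (classical, where it exists; Lipschitz functions are differentiable a.e.)\<close>
definition sgrad :: "(real \<Rightarrow> real^'n \<Rightarrow> real) \<Rightarrow> real \<Rightarrow> real^'n \<Rightarrow> real^'n" where
  "sgrad f t x = (\<chi> j. frechet_derivative (f t) (at x) (axis j 1))"

definition tderiv :: "(real \<Rightarrow> real^'n \<Rightarrow> real) \<Rightarrow> real \<Rightarrow> real^'n \<Rightarrow> real" where
  "tderiv f t x = frechet_derivative (\<lambda>s. f s x) (at t) 1"

definition jac :: "('n \<Rightarrow> real \<Rightarrow> real^'n \<Rightarrow> real) \<Rightarrow> real \<Rightarrow> real^'n \<Rightarrow> real" where
  "jac p t x = det (\<chi> i j. sgrad (p i) t x $ j)"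

definition Linfty_field :: "real \<Rightarrow> (real \<Rightarrow> real^'n \<Rightarrow> real^'n) \<Rightarrow> bool" where
  "Linfty_field T a \<longleftrightarrow>
     (\<lambda>z. a (fst z) (snd z)) \<in> borel_measurable (lebesgue_on ({0<..<T} \<times> UNIV))
   \<and> (\<exists>C. AE z in lebesgue. z \<in> {0<..<T} \<times> UNIV \<longrightarrow> norm (a (fst z) (snd z)) \<le> C)"

definition Lip_loc :: "real \<Rightarrow> (real \<Rightarrow> real^'n \<Rightarrow> real) \<Rightarrow> bool" where
  "Lip_loc T f \<longleftrightarrow> (\<forall>K. compact K \<and> K \<subseteq> {0..T} \<times> UNIV \<longrightarrow>
       (\<exists>L. L-lipschitz_on K (\<lambda>z. f (fst z) (snd z))))"

definition Linfty_loc :: "(real^'n \<Rightarrow> real) \<Rightarrow> bool" where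
  "Linfty_loc u \<longleftrightarrow> u \<in> borel_measurable lebesgue \<and>
     (\<forall>K. compact K \<longrightarrow> (\<exists>C. AE x in lebesgue. x \<in> K \<longrightarrow> \<bar>u x\<bar> \<le> C))"

text \<open>C([0,T], L^infty_loc weak-*): each pi(t) in L^infty_loc and t \<mapsto> pi(t) continuous for the
  weak-* topology, i.e. every pairing with an L^1 function of compact support is continuous in t.\<close>
definition C_weakstar :: "real \<Rightarrow> (real \<Rightarrow> real^'n \<Rightarrow> real) \<Rightarrow> bool" where
  "C_weakstar T \<pi> \<longleftrightarrow> (\<forall>t\<in>{0..T}. Linfty_loc (\<pi> t)) \<and>
     (\<forall>\<phi>::real^'n \<Rightarrow> real. integrable lebesgue \<phi> \<and> bounded {x. \<phi> x \<noteq> 0} \<longrightarrow>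
        continuous_on {0..T} (\<lambda>t. integral\<^sup>L lebesgue (\<lambda>x. \<pi> t x * \<phi> x)))"

fun dderiv :: "'a::real_normed_vector list \<Rightarrow> ('a \<Rightarrow> real) \<Rightarrow> 'a \<Rightarrow> real" where
  "dderiv [] f = f"
| "dderiv (v # vs) f = (\<lambda>z. frechet_derivative (dderiv vs f) (at z) v)"

definition smooth :: "('a::real_normed_vector \<Rightarrow> real) \<Rightarrow> bool" where
  "smooth f \<longleftrightarrow> (\<forall>vs z. dderiv vs f differentiable (at z))"

definition test_fun :: "real \<Rightarrow> ((real * (real^'n)) \<Rightarrow> real) \<Rightarrow> bool" where
  "test_fun T \<phi> \<longleftrightarrow> smooth \<phi> \<and> compact (closure {z. \<phi> z \<noteq> 0})
     \<and> closure {z. \<phi> z \<noteq> 0} \<subseteq> {0<..<T} \<times> UNIV"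

text \<open>Distributional solution of d_t pi + div(a pi) = 0 on (0,T) x R^N:
  \<integral>\<integral> pi (d_t phi + a . grad_x phi) = 0 for all test functions phi.\<close>
definition weak_sol :: "real \<Rightarrow> (real \<Rightarrow> real^'n \<Rightarrow> real^'n) \<Rightarrow> (real \<Rightarrow> real^'n \<Rightarrow> real) \<Rightarrow> bool" where
  "weak_sol T a \<pi> \<longleftrightarrow> (\<forall>\<phi>. test_fun T \<phi> \<longrightarrow>
     (let g = (\<lambda>z. \<pi> (fst z) (snd z) *
          (frechet_derivative \<phi> (at z) (1, 0)
           + a (fst z) (snd z) \<bullet> (\<chi> j. frechet_derivative \<phi> (at z) (0, axis j 1))))
      in integrable lebesgue g \<and> integral\<^sup>L lebesgue g = 0))"

definition WT :: "real \<Rightarrow> (real \<Rightarrow> real^'n \<Rightarrow> real^'n) \<Rightarrow> (real \<Rightarrow> real^'n \<Rightarrow> real) \<Rightarrow> bool" where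
  "WT T a \<pi> \<longleftrightarrow> C_weakstar T \<pi> \<and> weak_sol T a \<pi>"

end

theory Submission
  imports Defs
begin

text \<open>
  The whole theorem rests on one identity: if \<open>g\<^sub>1, \<dots>, g\<^sub>m\<close> are compactly supported Lipschitz functions
  on an \<open>m\<close>-dimensional space, then \<open>\<integral> det (\<nabla>g\<^sub>1, \<dots>, \<nabla>g\<^sub>m) = 0\<close>. No smoothing is needed for it: for small
  \<open>s\<close> the map \<open>x \<mapsto> x + s g(x)\<close> is a bijection of a large ball, so by Rademacher's theorem and the change of
  variables formula \<open>\<integral> det (I + s \<nabla>g)\<close> over the ball is constant in \<open>s\<close>; it is a polynomial in \<open>s\<close>,
  and its leading coefficient is the integral in question.

  In space-time, each \<open>\<nabla>p\<^sub>i\<close> annihilates \<open>(1, a)\<close>, hence \<open>det_jacobian(p) (\<partial>\<^sub>t\<phi> + a \<cdot> \<nabla>\<phi>)\<close> is the determinant of the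
  \<open>N + 1\<close> space-time gradients of \<open>\<phi>, p\<^sub>1, \<dots>, p\<^sub>N\<close>, whose integral vanishes. In space, applying the identity to
  \<open>\<psi> g\<^sub>k\<close> in place of \<open>g\<^sub>k\<close> moves the derivative off one factor, so \<open>\<integral> \<psi> det_jacobian(g)\<close> is Lipschitz in the sup norm of \<open>g\<close>
  as long as the Lipschitz constants stay bounded; density of Lipschitz functions in \<open>L\<^sup>1\<close> then gives the
  weak-* continuity.

  Rademacher's theorem is reduced to the line by Fubini's theorem; there, the Vitali covering theorem compares
  Lebesgue measure with the Stieltjes measure on the set where two derivates differ.
\<close>


section \<open>Lipschitz functions on the line\<close>

text \<open>The field \<open>a\<close> is only bounded and measurable, so there is no flow along
  which \<open>jac p\<close> could be transported, and uniform closeness of \<open>p i s\<close> to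
  \<open>p i t\<close> gives no closeness of the gradients; only the structure of the determinant
  helps. The identity is needed on \<open>real^'n\<close> at every single time and also on
  space-time, because an almost-everywhere statement in space-time says nothing about a prescribed
  time. For this reason Rademacher's theorem and the identity are proved on an arbitrary Euclidean
  space whose basis is enumerated by an arbitrary finite type. Change of variables produces the
  absolute value of the determinant, which is a polynomial in s only while the sign is constant;
  this is a second reason for keeping s small. The functions \<open>p i\<close> are Lipschitz only
  on compact subsets of [0,T] x R^N and have no bounded support. A cutoff combined with the
  retraction onto a compact convex set replaces them by global functions that agree with them near
  the support of the given test function.\<close>

lemma emeasure_interval_measure_singleton:
  fixes F :: "real \<Rightarrow> real"
  assumes "mono F" "continuous_on UNIV F"
  shows "emeasure (interval_measure F) {a} = 0"
  using emeasure_interval_measure_Icc[of a a F] assms by (auto simp: mono_def)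

lemma emeasure_interval_measure_Ioo:
  fixes F :: "real \<Rightarrow> real"
  assumes "mono F" "continuous_on UNIV F" "a \<le> b"
  shows "emeasure (interval_measure F) {a<..<b} = F b - F a"
proof -
  have "emeasure (interval_measure F) {a..b} = emeasure (interval_measure F) ({a..b} - {a,b})"
  proof (rule emeasure_Diff_null_set[symmetric])
    have "{a} \<union> {b} \<in> null_sets (interval_measure F)"
      by (intro null_sets.Un null_setsI emeasure_interval_measure_singleton assms) auto
    then show "{a,b} \<in> null_sets (interval_measure F)" by (simp add: insert_is_Un[of a "{b}"])
  qed auto
  moreover have "{a..b} - {a,b} = {a<..<b}" by auto
  ultimately show ?thesis
    using emeasure_interval_measure_Icc[of a b F] assms by (auto simp: mono_def)
qed

text \<open>With G x = x - F x, the measures of F and G add up to Lebesgue measure, since the sum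
  gives every open interval its length. The inequality makes Lebesgue-null sets null for
  \<open>interval_measure F\<close>, so a Vitali cover, which misses a Lebesgue-null set, can
  compute this measure as well.\<close>

lemma interval_measure_le_lborel:
  fixes F :: "real \<Rightarrow> real"
  assumes F: "mono F" "mono (\<lambda>x. x - F x)" "continuous_on UNIV F" and A: "A \<in> sets borel"
  shows "emeasure (interval_measure F) A \<le> emeasure lborel A"
proof -
  define G where "G = (\<lambda>x. x - F x)"
  have G: "mono G" "continuous_on UNIV G"
    using F by (auto simp: G_def intro!: continuous_intros)
  define \<rho> where "\<rho> = measure_of UNIV (sets borel)
    (\<lambda>A. emeasure (interval_measure F) A + emeasure (interval_measure G) A)"
  have sets_\<rho>: "sets \<rho> = sets borel"
    unfolding \<rho>_def using sets.sigma_sets_eq[of "borel::real measure"] by simp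
  have em: "emeasure \<rho> X = emeasure (interval_measure F) X + emeasure (interval_measure G) X"
    if "X \<in> sets borel" for X
    unfolding \<rho>_def
  proof (rule emeasure_measure_of_sigma)
    show "sigma_algebra UNIV (sets (borel::real measure))"
      using sets.sigma_algebra_axioms[of "borel::real measure"] by simp
    show "positive (sets borel) (\<lambda>A. emeasure (interval_measure F) A + emeasure (interval_measure G) A)"
      by (simp add: positive_def)
    show "countably_additive (sets borel) (\<lambda>A. emeasure (interval_measure F) A + emeasure (interval_measure G) A)"
      unfolding countably_additive_def
      by (auto simp: suminf_add[symmetric] suminf_emeasure)
  qed (use that in auto)
  have "lborel = \<rho>"
  proof (rule lborel_eqI)
    fix l u :: real assume "\<And>b. b \<in> Basis \<Longrightarrow> l \<bullet> b \<le> u \<bullet> b"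
    then have "l \<le> u" by simp
    moreover have "F l \<le> F u" "G l \<le> G u" using F G \<open>l \<le> u\<close> by (auto simp: mono_def)
    ultimately show "emeasure \<rho> (box l u) = (\<Prod>b\<in>Basis. (u - l) \<bullet> b)"
      using F G by (simp add: em emeasure_interval_measure_Ioo ennreal_plus[symmetric]
          del: ennreal_plus) (simp add: G_def)
  qed (simp add: sets_\<rho>)
  then have "emeasure lborel A = emeasure (interval_measure F) A + emeasure (interval_measure G) A"
    using em[OF A] by simp
  then show ?thesis by simp
qed

text \<open>The intervals are chosen inside an open U containing E with |U - E| < \<epsilon>, so the
  family exceeds E by less than \<epsilon>. P stays a parameter so that upper and lower bounds on
  slopes share one covering argument.\<close>

lemma Vitali_interval_cover:
  fixes E :: "real set"
  assumes E: "E \<in> sets borel" and "\<epsilon> > 0"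
    and cov: "\<And>x d. x \<in> E \<Longrightarrow> 0 < d \<Longrightarrow> \<exists>a b. a < b \<and> x \<in> {a..b} \<and> b - a < d \<and> P a b"
  obtains C :: "(real \<times> real) set" where
    "countable C" "\<forall>z\<in>C. fst z < snd z \<and> P (fst z) (snd z)"
    "disjoint_family_on (\<lambda>z. {fst z..snd z}) C"
    "emeasure lborel (E - (\<Union>z\<in>C. {fst z..snd z})) = 0"
    "emeasure lborel ((\<Union>z\<in>C. {fst z..snd z}) - E) < ennreal \<epsilon>"
proof -
  have "E \<in> sets lebesgue" using E by simp
  then obtain U where U: "open U" "E \<subseteq> U" "(U - E) \<in> lmeasurable" "emeasure lebesgue (U - E) < ennreal \<epsilon>"
    using sets_lebesgue_outer_open[OF _ \<open>\<epsilon> > 0\<close>] by metis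
  define K where "K = {z::real\<times>real. fst z < snd z \<and> P (fst z) (snd z) \<and> {fst z..snd z} \<subseteq> U}"
  define ce where "ce = (\<lambda>z::real\<times>real. (fst z + snd z)/2)"
  define r where "r = (\<lambda>z::real\<times>real. (snd z - fst z)/2)"
  have cb: "cball (ce z) (r z) = {fst z..snd z}" for z
    by (auto simp: ce_def r_def cball_eq_atLeastAtMost field_simps)
  have "\<exists>i. i \<in> K \<and> x \<in> cball (ce i) (r i) \<and> r i < d" if "x \<in> E" "0 < d" for x d
  proof -
    obtain e where e: "e > 0" "cball x e \<subseteq> U"
      using U(1,2) \<open>x \<in> E\<close> unfolding open_contains_cball by blast
    have "0 < min d e" using e(1) \<open>0 < d\<close> by simp
    then obtain a b where ab: "a < b" "x \<in> {a..b}" "b - a < min d e" "P a b"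
      using cov[OF \<open>x \<in> E\<close>] by blast
    have "{a..b} \<subseteq> cball x e" using ab by (auto simp: dist_real_def)
    then have "(a,b) \<in> K" using ab e by (auto simp: K_def)
    moreover have "r (a,b) < d" using ab by (simp add: r_def)
    ultimately show ?thesis using ab cb[of "(a,b)"] by (intro exI[of _ "(a,b)"]) auto
  qed
  note cover = this
  obtain C where C: "countable C" "C \<subseteq> K"
     "pairwise (\<lambda>i j. disjnt (cball (ce i) (r i)) (cball (ce j) (r j))) C"
     "negligible (E - (\<Union>i \<in> C. cball (ce i) (r i)))"
    by (rule Vitali_covering_theorem_cballs[of K r E ce, OF _ cover]) (auto simp: K_def r_def)
  define W where "W = (\<Union>z\<in>C. {fst z..snd z})"
  have W: "W \<in> sets borel" unfolding W_def using C by auto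
  have "emeasure lebesgue (E - W) = 0"
    using C(4) unfolding cb W_def[symmetric] by (simp add: negligible_iff_null_sets null_sets_def)
  then have 1: "emeasure lborel (E - W) = 0" using E W by simp
  have "W \<subseteq> U" using C(2) by (auto simp: W_def K_def)
  then have "emeasure lebesgue (W - E) \<le> emeasure lebesgue (U - E)"
    using U by (intro emeasure_mono) auto
  then have 2: "emeasure lborel (W - E) < ennreal \<epsilon>" using U(4) E W by simp
  show thesis
    by (rule that[OF C(1) _ _ 1[unfolded W_def] 2[unfolded W_def]])
      (use C in \<open>auto simp: K_def pairwise_def disjoint_family_on_def disjnt_def cb\<close>)
qed

lemma emeasure_interval_family_le:
  fixes C :: "(real \<times> real) set"
  assumes "countable C" "disjoint_family_on (\<lambda>z. {fst z..snd z}) C"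
    and [simp]: "sets M = sets borel" "sets N = sets borel"
    and "\<And>z. z \<in> C \<Longrightarrow> emeasure M {fst z..snd z} \<le> c * emeasure N {fst z..snd z}"
  shows "emeasure M (\<Union>z\<in>C. {fst z..snd z}) \<le> c * emeasure N (\<Union>z\<in>C. {fst z..snd z})"
proof -
  have "emeasure M (\<Union>z\<in>C. {fst z..snd z}) = (\<integral>\<^sup>+z. emeasure M {fst z..snd z} \<partial>count_space C)"
    by (rule emeasure_UN_countable) (use assms in auto)
  also have "\<dots> \<le> (\<integral>\<^sup>+z. c * emeasure N {fst z..snd z} \<partial>count_space C)"
    by (rule nn_integral_mono) (use assms in auto)
  also have "\<dots> = c * (\<integral>\<^sup>+z. emeasure N {fst z..snd z} \<partial>count_space C)"
    by (rule nn_integral_cmult) auto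
  also have "(\<integral>\<^sup>+z. emeasure N {fst z..snd z} \<partial>count_space C) = emeasure N (\<Union>z\<in>C. {fst z..snd z})"
    by (rule emeasure_UN_countable[symmetric]) (use assms in auto)
  finally show ?thesis .
qed

section \<open>Derivates of an increasing function whose slopes are at most one\<close>

context
  fixes F :: "real \<Rightarrow> real"
  assumes F: "mono F" "mono (\<lambda>x. x - F x)" "continuous_on UNIV F"
begin

text \<open>On each interval of the cover the measure is F b - F a \<le> p (b - a). Summation over
  the disjoint family transfers this to its union W, which differs from E by a null set on one side
  and by a set of small measure on the other.\<close>

lemma interval_measure_derivate_le:
  fixes E :: "real set"
  assumes E: "E \<in> sets borel" and p: "0 \<le> p"
    and cov: "\<And>x d. x \<in> E \<Longrightarrow> 0 < d \<Longrightarrow>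
      \<exists>a b. a < b \<and> x \<in> {a..b} \<and> b - a < d \<and> F b - F a \<le> p * (b - a)"
  shows "emeasure (interval_measure F) E \<le> ennreal p * emeasure lborel E"
proof (rule ennreal_le_epsilon)
  fix \<epsilon> :: real assume "\<epsilon> > 0"
  \<comment> \<open>The excess of W over E is multiplied by p below; the added 1 keeps the divisor
    positive when p = 0.\<close>
  define e where "e = \<epsilon> / (p + 1)"
  have "e > 0" using \<open>\<epsilon> > 0\<close> p by (simp add: e_def)
  then obtain C :: "(real \<times> real) set" where C:
    "countable C" "\<forall>z\<in>C. fst z < snd z \<and> F (snd z) - F (fst z) \<le> p * (snd z - fst z)"
    "disjoint_family_on (\<lambda>z. {fst z..snd z}) C"
    "emeasure lborel (E - (\<Union>z\<in>C. {fst z..snd z})) = 0"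
    "emeasure lborel ((\<Union>z\<in>C. {fst z..snd z}) - E) < ennreal e"
    by (rule Vitali_interval_cover[where P = "\<lambda>a b. F b - F a \<le> p * (b - a)", OF E _ cov])
  define W where "W = (\<Union>z\<in>C. {fst z..snd z})"
  let ?\<mu> = "interval_measure F"
  have W: "W \<in> sets borel" unfolding W_def using C by auto
  have "emeasure ?\<mu> (E - W) = 0"
    using interval_measure_le_lborel[OF F, of "E - W"] C(4) E W by (simp add: W_def)
  then have "emeasure ?\<mu> E \<le> emeasure ?\<mu> W"
    using emeasure_subadditive[of "E - W" ?\<mu> W] emeasure_mono[of E "E - W \<union> W" ?\<mu>] E W by force
  also have "\<dots> \<le> ennreal p * emeasure lborel W"
    unfolding W_def
  proof (rule emeasure_interval_family_le[OF C(1,3)])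
    fix z assume "z \<in> C"
    then show "emeasure ?\<mu> {fst z..snd z} \<le> ennreal p * emeasure lborel {fst z..snd z}"
      using C(2)[rule_format, of z] F p by (auto simp: emeasure_interval_measure_Icc mono_def ennreal_mult[symmetric]
          intro!: ennreal_leI)
  qed auto
  also have "emeasure lborel W \<le> emeasure lborel E + ennreal e"
  proof -
    have "emeasure lborel W \<le> emeasure lborel (E \<union> (W - E))"
      using E W by (intro emeasure_mono) auto
    also have "\<dots> \<le> emeasure lborel E + emeasure lborel (W - E)"
      using E W by (intro emeasure_subadditive) auto
    also have "\<dots> \<le> emeasure lborel E + ennreal e"
      using C(5) by (intro add_left_mono) (auto simp: W_def)
    finally show ?thesis .
  qed
  also have "ennreal p * (emeasure lborel E + ennreal e) = ennreal p * emeasure lborel E + ennreal (p * e)"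
    using p \<open>e > 0\<close> by (simp add: distrib_left ennreal_mult)
  also have "\<dots> \<le> ennreal p * emeasure lborel E + ennreal \<epsilon>"
    using p \<open>\<epsilon> > 0\<close> by (intro add_left_mono ennreal_leI) (simp add: e_def field_simps)
  finally show "emeasure ?\<mu> E \<le> ennreal p * emeasure lborel E + ennreal \<epsilon>"
    by (simp add: mult_left_mono)
qed

lemma interval_measure_derivate_ge:
  fixes E :: "real set"
  assumes E: "E \<in> sets borel" and p: "0 \<le> p"
    and cov: "\<And>x d. x \<in> E \<Longrightarrow> 0 < d \<Longrightarrow>
      \<exists>a b. a < b \<and> x \<in> {a..b} \<and> b - a < d \<and> F b - F a \<ge> p * (b - a)"
  shows "ennreal p * emeasure lborel E \<le> emeasure (interval_measure F) E"
proof (rule ennreal_le_epsilon)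
  fix e :: real assume "e > 0"
  then obtain C :: "(real \<times> real) set" where C:
    "countable C" "\<forall>z\<in>C. fst z < snd z \<and> F (snd z) - F (fst z) \<ge> p * (snd z - fst z)"
    "disjoint_family_on (\<lambda>z. {fst z..snd z}) C"
    "emeasure lborel (E - (\<Union>z\<in>C. {fst z..snd z})) = 0"
    "emeasure lborel ((\<Union>z\<in>C. {fst z..snd z}) - E) < ennreal e"
    by (rule Vitali_interval_cover[where P = "\<lambda>a b. F b - F a \<ge> p * (b - a)", OF E _ cov])
  define W where "W = (\<Union>z\<in>C. {fst z..snd z})"
  let ?\<mu> = "interval_measure F"
  have W: "W \<in> sets borel" unfolding W_def using C by auto
  have "emeasure lborel E \<le> emeasure lborel W"
    using emeasure_subadditive[of "E - W" lborel W] emeasure_mono[of E "E - W \<union> W" lborel] E W C(4)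
    by (force simp: W_def)
  then have "ennreal p * emeasure lborel E \<le> ennreal p * emeasure lborel W"
    by (intro mult_left_mono) auto
  \<comment> \<open>The factor p now stands on the smaller side, so it is absorbed into a measure
    and the comparison of families is used with constant 1.\<close>
  also have "\<dots> = emeasure (density lborel (\<lambda>x. ennreal p)) W"
    using W by (simp add: emeasure_density_const)
  also have "\<dots> \<le> 1 * emeasure ?\<mu> W"
    unfolding W_def
  proof (rule emeasure_interval_family_le[OF C(1,3)])
    fix z assume "z \<in> C"
    then show "emeasure (density lborel (\<lambda>x. ennreal p)) {fst z..snd z} \<le> 1 * emeasure ?\<mu> {fst z..snd z}"
      using C(2)[rule_format, of z] F p by (auto simp: emeasure_density_const emeasure_interval_measure_Icc mono_def ennreal_mult[symmetric]
          intro!: ennreal_leI)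
  qed auto
  also have "1 * emeasure ?\<mu> W \<le> emeasure ?\<mu> E + ennreal e"
  proof -
    have "emeasure ?\<mu> W \<le> emeasure ?\<mu> (E \<union> (W - E))"
      using E W by (intro emeasure_mono) auto
    also have "\<dots> \<le> emeasure ?\<mu> E + emeasure ?\<mu> (W - E)"
      using E W by (intro emeasure_subadditive) auto
    also have "\<dots> \<le> emeasure ?\<mu> E + ennreal e"
      using C(5) interval_measure_le_lborel[OF F, of "W - E"] E W
      by (intro add_left_mono) (auto simp: W_def)
    finally show ?thesis by simp
  qed
  finally show "ennreal p * emeasure lborel E \<le> emeasure ?\<mu> E + ennreal e" .
qed

text \<open>The point x becomes the left end of the interval for t > 0 and the right end for t < 0;
  in both cases the slope over the interval is the difference quotient at x.\<close>

lemma frequently_difference_quotient_cover: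
  assumes "\<exists>\<^sub>F t in at 0. Q ((F (x + t) - F x) / t)" "0 < d"
  shows "\<exists>a b. a < b \<and> x \<in> {a..b} \<and> b - a < d \<and> Q ((F b - F a) / (b - a))"
proof -
  have "\<exists>\<^sub>F t in at 0. Q ((F (x + t) - F x) / t) \<and> dist t 0 < d \<and> t \<noteq> 0"
    using frequently_eventually_conj[OF assms(1), of "\<lambda>t. dist t 0 < d \<and> t \<noteq> 0"] \<open>0 < d\<close>
    by (auto simp: eventually_at conj_ac)
  then obtain t where t: "Q ((F (x + t) - F x) / t)" "\<bar>t\<bar> < d" "t \<noteq> 0"
    using frequently_ex by fastforce
  show ?thesis
  proof (cases "t > 0")
    case True
    then show ?thesis using t by (intro exI[of _ x] exI[of _ "x + t"]) auto
  next
    case False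
    have "(F x - F (x + t)) / (x - (x + t)) = (F (x + t) - F x) / t"
      using t by (simp add: field_simps)
    then show ?thesis using t False by (intro exI[of _ "x + t"] exI[of _ x]) auto
  qed
qed

text \<open>The set is a G-delta: for each bound 1/(n+1) on t, continuity of F makes the condition
  open for every t, and a union of open sets over uncountably many t is still open.\<close>

lemma borel_frequently_difference_quotient:
  assumes "open S"
  shows "{x. \<exists>\<^sub>F t in at 0. (F (x + t) - F x) / t \<in> S} \<in> sets borel"
proof -
  define B where "B = (\<lambda>n::nat. \<Union>t\<in>{t. \<bar>t\<bar> < 1 / Suc n \<and> t \<noteq> 0}. (\<lambda>x. (F (x + t) - F x) / t) -` S)"
  have "open (B n)" for n
    unfolding B_def using assms
    by (intro open_UN ballI open_vimage continuous_intros continuous_on_compose2[OF F(3)]) auto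
  then have B: "(\<Inter>n. B n) \<in> sets borel" by auto
  have "(\<exists>\<^sub>F t in at 0. (F (x + t) - F x) / t \<in> S) \<longleftrightarrow> x \<in> (\<Inter>n. B n)" for x
  proof
    assume *: "\<exists>\<^sub>F t in at 0. (F (x + t) - F x) / t \<in> S"
    have "x \<in> B n" for n
    proof -
      have "\<exists>\<^sub>F t in at 0. (F (x + t) - F x) / t \<in> S \<and> dist t 0 < 1 / Suc n \<and> t \<noteq> 0"
        by (rule frequently_eventually_frequently[OF *])
          (auto simp: eventually_at intro!: exI[of _ "1 / Suc n"])
      then show ?thesis by (auto simp: B_def dest!: frequently_ex)
    qed
    then show "x \<in> (\<Inter>n. B n)" by auto
  next
    assume *: "x \<in> (\<Inter>n. B n)"
    show "\<exists>\<^sub>F t in at 0. (F (x + t) - F x) / t \<in> S"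
      unfolding frequently_def eventually_at
    proof (rule notI, elim exE conjE)
      fix d :: real assume "d > 0" 
        and d: "\<forall>t\<in>UNIV. t \<noteq> 0 \<and> dist t 0 < d \<longrightarrow> (F (x + t) - F x) / t \<notin> S"
      obtain n where "1 / Suc n < d" using \<open>d > 0\<close> nat_approx_posE by blast
      moreover obtain t where "\<bar>t\<bar> < 1 / Suc n" "t \<noteq> 0" "(F (x + t) - F x) / t \<in> S"
        using * by (auto simp: B_def)
      ultimately show False using d[rule_format, of t] by simp
    qed
  qed
  then have "{x. \<exists>\<^sub>F t in at 0. (F (x + t) - F x) / t \<in> S} = (\<Inter>n. B n)" by auto
  then show ?thesis using B by simp
qed

text \<open>The two Vitali estimates give q |E| \<le> \<mu> E \<le> p |E| with p < q, where \<mu> is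
  the measure of F. For p \<le> 0 the set is empty, since F is increasing.\<close>

lemma null_derivate_gap:
  fixes p q k :: real
  assumes pq: "p < q"
  defines "E \<equiv> {x. \<exists>\<^sub>F t in at 0. (F (x + t) - F x) / t \<in> {..<p}}
     \<inter> {x. \<exists>\<^sub>F t in at 0. (F (x + t) - F x) / t \<in> {q<..}} \<inter> {-k..k}"
  shows "emeasure lborel E = 0"
proof (cases "p \<le> 0")
  case True
  have "E = {}"
  proof -
    have "False" if "x \<in> E" for x
    proof -
      have "\<exists>a b. a < b \<and> x \<in> {a..b} \<and> b - a < 1 \<and> (F b - F a) / (b - a) \<in> {..<p}"
        using frequently_difference_quotient_cover[of "\<lambda>r. r \<in> {..<p}" x 1] that by (auto simp: E_def)
      then obtain a b where "a < b" "(F b - F a) / (b - a) < 0" using True by auto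
      moreover have "F a \<le> F b" using F \<open>a < b\<close> by (auto simp: mono_def)
      ultimately show False by (simp add: divide_less_0_iff)
    qed
    then show ?thesis by auto
  qed
  then show ?thesis by simp
next
  case False
  have E: "E \<in> sets borel" unfolding E_def
    by (intro sets.Int borel_frequently_difference_quotient) auto
  have 1: "emeasure (interval_measure F) E \<le> ennreal p * emeasure lborel E"
  proof (rule interval_measure_derivate_le[OF E])
    fix x d :: real assume "x \<in> E" "0 < d"
    then have "\<exists>a b. a < b \<and> x \<in> {a..b} \<and> b - a < d \<and> (F b - F a) / (b - a) \<in> {..<p}"
      by (intro frequently_difference_quotient_cover) (auto simp: E_def)
    then show "\<exists>a b. a < b \<and> x \<in> {a..b} \<and> b - a < d \<and> F b - F a \<le> p * (b - a)"
      by (fastforce simp: field_simps)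
  qed (use False in auto)
  have 2: "ennreal q * emeasure lborel E \<le> emeasure (interval_measure F) E"
  proof (rule interval_measure_derivate_ge[OF E])
    fix x d :: real assume "x \<in> E" "0 < d"
    then have "\<exists>a b. a < b \<and> x \<in> {a..b} \<and> b - a < d \<and> (F b - F a) / (b - a) \<in> {q<..}"
      by (intro frequently_difference_quotient_cover) (auto simp: E_def)
    then show "\<exists>a b. a < b \<and> x \<in> {a..b} \<and> b - a < d \<and> F b - F a \<ge> q * (b - a)"
      by (fastforce simp: field_simps)
  qed (use False pq in auto)
  \<comment> \<open>Restricting to a bounded interval makes |E| finite, and only a finite |E| can be
    cancelled from q |E| \<le> p |E|.\<close>
  have "emeasure lborel E \<le> emeasure lborel {-k..k}" using E by (intro emeasure_mono) (auto simp: E_def)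
  also have "\<dots> < \<infinity>" by (simp add: emeasure_lborel_Icc_eq)
  finally obtain m where m: "emeasure lborel E = ennreal m" "m \<ge> 0"
    by (metis ennreal_cases infinity_ennreal_def less_irrefl)
  have "ennreal (q * m) \<le> ennreal (p * m)"
    using 1 2 m False pq by (simp add: ennreal_mult)
  then have "q * m \<le> p * m" using m False by (simp add: ennreal_le_iff)
  then have "m = 0" using pq m by (simp add: mult_le_cancel_right)
  then show ?thesis using m by simp
qed

text \<open>Where the lower and upper limits of the quotients differ, two rationals p < q fit
  between them, and the point lies in one of countably many null sets; the natural numbers k exhaust
  the line.\<close>

lemma monotone_1_Lipschitz_AE_differentiable:
  "AE x in lborel. F differentiable (at x)"
proof -
  define A where "A = (\<lambda>S x. \<exists>\<^sub>F t in at 0. (F (x + t) - F x) / t \<in> S)"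
  have "AE x in lborel. \<forall>p\<in>\<rat>. \<forall>q\<in>\<rat>. \<forall>k\<in>\<nat>. p < q \<longrightarrow> \<not> (A {..<p} x \<and> A {q<..} x \<and> x \<in> {-k..k})"
  proof (intro AE_ball_countable' countable_rat)
    fix p q k :: real assume "k \<in> \<nat>" 
    show "AE x in lborel. p < q \<longrightarrow> \<not> (A {..<p} x \<and> A {q<..} x \<and> x \<in> {-k..k})"
    proof (cases "p < q")
      case True
      define N where "N = {x. A {..<p} x} \<inter> {x. A {q<..} x} \<inter> {-k..k}"
      have "N \<in> sets borel" unfolding N_def A_def
        by (intro sets.Int borel_frequently_difference_quotient) auto
      then have "N \<in> null_sets lborel" using null_derivate_gap[OF True] by (auto simp: N_def A_def)
      then show ?thesis by (rule AE_I') (auto simp: N_def)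
    qed simp
  qed (auto simp: Nats_def)
  then show ?thesis
  proof eventually_elim
    fix x assume *: "\<forall>p\<in>\<rat>. \<forall>q\<in>\<rat>. \<forall>k\<in>\<nat>. p < q \<longrightarrow> \<not> (A {..<p} x \<and> A {q<..} x \<and> x \<in> {-k..k})"
    define Q where "Q = (\<lambda>t. (F (x + t) - F x) / t)"
    \<comment> \<open>This bound keeps the two extended-real limits in [0,1], so their common value
      is a real derivative.\<close>
    have bd: "0 \<le> Q t \<and> Q t \<le> 1" if "t \<noteq> 0" for t
      using F(1,2)[THEN monoD, of x "x + t"] F(1,2)[THEN monoD, of "x + t" x] that
      by (cases "t > 0") (auto simp: Q_def field_simps)
    define l where "l = Liminf (at 0) (\<lambda>t. ereal (Q t))"
    define u where "u = Limsup (at 0) (\<lambda>t. ereal (Q t))"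
    have lu: "l \<le> u" unfolding l_def u_def by (rule Liminf_le_Limsup) simp
    have l0: "0 \<le> l" unfolding l_def
      by (rule Liminf_bounded) (auto simp: eventually_at intro!: exI[of _ 1] dest!: bd)
    have u1: "u \<le> 1" unfolding u_def
      by (rule Limsup_bounded) (auto simp: eventually_at intro!: exI[of _ 1] dest!: bd)
    have "\<not> l < u"
    proof
      assume "l < u"
      then obtain q where q: "l < ereal (real_of_rat q)" "ereal (real_of_rat q) < u"
        using ereal_dense3 by blast
      obtain p where p: "l < ereal (real_of_rat p)" "ereal (real_of_rat p) < ereal (real_of_rat q)"
        using ereal_dense3 q by blast
      have 1: "A {..<real_of_rat p} x"
      proof (rule ccontr)
        assume "\<not> A {..<real_of_rat p} x"
        then have "eventually (\<lambda>t. ereal (real_of_rat p) \<le> ereal (Q t)) (at 0)"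
          by (simp add: A_def Q_def frequently_def not_less)
        then have "ereal (real_of_rat p) \<le> l" unfolding l_def by (rule Liminf_bounded)
        then show False using p by simp
      qed
      have 2: "A {real_of_rat q<..} x"
      proof (rule ccontr)
        assume "\<not> A {real_of_rat q<..} x"
        then have "eventually (\<lambda>t. ereal (Q t) \<le> ereal (real_of_rat q)) (at 0)"
          by (simp add: A_def Q_def frequently_def not_less)
        then have "u \<le> ereal (real_of_rat q)" unfolding u_def by (rule Limsup_bounded)
        then show False using q by simp
      qed
      obtain k :: nat where "\<bar>x\<bar> \<le> real k" using real_arch_simple by blast
      then have "x \<in> {- real k..real k}" by auto
      then show False using *[rule_format, of "real_of_rat p" "real_of_rat q" "real k"] 1 2 p by auto
    qed
    then have "l = u" using lu by auto
    moreover obtain c where "u = ereal c" using l0 u1 lu by (cases u) auto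
    ultimately have "((\<lambda>t. ereal (Q t)) \<longlongrightarrow> ereal c) (at 0)"
      by (intro tendsto_iff_Liminf_eq_Limsup[THEN iffD2]) (auto simp: l_def u_def)
    then have "(Q \<longlongrightarrow> c) (at 0)" by simp
    then have "DERIV F x :> c" by (simp add: DERIV_def Q_def)
    then show "F differentiable (at x)" by (auto simp: differentiable_def has_field_derivative_def)
  qed
qed

end

theorem Lipschitz_real_AE_differentiable:
  fixes f :: "real \<Rightarrow> real"
  assumes f: "L-lipschitz_on UNIV f"
  shows "AE x in lborel. f differentiable (at x)"
proof -
  have L: "L \<ge> 0" using f lipschitz_on_nonneg by blast
  \<comment> \<open>Adding L x moves the slopes of f into [0, 2L], and division by 2L + 1 moves them
    into [0,1]; the 1 avoids division by zero for constant f.\<close>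
  define F where "F = (\<lambda>x. (f x + L * x) / (2 * L + 1))"
  have f': "\<bar>f y - f x\<bar> \<le> L * (y - x)" if "x \<le> y" for x y
    using lipschitz_onD[OF f, of y x] that by (auto simp: dist_real_def)
  have "mono F" unfolding mono_def F_def
  proof (intro allI impI divide_right_mono)
    fix x y :: real assume "x \<le> y"
    then show "f x + L * x \<le> f y + L * y" using f'[of x y] by (simp add: algebra_simps abs_le_iff)
  qed (use L in auto)
  moreover have "mono (\<lambda>x. x - F x)" unfolding mono_def F_def
  proof (intro allI impI)
    fix x y :: real assume "x \<le> y"
    have "(2 * L + 1) * x - (f x + L * x) \<le> (2 * L + 1) * y - (f y + L * y)"
      using f'[OF \<open>x \<le> y\<close>] \<open>x \<le> y\<close> by (simp add: algebra_simps abs_le_iff)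
    then have "((2 * L + 1) * x - (f x + L * x)) / (2 * L + 1) \<le> ((2 * L + 1) * y - (f y + L * y)) / (2 * L + 1)"
      using L by (intro divide_right_mono) auto
    then show "x - (f x + L * x) / (2 * L + 1) \<le> y - (f y + L * y) / (2 * L + 1)"
      using L by (simp add: diff_divide_distrib)
  qed
  moreover have "continuous_on UNIV F" unfolding F_def
    using lipschitz_on_continuous_on[OF f] L by (intro continuous_intros) auto
  ultimately have "AE x in lborel. F differentiable (at x)"
    by (rule monotone_1_Lipschitz_AE_differentiable)
  then show ?thesis
  proof eventually_elim
    fix x assume "F differentiable (at x)"
    then have "(\<lambda>x. (2 * L + 1) * F x - L * x) differentiable (at x)"
      by (intro derivative_intros)
    moreover have "(\<lambda>x. (2 * L + 1) * F x - L * x) = f" using L by (auto simp: F_def)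
    ultimately show "f differentiable (at x)" by simp
  qed
qed

section \<open>Density of Lipschitz functions in $L^1$\<close>

lemma integrable_bounded_support:
  fixes f :: "'a::euclidean_space \<Rightarrow> real"
  assumes "f \<in> borel_measurable lebesgue" "bounded S" "\<And>x. x \<notin> S \<Longrightarrow> f x = 0"
    and "AE x in lebesgue. \<bar>f x\<bar> \<le> B"
  shows "integrable lebesgue f"
proof -
  obtain R where R: "S \<subseteq> cball 0 R" using bounded_subset_ballD[OF \<open>bounded S\<close>, of 0] ball_subset_cball by blast
  have "integrable lebesgue (\<lambda>x. indicator (cball (0::'a) R) x *\<^sub>R B)"
    using lmeasurable_cball[of "0::'a" R]
    by (intro integrable_scaleR_left integrable_real_indicator) (auto simp: fmeasurable_def)
  then show ?thesis
  proof (rule Bochner_Integration.integrable_bound[OF _ assms(1)])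
    show "AE x in lebesgue. norm (f x) \<le> norm (indicator (cball (0::'a) R) x *\<^sub>R B)"
      using assms(4) 
    proof eventually_elim
      fix x assume "\<bar>f x\<bar> \<le> B"
      then show "norm (f x) \<le> norm (indicator (cball (0::'a) R) x *\<^sub>R B)"
        using assms(3)[of x] R by (cases "x \<in> cball 0 R") (force simp del: mem_cball_0)+
    qed
  qed
qed

lemma lipschitz_borel_measurable:
  fixes f :: "'a::euclidean_space \<Rightarrow> 'b::euclidean_space"
  assumes "L-lipschitz_on UNIV f"
  shows "f \<in> borel_measurable lebesgue"
  using borel_measurable_continuous_onI[OF lipschitz_on_continuous_on[OF assms]]
  by (intro measurable_completion) simp

lemma lipschitz_bounded_range:
  fixes f :: "'a::euclidean_space \<Rightarrow> real"
  assumes f: "L-lipschitz_on UNIV f" and S: "bounded S" "\<And>x. x \<notin> S \<Longrightarrow> f x = 0"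
  obtains B where "B \<ge> 0" "\<And>x. \<bar>f x\<bar> \<le> B"
proof -
  obtain R where R: "S \<subseteq> cball 0 R" using bounded_subset_ballD[OF \<open>bounded S\<close>, of 0] ball_subset_cball by blast
  have "bounded (f ` cball 0 R)"
    by (intro compact_imp_bounded compact_continuous_image
        continuous_on_subset[OF lipschitz_on_continuous_on[OF f]]) auto
  then obtain B where B: "\<forall>y\<in>f ` cball 0 R. norm y \<le> B" unfolding bounded_iff by blast
  have "\<bar>f x\<bar> \<le> max 0 B" for x
    using B S(2)[of x] R
    by (cases "x \<in> cball 0 R") (force simp: max_def simp del: mem_cball_0)+
  then show thesis by (intro that[of "max 0 B"]) auto
qed

lemma lipschitz_integrable:
  fixes f :: "'a::euclidean_space \<Rightarrow> real"
  assumes f: "L-lipschitz_on UNIV f" and S: "bounded S" "\<And>x. x \<notin> S \<Longrightarrow> f x = 0"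
  shows "integrable lebesgue f"
proof -
  obtain B where "B \<ge> 0" "\<And>x. \<bar>f x\<bar> \<le> B" using lipschitz_bounded_range[OF f S] by blast
  then show ?thesis
    by (intro integrable_bounded_support[OF lipschitz_borel_measurable[OF f] S, of B]) auto
qed

text \<open>A tent of slope c around K which reaches 0 at distance 1/c. Since
  \<open>infdist x {}\<close> is 0, the tent over the empty set is constantly 1, which is why K
  \<noteq> {} is required where it should vanish.\<close>

definition infdist_bump :: "'a::metric_space set \<Rightarrow> real \<Rightarrow> 'a \<Rightarrow> real" where
  "infdist_bump K c x = max 0 (1 - c * infdist x K)"

lemma lipschitz_on_max_const:
  fixes f :: "'a::metric_space \<Rightarrow> real"
  assumes "L-lipschitz_on S f"
  shows "L-lipschitz_on S (\<lambda>x. max c (f x))"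
proof (rule lipschitz_onI)
  fix x y assume "x \<in> S" "y \<in> S"
  then show "dist (max c (f x)) (max c (f y)) \<le> L * dist x y"
    using lipschitz_onD[OF assms, of x y] by (auto simp: dist_real_def max_def)
qed (use assms lipschitz_on_nonneg in blast)

lemma lipschitz_infdist_bump:
  assumes "c \<ge> 0"
  shows "c-lipschitz_on UNIV (infdist_bump K c)"
  unfolding infdist_bump_def[abs_def]
proof (rule lipschitz_on_max_const, rule lipschitz_onI)
  fix x y
  have "\<bar>infdist x K - infdist y K\<bar> \<le> dist x y"
    using infdist_triangle[of x K y] infdist_triangle[of y K x] by (auto simp: dist_commute)
  then have "c * \<bar>infdist x K - infdist y K\<bar> \<le> c * dist x y" using assms by (rule mult_left_mono)
  moreover have "dist (1 - c * infdist x K) (1 - c * infdist y K) = c * \<bar>infdist x K - infdist y K\<bar>"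
  proof -
    have "1 - c * infdist x K - (1 - c * infdist y K) = - (c * (infdist x K - infdist y K))"
      by (simp add: algebra_simps)
    then show ?thesis using assms by (simp only: dist_real_def abs_minus_cancel abs_mult abs_of_nonneg)
  qed
  ultimately show "dist (1 - c * infdist x K) (1 - c * infdist y K) \<le> c * dist x y" by simp
qed (use assms in auto)

lemma infdist_bump_bounds: "c \<ge> 0 \<Longrightarrow> 0 \<le> infdist_bump K c x \<and> infdist_bump K c x \<le> 1"
  by (auto simp: infdist_bump_def infdist_nonneg)

lemma infdist_bump_eq_1: "x \<in> K \<Longrightarrow> infdist_bump K c x = 1"
  by (auto simp: infdist_bump_def)

text \<open>A compact set and a disjoint closed set have positive distance d, and the tent of slope
  n vanishes at distance 1/n; so n \<ge> 1/d suffices.\<close>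

lemma eventually_infdist_bump_eq_0:
  fixes K :: "'a::heine_borel set"
  assumes "compact K" "K \<noteq> {}" "open U" "K \<subseteq> U"
  shows "\<forall>\<^sub>F n::nat in sequentially. \<forall>x. x \<notin> U \<longrightarrow> infdist_bump K (real n) x = 0"
proof -
  have "closed (- U)" "K \<inter> - U = {}" using assms by auto
  from separate_compact_closed[OF \<open>compact K\<close> this]
  obtain d where d: "d > 0" "\<forall>x\<in>K. \<forall>y\<in>-U. d \<le> dist x y" by blast
  have "d \<le> infdist y K" if "y \<notin> U" for y
    unfolding infdist_notempty[OF \<open>K \<noteq> {}\<close>]
    by (rule cINF_greatest) (use assms d that in \<open>auto simp: dist_commute\<close>)
  moreover have "\<forall>\<^sub>F n in sequentially. 1 / d \<le> real n"
    using eventually_ge_at_top[of "nat \<lceil>1 / d\<rceil>"] by eventually_elim linarith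
  then have "\<forall>\<^sub>F n in sequentially. 1 \<le> real n * d"
    by eventually_elim (use d in \<open>simp add: field_simps\<close>)
  ultimately show ?thesis
  proof (elim eventually_mono, intro allI impI)
    fix n x assume "1 \<le> real n * d" "x \<notin> U" and *: "\<And>y. y \<notin> U \<Longrightarrow> d \<le> infdist y K"
    then have "1 \<le> real n * infdist x K"
      by (meson mult_left_mono of_nat_0_le_iff order_trans)
    then show "infdist_bump K (real n) x = 0" by (simp add: infdist_bump_def)
  qed
qed

text \<open>Inner regularity provides a compact K in S with |S - K| < e/2. The tents over K converge
  pointwise to the indicator of K and are eventually dominated by the indicator of U.\<close>

lemma Lipschitz_dense_L1_indicator:
  fixes U :: "'a::euclidean_space set" and e :: real
  assumes U: "open U" "bounded U" and S: "S \<in> sets lebesgue" "S \<subseteq> U" and e: "e > 0"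
  shows "\<exists>\<psi> L. L-lipschitz_on UNIV \<psi> \<and> (\<forall>x. x \<notin> U \<longrightarrow> \<psi> x = 0) \<and>
    (\<integral>x. \<bar>indicator S x - \<psi> x :: real\<bar> \<partial>lebesgue) < e"
proof -
  obtain K where K: "closed K" "K \<subseteq> S" "S - K \<in> lmeasurable" "emeasure lebesgue (S - K) < ennreal (e/2)"
    using sets_lebesgue_inner_closed[OF S(1), of "e/2"] e by auto
  have cK: "compact K" using K S U by (meson bounded_subset compact_eq_bounded_closed subset_trans)
  have mS: "S \<in> lmeasurable" using S U
    by (meson bounded_set_imp_lmeasurable bounded_subset)
  have intS: "integrable lebesgue (indicator S :: 'a \<Rightarrow> real)"
    using mS by (auto simp: fmeasurable_def intro!: integrable_real_indicator)
  have mSK: "measure lebesgue (S - K) < e/2"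
    using K(3,4) e by (metis emeasure_eq_measure2 ennreal_less_iff fmeasurable_def measure_nonneg)
  show ?thesis
  \<comment> \<open>For empty K the zero function is close enough, because then |S| itself is below
    e/2.\<close>
  proof (cases "K = {}")
    case True
    have "(\<integral>x. \<bar>indicator S x - 0::real\<bar> \<partial>lebesgue) = measure lebesgue S" using mS by simp
    then show ?thesis using mSK True e
      by (intro exI[of _ "\<lambda>x. 0"] exI[of _ 0]) (auto simp: lipschitz_on_constant)
  next
    case False
    define \<psi> where "\<psi> = (\<lambda>n::nat. infdist_bump K (real n))"
    have "K \<subseteq> U" using K(2) S(2) by auto
    from eventually_infdist_bump_eq_0[OF cK False U(1) this]
    obtain N where N: "\<And>n x. n \<ge> N \<Longrightarrow> x \<notin> U \<Longrightarrow> \<psi> n x = 0"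
      unfolding eventually_sequentially \<psi>_def by blast
    \<comment> \<open>The tents vanish off U only from index N on; the shift makes the indicator of
      U a majorant for every n.\<close>
    define g where "g = (\<lambda>n x. \<bar>indicator S x - \<psi> (n + N) x\<bar>)"
    have lip: "(real n)-lipschitz_on UNIV (\<psi> n)" for n
      unfolding \<psi>_def by (rule lipschitz_infdist_bump) simp
    have lim: "(\<lambda>n. \<psi> n x) \<longlonglongrightarrow> indicator K x" for x
    proof (cases "x \<in> K")
      case True
      then show ?thesis by (simp add: \<psi>_def infdist_bump_eq_1)
    next
      case x: False
      then have "infdist x K > 0" using cK \<open>K \<noteq> {}\<close>
        by (metis compact_imp_closed in_closed_iff_infdist_zero infdist_nonneg less_eq_real_def)
      then have "\<forall>\<^sub>F n in sequentially. \<psi> n x = 0"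
        using eventually_infdist_bump_eq_0[OF cK False, of "-{x}"] x
        by (auto simp: \<psi>_def elim!: eventually_mono)
      then show ?thesis using x by (simp add: tendsto_eventually)
    qed
    have "(\<lambda>n. \<integral>x. g n x \<partial>lebesgue) \<longlonglongrightarrow> (\<integral>x. \<bar>indicator S x - indicator K x :: real\<bar> \<partial>lebesgue)"
    proof (rule integral_dominated_convergence[where w = "\<lambda>x. indicator U x"])
      show "AE x in lebesgue. (\<lambda>n. g n x) \<longlonglongrightarrow> \<bar>indicator S x - indicator K x\<bar>"
        unfolding g_def
        by (intro AE_I2 tendsto_intros LIMSEQ_ignore_initial_segment lim)
      show "AE x in lebesgue. norm (g n x) \<le> indicator U x" for n
      proof (intro AE_I2)
        fix x
        show "norm (g n x) \<le> indicator U x"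
          using infdist_bump_bounds[of "real (n+N)" K x] N[of "n+N" x] S(2)
          by (auto simp: g_def \<psi>_def indicator_def)
      qed
      show "(\<lambda>x. g n x) \<in> borel_measurable lebesgue" for n
        using lipschitz_borel_measurable[OF lip] S unfolding g_def by measurable
      show "(\<lambda>x. \<bar>indicator S x - indicator K x\<bar> :: real) \<in> borel_measurable lebesgue"
        using S K by (intro borel_measurable_abs borel_measurable_diff borel_measurable_indicator) auto
      show "integrable lebesgue (indicator U :: 'a \<Rightarrow> real)"
        using lmeasurable_open[OF U(2,1)] by (intro integrable_real_indicator) (auto simp: fmeasurable_def)
    qed
    also have "(\<integral>x. \<bar>indicator S x - indicator K x :: real\<bar> \<partial>lebesgue) = measure lebesgue (S - K)"
    proof -
      have "(\<lambda>x. \<bar>indicator S x - indicator K x :: real\<bar>) = indicator (S - K)"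
        using K(2) by (auto simp: indicator_def fun_eq_iff)
      then show ?thesis using K(3) by simp
    qed
    finally have "\<forall>\<^sub>F n in sequentially. (\<integral>x. g n x \<partial>lebesgue) < e"
      by (rule order_tendstoD(2)) (use mSK e in simp)
    then obtain n where "(\<integral>x. g n x \<partial>lebesgue) < e" by (auto simp: eventually_sequentially)
    then show ?thesis using N lip[of "n+N"]
      by (intro exI[of _ "\<psi> (n + N)"] exI[of _ "real (n + N)"]) (auto simp: g_def)
  qed
qed

lemma Lipschitz_dense_L1:
  fixes \<phi> :: "'a::euclidean_space \<Rightarrow> real"
  assumes \<phi>: "integrable lebesgue \<phi>" and U: "open U" "bounded U"
    and supp: "\<And>x. x \<notin> U \<Longrightarrow> \<phi> x = 0" and e: "e > 0"
  obtains \<psi> L where "L-lipschitz_on UNIV \<psi>" "\<And>x. x \<notin> U \<Longrightarrow> \<psi> x = 0"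
    "(\<integral>x. \<bar>\<phi> x - \<psi> x\<bar> \<partial>lebesgue) < e"
proof -
  \<comment> \<open>The factor \<open>indicator U\<close> is part of the predicate because the
    simple functions met during the induction need not vanish off U.\<close>
  define P where "P = (\<lambda>\<phi>::'a \<Rightarrow> real. \<forall>e>0. \<exists>\<psi> L. L-lipschitz_on UNIV \<psi> \<and> (\<forall>x. x \<notin> U \<longrightarrow> \<psi> x = 0)
     \<and> (\<integral>x. \<bar>indicator U x * \<phi> x - \<psi> x\<bar> \<partial>lebesgue) < e)"
  have [measurable]: "U \<in> sets lebesgue" using U by auto
  have Ui: "integrable lebesgue (\<lambda>x. indicator U x * \<phi> x)" if "integrable lebesgue \<phi>" for \<phi> :: "'a \<Rightarrow> real"
    using integrable_mult_indicator[OF _ that, of U] by simp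
  have "P \<phi>" using \<phi>
  proof (induct rule: integrable_induct)
    case (base A c)
    show ?case unfolding P_def
    proof (intro allI impI)
      fix e :: real assume "e > 0"
      then have "e / (\<bar>c\<bar> + 1) > 0" by simp
      then obtain \<psi> L where \<psi>: "L-lipschitz_on UNIV \<psi>" "\<forall>x. x \<notin> U \<longrightarrow> \<psi> x = 0"
        "(\<integral>x. \<bar>indicator (A \<inter> U) x - \<psi> x\<bar> \<partial>lebesgue) < e / (\<bar>c\<bar> + 1)"
        using Lipschitz_dense_L1_indicator[OF U, of "A \<inter> U" "e / (\<bar>c\<bar> + 1)"] base(1) by auto
      have "(\<integral>x. \<bar>indicator U x * (indicator A x *\<^sub>R c) - c * \<psi> x\<bar> \<partial>lebesgue)
        = (\<integral>x. \<bar>c\<bar> * \<bar>indicator (A \<inter> U) x - \<psi> x\<bar> \<partial>lebesgue)"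
        by (intro Bochner_Integration.integral_cong)
          (auto simp: indicator_def abs_mult[symmetric] algebra_simps abs_minus_commute)
      also have "\<dots> = \<bar>c\<bar> * (\<integral>x. \<bar>indicator (A \<inter> U) x - \<psi> x\<bar> \<partial>lebesgue)" by simp
      also have "\<dots> \<le> \<bar>c\<bar> * (e / (\<bar>c\<bar> + 1))" using \<psi> by (intro mult_left_mono) auto
      also have "\<dots> < e" using \<open>e > 0\<close> by (simp add: field_simps)
      finally show "\<exists>\<psi> L. L-lipschitz_on UNIV \<psi> \<and> (\<forall>x. x \<notin> U \<longrightarrow> \<psi> x = 0)
        \<and> (\<integral>x. \<bar>indicator U x * (indicator A x *\<^sub>R c) - \<psi> x\<bar> \<partial>lebesgue) < e"
        using \<psi> by (intro exI[of _ "\<lambda>x. c * \<psi> x"] exI[of _ "\<bar>c\<bar> * L"])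
          (auto intro!: lipschitz_on_cmult_real)
    qed
  next
    case (add f g)
    show ?case unfolding P_def
    proof (intro allI impI)
      fix e :: real assume "e > 0"
      then have e2: "e/2 > 0" by simp
      obtain \<psi> L where \<psi>: "L-lipschitz_on UNIV \<psi>" "\<forall>x. x \<notin> U \<longrightarrow> \<psi> x = 0"
        "(\<integral>x. \<bar>indicator U x * f x - \<psi> x\<bar> \<partial>lebesgue) < e/2"
        using add e2 unfolding P_def by meson
      obtain \<psi>' L' where \<psi>': "L'-lipschitz_on UNIV \<psi>'" "\<forall>x. x \<notin> U \<longrightarrow> \<psi>' x = 0"
        "(\<integral>x. \<bar>indicator U x * g x - \<psi>' x\<bar> \<partial>lebesgue) < e/2"
        using add e2 unfolding P_def by meson
      have i: "integrable lebesgue (\<lambda>x. \<bar>indicator U x * f x - \<psi> x\<bar>)"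
        "integrable lebesgue (\<lambda>x. \<bar>indicator U x * g x - \<psi>' x\<bar>)"
        using add \<psi> \<psi>' U
        by (auto intro!: integrable_abs Bochner_Integration.integrable_diff Ui lipschitz_integrable)
      have "(\<integral>x. \<bar>indicator U x * (f x + g x) - (\<psi> x + \<psi>' x)\<bar> \<partial>lebesgue)
        \<le> (\<integral>x. \<bar>indicator U x * f x - \<psi> x\<bar> + \<bar>indicator U x * g x - \<psi>' x\<bar> \<partial>lebesgue)"
      proof (rule integral_mono')
        fix x
        have "indicator U x * (f x + g x) - (\<psi> x + \<psi>' x) =
          (indicator U x * f x - \<psi> x) + (indicator U x * g x - \<psi>' x)" by (simp add: algebra_simps)
        then show "\<bar>indicator U x * (f x + g x) - (\<psi> x + \<psi>' x)\<bar>
          \<le> \<bar>indicator U x * f x - \<psi> x\<bar> + \<bar>indicator U x * g x - \<psi>' x\<bar>"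
          by (metis abs_triangle_ineq)
      qed (use i in auto)
      also have "\<dots> < e" using i \<psi>(3) \<psi>'(3) by simp
      finally show "\<exists>\<psi> L. L-lipschitz_on UNIV \<psi> \<and> (\<forall>x. x \<notin> U \<longrightarrow> \<psi> x = 0)
        \<and> (\<integral>x. \<bar>indicator U x * (f x + g x) - \<psi> x\<bar> \<partial>lebesgue) < e"
        using \<psi> \<psi>' by (intro exI[of _ "\<lambda>x. \<psi> x + \<psi>' x"] exI[of _ "L + L'"])
          (auto intro!: lipschitz_on_add)
    qed
  next
    case (lim f s)
    show ?case unfolding P_def
    proof (intro allI impI)
      fix e :: real assume "e > 0"
      then have e2: "e/2 > 0" by simp
      have "(\<lambda>i. \<integral>x. \<bar>indicator U x * f x - indicator U x * s i x\<bar> \<partial>lebesgue) \<longlonglongrightarrow> integral\<^sup>L lebesgue (\<lambda>x::'a. 0)"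
      \<comment> \<open>The approximants of the induction rule satisfy |s i x| \<le> 2 |f x|, so
        their distance to f is at most 3 |f x|.\<close>
      proof (rule integral_dominated_convergence[where w = "\<lambda>x. 3 * \<bar>f x\<bar>"])
        show "AE x in lebesgue. (\<lambda>i. \<bar>indicator U x * f x - indicator U x * s i x\<bar>) \<longlonglongrightarrow> 0"
        proof (rule AE_I2)
          fix x :: 'a
          have "(\<lambda>i. \<bar>indicator U x * f x - indicator U x * s i x\<bar>) \<longlonglongrightarrow>
            \<bar>indicator U x * f x - indicator U x * f x\<bar>"
            using lim(3)[of x] by (intro tendsto_intros) auto
          then show "(\<lambda>i. \<bar>indicator U x * f x - indicator U x * s i x\<bar>) \<longlonglongrightarrow> 0" by simp
        qed
        show "AE x in lebesgue. norm \<bar>indicator U x * f x - indicator U x * s i x\<bar> \<le> 3 * \<bar>f x\<bar>" for i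
        proof (rule AE_I2)
          fix x :: 'a
          show "norm \<bar>indicator U x * f x - indicator U x * s i x\<bar> \<le> 3 * \<bar>f x\<bar>"
            using lim(4)[of x i] by (auto simp: indicator_def)
        qed
        show "(\<lambda>x. \<bar>indicator U x * f x - indicator U x * s i x\<bar>) \<in> borel_measurable lebesgue" for i
          using lim(1)[of i] lim(5) by (intro borel_measurable_abs borel_measurable_diff
              borel_measurable_integrable Ui) auto
      qed (use lim in auto)
      then have "(\<lambda>i. \<integral>x. \<bar>indicator U x * f x - indicator U x * s i x\<bar> \<partial>lebesgue) \<longlonglongrightarrow> 0" by simp
      then have "\<forall>\<^sub>F i in sequentially. (\<integral>x. \<bar>indicator U x * f x - indicator U x * s i x\<bar> \<partial>lebesgue) < e/2"
        by (rule order_tendstoD(2)) (use e2 in simp)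
      then obtain i where i: "(\<integral>x. \<bar>indicator U x * f x - indicator U x * s i x\<bar> \<partial>lebesgue) < e/2"
        by (auto simp: eventually_sequentially)
      obtain \<psi> L where \<psi>: "L-lipschitz_on UNIV \<psi>" "\<forall>x. x \<notin> U \<longrightarrow> \<psi> x = 0"
        "(\<integral>x. \<bar>indicator U x * s i x - \<psi> x\<bar> \<partial>lebesgue) < e/2"
        using lim(2)[of i] e2 unfolding P_def by meson
      have j: "integrable lebesgue (\<lambda>x. \<bar>indicator U x * f x - indicator U x * s i x\<bar>)"
        "integrable lebesgue (\<lambda>x. \<bar>indicator U x * s i x - \<psi> x\<bar>)"
        using lim(1)[of i] lim(5) \<psi> U
        by (auto intro!: integrable_abs Bochner_Integration.integrable_diff Ui lipschitz_integrable)
      have "(\<integral>x. \<bar>indicator U x * f x - \<psi> x\<bar> \<partial>lebesgue)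
        \<le> (\<integral>x. \<bar>indicator U x * f x - indicator U x * s i x\<bar> + \<bar>indicator U x * s i x - \<psi> x\<bar> \<partial>lebesgue)"
        by (rule integral_mono') (use j in auto)
      also have "\<dots> < e" using i j \<psi>(3) by simp
      finally show "\<exists>\<psi> L. L-lipschitz_on UNIV \<psi> \<and> (\<forall>x. x \<notin> U \<longrightarrow> \<psi> x = 0)
        \<and> (\<integral>x. \<bar>indicator U x * f x - \<psi> x\<bar> \<partial>lebesgue) < e"
        using \<psi> by blast
    qed
  qed
  moreover have "(\<lambda>x. indicator U x * \<phi> x) = \<phi>" using supp by (auto simp: indicator_def fun_eq_iff)
  ultimately have "\<exists>\<psi> L. L-lipschitz_on UNIV \<psi> \<and> (\<forall>x. x \<notin> U \<longrightarrow> \<psi> x = 0)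
     \<and> (\<integral>x. \<bar>\<phi> x - \<psi> x\<bar> \<partial>lebesgue) < e"
  proof -
    assume 1: "P \<phi>" and 2: "(\<lambda>x. indicator U x * \<phi> x) = \<phi>"
    have "indicator U x * \<phi> x = \<phi> x" for x using 2 by metis
    then show ?thesis using 1 e unfolding P_def by (simp only:)
  qed
  then show thesis using that by blast
qed

text \<open>The ideal test function is h restricted to a ball, because its pairing with h is the
  integral of the square of h over that ball. Density in \<open>L^1\<close> together with
  boundedness of h makes it admissible up to an arbitrarily small error.\<close>

lemma AE_eq_0_if_Lipschitz_tests:
  fixes h :: "'a::euclidean_space \<Rightarrow> real"
  assumes h: "h \<in> borel_measurable lebesgue" "\<And>x. \<bar>h x\<bar> \<le> C"
    and test: "\<And>\<psi> L S. L-lipschitz_on UNIV \<psi> \<Longrightarrow> bounded S \<Longrightarrow> (\<And>x. x \<notin> S \<Longrightarrow> \<psi> x = 0) \<Longrightarrow>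
      (\<integral>x. h x * \<psi> x \<partial>lebesgue) = 0"
  shows "AE x in lebesgue. h x = 0"
proof -
  have C: "C \<ge> 0" using h(2)[of 0] by linarith
  have "AE x in lebesgue. x \<in> ball 0 (real n) \<longrightarrow> h x = 0" for n
  proof -
    define U where "U = ball (0::'a) (real n)"
    define \<phi> where "\<phi> = (\<lambda>x. indicator U x * h x)"
    have U: "open U" "bounded U" by (auto simp: U_def)
    have U': "U \<in> sets lebesgue" using U by auto
    have m: "\<phi> \<in> borel_measurable lebesgue" using h U' unfolding \<phi>_def by measurable
    have i: "integrable lebesgue \<phi>"
      by (rule integrable_bounded_support[OF m U(2), of C])
        (use h C in \<open>auto simp: \<phi>_def indicator_def\<close>)
    have \<phi>C: "\<bar>\<phi> x\<bar> \<le> C" for x using h(2)[of x] C by (auto simp: \<phi>_def indicator_def)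
    have i2: "integrable lebesgue (\<lambda>x. h x * \<phi> x)"
    proof (rule integrable_bounded_support[OF _ U(2), of _ "C * C"])
      show "AE x in lebesgue. \<bar>h x * \<phi> x\<bar> \<le> C * C"
        unfolding abs_mult by (intro AE_I2 mult_mono h \<phi>C) (use C in auto)
    qed (use h m in \<open>auto simp: \<phi>_def\<close>)
    have nn: "0 \<le> h x * \<phi> x" for x by (simp add: \<phi>_def indicator_def)
    have "(\<integral>x. h x * \<phi> x \<partial>lebesgue) \<le> 0"
    proof (rule field_le_epsilon)
      fix e :: real assume "e > 0"
      then have "e / (C + 1) > 0" using C by simp
      then obtain \<psi> L where \<psi>: "L-lipschitz_on UNIV \<psi>" "\<And>x. x \<notin> U \<Longrightarrow> \<psi> x = 0"
        "(\<integral>x. \<bar>\<phi> x - \<psi> x\<bar> \<partial>lebesgue) < e / (C + 1)"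
        by (rule Lipschitz_dense_L1[OF i U, rotated]) (auto simp: \<phi>_def)
      have i\<psi>: "integrable lebesgue \<psi>" by (rule lipschitz_integrable[OF \<psi>(1) U(2) \<psi>(2)])
      obtain B where B: "\<And>x. \<bar>\<psi> x\<bar> \<le> B" using lipschitz_bounded_range[OF \<psi>(1) U(2) \<psi>(2)] by blast
      have i3: "integrable lebesgue (\<lambda>x. h x * \<psi> x)"
      proof (rule integrable_bounded_support[OF _ U(2), of _ "C * B"])
        show "AE x in lebesgue. \<bar>h x * \<psi> x\<bar> \<le> C * B"
          unfolding abs_mult by (intro AE_I2 mult_mono h B) (use C in auto)
      qed (use h lipschitz_borel_measurable[OF \<psi>(1)] \<psi>(2) in auto)
      have "(\<integral>x. h x * \<phi> x \<partial>lebesgue) = (\<integral>x. h x * \<phi> x - h x * \<psi> x \<partial>lebesgue)"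
        using i2 i3 test[OF \<psi>(1) U(2) \<psi>(2)] by simp
      also have "\<dots> \<le> (\<integral>x. C * \<bar>\<phi> x - \<psi> x\<bar> \<partial>lebesgue)"
      proof (rule integral_mono)
        fix x
        have "h x * (\<phi> x - \<psi> x) \<le> \<bar>h x\<bar> * \<bar>\<phi> x - \<psi> x\<bar>" by (metis abs_ge_self abs_mult)
        also have "\<dots> \<le> C * \<bar>\<phi> x - \<psi> x\<bar>" using h(2)[of x] by (intro mult_right_mono) auto
        finally show "h x * \<phi> x - h x * \<psi> x \<le> C * \<bar>\<phi> x - \<psi> x\<bar>" by (simp add: algebra_simps)
      qed (use i i2 i3 i\<psi> in auto)
      also have "\<dots> = C * (\<integral>x. \<bar>\<phi> x - \<psi> x\<bar> \<partial>lebesgue)" by simp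
      also have "\<dots> \<le> C * (e / (C + 1))" using \<psi>(3) C by (intro mult_left_mono) auto
      also have "\<dots> \<le> e" using C \<open>e > 0\<close> by (simp add: field_simps)
      finally show "(\<integral>x. h x * \<phi> x \<partial>lebesgue) \<le> 0 + e" by simp
    qed
    moreover have "(\<integral>x. h x * \<phi> x \<partial>lebesgue) \<ge> 0" by (rule Bochner_Integration.integral_nonneg) (rule nn)
    ultimately have "AE x in lebesgue. h x * \<phi> x = 0"
      using integral_nonneg_eq_0_iff_AE[OF i2] nn by simp
    then show ?thesis by eventually_elim (auto simp: \<phi>_def U_def)
  qed
  then have "AE x in lebesgue. \<forall>n. x \<in> ball 0 (real n) \<longrightarrow> h x = 0" unfolding AE_all_countable by blast
  then show ?thesis
  proof eventually_elim
    fix x :: 'a assume *: "\<forall>n. x \<in> ball 0 (real n) \<longrightarrow> h x = 0"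
    obtain n :: nat where "norm x < real n" using reals_Archimedean2 by blast
    then show "h x = 0" using * by auto
  qed
qed

section \<open>Rademacher's theorem\<close>

context
  fixes f :: "'a::euclidean_space \<Rightarrow> real" and L :: real
  assumes lip: "L-lipschitz_on UNIV f"
begin

lemma lipschitz_UNIV_const_nonneg: "L \<ge> 0" using lip lipschitz_on_nonneg by blast

lemma lipschitz_UNIV_continuous_on: "continuous_on S f"
  using lipschitz_on_continuous_on[OF lip] continuous_on_subset by blast

lemma lipschitz_UNIV_abs_diff_le: "\<bar>f x - f y\<bar> \<le> L * norm (x - y)"
  using lipschitz_onD[OF lip, of x y] by (simp add: dist_real_def dist_norm)

definition line_differentiable :: "'a \<Rightarrow> 'a set" where
  "line_differentiable v = {x. (\<lambda>t. f (x + t *\<^sub>R v)) differentiable (at (0::real))}"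

definition line_deriv :: "'a \<Rightarrow> 'a \<Rightarrow> real" where
  "line_deriv v x = deriv (\<lambda>t. f (x + t *\<^sub>R v)) (0::real)"

lemma line_deriv_DERIV:
  "x \<in> line_differentiable v \<Longrightarrow> ((\<lambda>t. f (x + t *\<^sub>R v)) has_real_derivative line_deriv v x) (at 0)"
  by (simp add: line_differentiable_def line_deriv_def DERIV_deriv_iff_real_differentiable)

lemma line_deriv_lim:
  "x \<in> line_differentiable v \<Longrightarrow> ((\<lambda>t. (f (x + t *\<^sub>R v) - f x) / t) \<longlongrightarrow> line_deriv v x) (at (0::real))"
  using line_deriv_DERIV[of x v] by (simp add: DERIV_def)

text \<open>The Cauchy criterion eliminates the unknown derivative and leaves countable quantifiers
  over m and n. The inner inequality is non-strict so that it defines a closed set.\<close>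

lemma line_differentiable_Cauchy:
  "x \<in> line_differentiable v \<longleftrightarrow> (\<forall>m::nat. \<exists>n::nat. \<forall>s t. s \<noteq> 0 \<and> \<bar>s\<bar> < 1 / Suc n \<and> t \<noteq> 0 \<and> \<bar>t\<bar> < 1 / Suc n \<longrightarrow>
     \<bar>(f (x + s *\<^sub>R v) - f x) / s - (f (x + t *\<^sub>R v) - f x) / t\<bar> \<le> 1 / Suc m)"
proof -
  define q where "q = (\<lambda>t::real. (f (x + t *\<^sub>R v) - f x) / t)"
  have "x \<in> line_differentiable v \<longleftrightarrow> (\<exists>d. (q \<longlongrightarrow> d) (at 0))"
    by (auto simp: line_differentiable_def real_differentiable_def DERIV_def q_def)
  also have "\<dots> \<longleftrightarrow> (\<forall>m::nat. \<exists>n::nat. \<forall>s t. s \<noteq> 0 \<and> \<bar>s\<bar> < 1 / Suc n \<and> t \<noteq> 0 \<and> \<bar>t\<bar> < 1 / Suc n \<longrightarrow>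
     \<bar>q s - q t\<bar> \<le> 1 / Suc m)" (is "_ \<longleftrightarrow> ?C")
  proof
    assume "\<exists>d. (q \<longlongrightarrow> d) (at 0)"
    then obtain d where d: "(q \<longlongrightarrow> d) (at 0)" ..
    show ?C
    proof
      fix m :: nat
      have "\<forall>\<^sub>F t in at 0. dist (q t) d < 1 / (2 * Suc m)"
        using d by (rule tendstoD) simp
      then obtain e where e: "e > 0" "\<And>t. t \<noteq> 0 \<Longrightarrow> \<bar>t\<bar> < e \<Longrightarrow> \<bar>q t - d\<bar> < 1 / (2 * Suc m)"
        by (auto simp: eventually_at dist_real_def)
      obtain n where n: "1 / real (Suc n) < e" using e(1) nat_approx_posE by blast
      show "\<exists>n::nat. \<forall>s t. s \<noteq> 0 \<and> \<bar>s\<bar> < 1 / Suc n \<and> t \<noteq> 0 \<and> \<bar>t\<bar> < 1 / Suc n \<longrightarrow> \<bar>q s - q t\<bar> \<le> 1 / Suc m"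
      proof (intro exI allI impI)
        fix s t :: real assume st: "s \<noteq> 0 \<and> \<bar>s\<bar> < 1 / Suc n \<and> t \<noteq> 0 \<and> \<bar>t\<bar> < 1 / Suc n"
        have "\<bar>q s - d\<bar> < 1 / (2 * Suc m)" "\<bar>q t - d\<bar> < 1 / (2 * Suc m)"
          using e(2)[of s] e(2)[of t] st n by auto
        moreover have "1 / (2 * Suc m) + 1 / (2 * Suc m) = 1 / real (Suc m)" by (simp add: field_simps)
        ultimately show "\<bar>q s - q t\<bar> \<le> 1 / Suc m"
          using abs_triangle_ineq4[of "q s - d" "q t - d"] by simp
      qed
    qed
  next
    assume C: ?C
    have "cauchy_filter (filtermap q (at 0))"
      unfolding cauchy_filter_metric_filtermap
    proof (intro allI impI)
      fix e :: real assume "e > 0"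
      then obtain m where m: "1 / real (Suc m) < e" using nat_approx_posE by blast
      obtain n where n: "\<forall>s t. s \<noteq> 0 \<and> \<bar>s\<bar> < 1 / Suc n \<and> t \<noteq> 0 \<and> \<bar>t\<bar> < 1 / Suc n \<longrightarrow> \<bar>q s - q t\<bar> \<le> 1 / Suc m"
        using C by blast
      show "\<exists>P. eventually P (at 0) \<and> (\<forall>x y. P x \<and> P y \<longrightarrow> dist (q x) (q y) < e)"
      proof (intro exI conjI allI impI)
        show "\<forall>\<^sub>F t in at 0. t \<noteq> 0 \<and> \<bar>t\<bar> < 1 / real (Suc n)"
          unfolding eventually_at by (intro exI[of _ "1 / real (Suc n)"]) auto
        fix s t :: real assume "(s \<noteq> 0 \<and> \<bar>s\<bar> < 1 / real (Suc n)) \<and> (t \<noteq> 0 \<and> \<bar>t\<bar> < 1 / real (Suc n))"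
        then have "\<bar>q s - q t\<bar> \<le> 1 / Suc m" using n by blast
        then show "dist (q s) (q t) < e" using m by (simp add: dist_real_def)
      qed
    qed
    moreover have "filtermap q (at 0) \<noteq> bot" by (simp add: filtermap_bot_iff)
    ultimately obtain d where "filtermap q (at 0) \<le> nhds d"
      using complete_UNIV[where 'a=real] unfolding complete_uniform by auto
    then show "\<exists>d. (q \<longlongrightarrow> d) (at 0)" by (auto simp: filterlim_def)
  qed
  finally show ?thesis by (simp add: q_def)
qed

text \<open>For fixed m and n the conditions over the uncountably many pairs (s,t) are closed, hence
  so is their intersection; only countable operations remain outside.\<close>

lemma borel_line_differentiable: "line_differentiable v \<in> sets borel"
proof -
  define Q where "Q = (\<lambda>m s t. {x. \<bar>(f (x + s *\<^sub>R v) - f x) / s - (f (x + t *\<^sub>R v) - f x) / t\<bar> \<le> 1 / real (Suc m)})"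
  define A where "A = (\<lambda>n::nat. {(s,t). s \<noteq> 0 \<and> \<bar>s\<bar> < 1 / real (Suc n) \<and> t \<noteq> 0 \<and> \<bar>t\<bar> < 1 / real (Suc n)})"
  have cl: "closed (\<Inter>p\<in>A n. Q m (fst p) (snd p))" for m n
    unfolding Q_def A_def
    by (intro closed_INT ballI closed_Collect_le continuous_intros continuous_on_compose2[OF lipschitz_UNIV_continuous_on[of UNIV]]) auto
  have "line_differentiable v = (\<Inter>m::nat. \<Union>n::nat. \<Inter>p\<in>A n. Q m (fst p) (snd p))"
    using line_differentiable_Cauchy unfolding A_def Q_def by (auto 0 3)
  moreover have "(\<Inter>m::nat. \<Union>n::nat. \<Inter>p\<in>A n. Q m (fst p) (snd p)) \<in> sets borel"
    by (intro sets.countable_INT'' sets.countable_UN'' borel_closed cl) auto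
  ultimately show ?thesis by simp
qed

text \<open>The one-dimensional theorem says that every line in direction v meets the exceptional
  set N in a null set of parameters. Integrating the indicator of N at x + t v over both variables
  and using translation invariance in x turns this into |N| = 0, without any rotation of
  coordinates.\<close>

lemma AE_line_differentiable: "AE x in lborel. x \<in> line_differentiable v"
proof -
  define N where "N = - line_differentiable v"
  have N: "N \<in> sets borel" unfolding N_def using borel_line_differentiable by auto
  have slice: "AE t in lborel. x + t *\<^sub>R v \<notin> N" for x
  proof -
    have "(L * norm v)-lipschitz_on UNIV (\<lambda>t. f (x + t *\<^sub>R v))"
    proof (rule lipschitz_onI)
      fix s t :: real
      have "\<bar>f (x + s *\<^sub>R v) - f (x + t *\<^sub>R v)\<bar> \<le> L * norm ((s - t) *\<^sub>R v)"
        using lipschitz_UNIV_abs_diff_le[of "x + s *\<^sub>R v" "x + t *\<^sub>R v"] by (simp add: algebra_simps)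
      then show "dist (f (x + s *\<^sub>R v)) (f (x + t *\<^sub>R v)) \<le> L * norm v * dist s t"
        by (simp add: dist_real_def mult_ac)
    qed (use lipschitz_UNIV_const_nonneg in auto)
    from Lipschitz_real_AE_differentiable[OF this] show ?thesis
    proof eventually_elim
      fix t assume "(\<lambda>t. f (x + t *\<^sub>R v)) differentiable (at t)"
      then obtain d where "((\<lambda>t. f (x + t *\<^sub>R v)) has_real_derivative d) (at (0 + t))"
        by (auto simp: real_differentiable_def)
      then have "((\<lambda>s. f (x + (s + t) *\<^sub>R v)) has_real_derivative d) (at 0)"
        by (simp only: DERIV_shift)
      then show "x + t *\<^sub>R v \<notin> N"
        unfolding N_def line_differentiable_def
        by (auto simp: real_differentiable_def algebra_simps)
    qed
  qed
  have pair: "pair_sigma_finite (lborel :: 'a measure) (lborel :: real measure)" ..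
  have [measurable]: "(\<lambda>(x, t). x + t *\<^sub>R v) \<in> borel_measurable (borel \<Otimes>\<^sub>M borel)"
    by (simp add: borel_prod split_def) (intro borel_measurable_continuous_onI continuous_intros)
  \<comment> \<open>Restricting t to an interval of length one makes the double integral equal to
    |N|.\<close>
  define g where "g = (\<lambda>(x, t). indicator N (x + t *\<^sub>R v) * indicator {0..1::real} t :: ennreal)"
  have g: "g \<in> borel_measurable (lborel \<Otimes>\<^sub>M lborel)"
    unfolding g_def using N by (simp add: split_def) measurable
  have "0 = (\<integral>\<^sup>+x. (\<integral>\<^sup>+t. g (x, t) \<partial>lborel) \<partial>lborel)"
  proof -
    have "(\<integral>\<^sup>+t. g (x, t) \<partial>lborel) = (\<integral>\<^sup>+(t::real). 0 \<partial>lborel)" for x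
      by (rule nn_integral_cong_AE) (use slice[of x] in eventually_elim, auto simp: g_def)
    then show ?thesis by simp
  qed
  also have "\<dots> = (\<integral>\<^sup>+t. (\<integral>\<^sup>+x. g (x, t) \<partial>lborel) \<partial>lborel)"
    by (rule pair_sigma_finite.Fubini[OF pair g, symmetric])
  also have "\<dots> = (\<integral>\<^sup>+t. emeasure lborel N * indicator {0..1::real} t \<partial>lborel)"
  proof (rule nn_integral_cong)
    fix t :: real
    have "(\<integral>\<^sup>+x. g (x, t) \<partial>lborel) = (\<integral>\<^sup>+x. indicator N (t *\<^sub>R v + x) \<partial>lborel) * indicator {0..1} t"
      using N by (simp add: g_def nn_integral_multc add.commute)
    also have "(\<integral>\<^sup>+x. indicator N (t *\<^sub>R v + x) \<partial>lborel) = (\<integral>\<^sup>+x. indicator N x \<partial>distr lborel borel ((+) (t *\<^sub>R v)))"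
      using N by (subst nn_integral_distr) auto
    also have "\<dots> = emeasure lborel N" using N by (simp add: lborel_distr_plus)
    finally show "(\<integral>\<^sup>+x. g (x, t) \<partial>lborel) = emeasure lborel N * indicator {0..1} t" .
  qed
  also have "\<dots> = emeasure lborel N" by (simp add: nn_integral_cmult)
  finally have "N \<in> null_sets lborel" using N by auto
  then show ?thesis by (rule AE_I') (auto simp: N_def)
qed

lemma line_deriv_scale:
  assumes "x \<in> line_differentiable v"
  shows "line_deriv (c *\<^sub>R v) x = c * line_deriv v x"
proof -
  have "((\<lambda>t. f (x + (c * t) *\<^sub>R v)) has_real_derivative line_deriv v x * c) (at 0)"
    by (rule DERIV_chain'[of "\<lambda>t. c * t" c 0 UNIV "\<lambda>t. f (x + t *\<^sub>R v)", simplified])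
      (use line_deriv_DERIV[OF assms] in \<open>auto intro!: derivative_eq_intros\<close>)
  then show ?thesis unfolding line_deriv_def[of "c *\<^sub>R v"]
    by (intro DERIV_imp_deriv) (simp add: mult.commute)
qed

lemma lipschitz_difference_quotient_bound: "\<bar>(f (x + t *\<^sub>R v) - f x) / t\<bar> \<le> L * norm v"
proof (cases "t = 0")
  case False
  then show ?thesis using lipschitz_UNIV_abs_diff_le[of "x + t *\<^sub>R v" x] by (simp add: field_simps)
qed (use lipschitz_UNIV_const_nonneg in simp)

lemma lborel_integral_translate:
  fixes g :: "'a \<Rightarrow> real"
  assumes "g \<in> borel_measurable borel"
  shows "(\<integral>x. g (x + c) \<partial>lborel) = (\<integral>x. g x \<partial>lborel)"
proof -
  have "(\<integral>x. g x \<partial>lborel) = (\<integral>x. g x \<partial>distr lborel borel ((+) c))" by (simp add: lborel_distr_plus)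
  also have "\<dots> = (\<integral>x. g (c + x) \<partial>lborel)" by (rule integral_distr) (use assms in auto)
  finally show ?thesis by (simp add: add.commute)
qed

text \<open>After a translation, the second difference \<open>\<Delta>\<^sub>u \<Delta>\<^sub>v f\<close> tested against \<open>\<psi>\<close>
  puts one difference on \<open>\<psi>\<close>; both factors are then \<open>O(k)\<close>, so division by \<open>k\<close> still leaves 0 in the limit.\<close>
lemma second_difference_test:
  assumes \<psi>: "M-lipschitz_on UNIV \<psi>" and S: "S = cball 0 r" "\<And>x. x \<notin> S \<Longrightarrow> \<psi> x = 0" and k: "0 < k" "k \<le> 1"
  shows "\<bar>\<integral>x. (f (x + k *\<^sub>R u + k *\<^sub>R v) - f (x + k *\<^sub>R u) - f (x + k *\<^sub>R v) + f x) / k * \<psi> x \<partial>lborel\<bar>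
    \<le> k * (L * norm u * (M * norm v) * measure lborel (cball (0::'a) (r + norm v)))"
proof -
  define F where "F = (\<lambda>x. f (x + k *\<^sub>R u) - f x)"
  have M: "M \<ge> 0" using \<psi> lipschitz_on_nonneg by blast
  have c\<psi>: "continuous_on UNIV \<psi>" using lipschitz_on_continuous_on[OF \<psi>] .
  have cF: "continuous_on UNIV F" unfolding F_def
    by (intro continuous_intros continuous_on_compose2[OF lipschitz_UNIV_continuous_on[of UNIV]]) auto
  have F: "\<bar>F x\<bar> \<le> L * (k * norm u)" for x
    using lipschitz_UNIV_abs_diff_le[of "x + k *\<^sub>R u" x] k by (simp add: F_def)
  \<comment> \<open>Since k \<le> 1, this ball contains the support of \<psi> and also the support
    translated by k v.\<close>
  define S' where "S' = cball (0::'a) (r + norm v)"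
  have kv: "norm (k *\<^sub>R v) \<le> norm v" using k by (simp add: mult_left_le_one_le)
  have supp: "\<psi> (x - k *\<^sub>R v) = 0" "\<psi> x = 0" if "x \<notin> S'" for x
  proof -
    have "norm x > r + norm v" using that by (simp add: S'_def)
    moreover have "norm x \<le> norm (x - k *\<^sub>R v) + norm (k *\<^sub>R v)" by (metis diff_add_cancel norm_triangle_ineq)
    ultimately have "norm (x - k *\<^sub>R v) > r" "norm x > r" using kv norm_ge_zero[of v] by linarith+
    then show "\<psi> (x - k *\<^sub>R v) = 0" "\<psi> x = 0" using S by auto
  qed
  have int: "integrable lborel g" if "continuous_on UNIV g" "\<And>x. x \<notin> S' \<Longrightarrow> g x = 0" for g :: "'a \<Rightarrow> real"
  proof -
    have "integrable lborel (\<lambda>x. indicator S' x *\<^sub>R g x)"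
      by (rule borel_integrable_compact[OF _ continuous_on_subset[OF that(1)]]) (auto simp: S'_def)
    moreover have "(\<lambda>x. indicator S' x *\<^sub>R g x) = g" using that(2) by (auto simp: indicator_def fun_eq_iff)
    ultimately show ?thesis by simp
  qed
  have i1: "integrable lborel (\<lambda>x. F (x + k *\<^sub>R v) * \<psi> x)"
    by (rule int) (use supp in \<open>auto intro!: continuous_intros c\<psi> continuous_on_compose2[OF cF]\<close>)
  have i2: "integrable lborel (\<lambda>x. F x * \<psi> x)"
    by (rule int) (use supp in \<open>auto intro!: continuous_intros c\<psi> cF\<close>)
  have i3: "integrable lborel (\<lambda>x. F x * \<psi> (x - k *\<^sub>R v))"
    by (rule int) (use supp in \<open>auto intro!: continuous_intros cF continuous_on_compose2[OF c\<psi>]\<close>)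
  have "(\<integral>x. (f (x + k *\<^sub>R u + k *\<^sub>R v) - f (x + k *\<^sub>R u) - f (x + k *\<^sub>R v) + f x) / k * \<psi> x \<partial>lborel)
    = (\<integral>x. (F (x + k *\<^sub>R v) * \<psi> x - F x * \<psi> x) / k \<partial>lborel)"
    by (rule Bochner_Integration.integral_cong) (use k in \<open>auto simp: F_def field_simps\<close>)
  also have "\<dots> = ((\<integral>x. F (x + k *\<^sub>R v) * \<psi> x \<partial>lborel) - (\<integral>x. F x * \<psi> x \<partial>lborel)) / k"
    using i1 i2 by simp
  also have "(\<integral>x. F (x + k *\<^sub>R v) * \<psi> x \<partial>lborel) = (\<integral>x. F x * \<psi> (x - k *\<^sub>R v) \<partial>lborel)"
    using lborel_integral_translate[of "\<lambda>x. F x * \<psi> (x - k *\<^sub>R v)" "k *\<^sub>R v"] i3 by simp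
  also have "((\<integral>x. F x * \<psi> (x - k *\<^sub>R v) \<partial>lborel) - (\<integral>x. F x * \<psi> x \<partial>lborel)) / k
    = (\<integral>x. F x * (\<psi> (x - k *\<^sub>R v) - \<psi> x) / k \<partial>lborel)"
    using i2 i3 by (simp add: right_diff_distrib)
  finally have eq: "(\<integral>x. (f (x + k *\<^sub>R u + k *\<^sub>R v) - f (x + k *\<^sub>R u) - f (x + k *\<^sub>R v) + f x) / k * \<psi> x \<partial>lborel)
    = (\<integral>x. F x * (\<psi> (x - k *\<^sub>R v) - \<psi> x) / k \<partial>lborel)" .
  have S'i: "integrable lborel (indicator S' :: 'a \<Rightarrow> real)"
    unfolding S'_def by (intro integrable_real_indicator) (use emeasure_lborel_cball_finite in auto)
  have "norm (\<integral>x. F x * (\<psi> (x - k *\<^sub>R v) - \<psi> x) / k \<partial>lborel)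
    \<le> (\<integral>x. indicator S' x * (k * (L * norm u * (M * norm v))) \<partial>lborel)"
  proof (rule order_trans[OF integral_norm_bound integral_mono])
    show "integrable lborel (\<lambda>x. norm (F x * (\<psi> (x - k *\<^sub>R v) - \<psi> x) / k))"
      using i2 i3 by (intro integrable_norm) (auto simp: right_diff_distrib)
    show "integrable lborel (\<lambda>x. indicator S' x * (k * (L * norm u * (M * norm v))))"
      using S'i by simp
    fix x
    show "norm (F x * (\<psi> (x - k *\<^sub>R v) - \<psi> x) / k) \<le> indicator S' x * (k * (L * norm u * (M * norm v)))"
    proof (cases "x \<in> S'")
      case True
      have "\<bar>\<psi> (x - k *\<^sub>R v) - \<psi> x\<bar> \<le> M * (k * norm v)"
        using lipschitz_onD[OF \<psi>, of "x - k *\<^sub>R v" x] k by (simp add: dist_real_def dist_norm)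
      then have "\<bar>F x\<bar> * \<bar>\<psi> (x - k *\<^sub>R v) - \<psi> x\<bar> \<le> L * (k * norm u) * (M * (k * norm v))"
        using F[of x] lipschitz_UNIV_const_nonneg k by (intro mult_mono) auto
      then have "\<bar>F x\<bar> * \<bar>\<psi> (x - k *\<^sub>R v) - \<psi> x\<bar> / k \<le> L * (k * norm u) * (M * (k * norm v)) / k"
        using k by (intro divide_right_mono) auto
      also have "\<dots> = k * (L * norm u * (M * norm v))" using k by (simp add: field_simps)
      finally show ?thesis using True k by (simp add: abs_mult)
    qed (use supp in auto)
  qed
  also have "\<dots> = k * (L * norm u * (M * norm v) * measure lborel S')"
    using S'i by (simp add: S'_def)
  finally show ?thesis unfolding eq S'_def by simp
qed

text \<open>Existence of directional derivatives at a point does not make them additive there, so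
  additivity is proved in the weak sense. The defect is a limit of second differences divided by the
  step, and these tend to 0 against every Lipschitz test function with bounded support.\<close>

lemma AE_line_deriv_add:
  "AE x in lborel. line_deriv (u + v) x = line_deriv u x + line_deriv v x"
proof -
  define G where "G = line_differentiable (u + v) \<inter> line_differentiable u \<inter> line_differentiable v"
  have G: "G \<in> sets borel" unfolding G_def using borel_line_differentiable by auto
  have AE_G: "AE x in lborel. x \<in> G"
    unfolding G_def using AE_line_differentiable[of "u+v"] AE_line_differentiable[of u] AE_line_differentiable[of v]
    by eventually_elim auto
  define k where "k = (\<lambda>n. 1 / real (Suc n))"
  have k: "0 < k n" "k n \<le> 1" for n by (auto simp: k_def)
  have k0: "k \<longlonglongrightarrow> 0" unfolding k_def using LIMSEQ_inverse_real_of_nat by (simp add: inverse_eq_divide)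
  have kat: "filterlim k (at 0) sequentially" using k0 k(1) by (auto simp: filterlim_at less_imp_neq eventually_sequentially)
     (metis less_irrefl)
  define Q where "Q = (\<lambda>w x n. (f (x + k n *\<^sub>R w) - f x) / k n)"
  \<comment> \<open>Off G the value of \<open>line_deriv\<close> carries no information. With the
    indicator, \<open>H n\<close> converges to h at every point, which yields measurability of
    h.\<close>
  define h where "h = (\<lambda>x. indicator G x * (line_deriv (u + v) x - line_deriv u x - line_deriv v x))"
  define H where "H = (\<lambda>n x. indicator G x * (Q (u + v) x n - Q u x n - Q v x n))"
  have Qb: "(\<lambda>x. Q w x n) \<in> borel_measurable borel" for w n
    unfolding Q_def using k[of n]
    by (intro borel_measurable_continuous_onI continuous_intros continuous_on_compose2[OF lipschitz_UNIV_continuous_on[of UNIV]]) auto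
  have Hb: "H n \<in> borel_measurable borel" for n
    unfolding H_def using G Qb by measurable
  have Ql: "(\<lambda>n. Q w x n) \<longlonglongrightarrow> line_deriv w x" if "x \<in> line_differentiable w" for w x
    unfolding Q_def by (rule filterlim_compose[OF line_deriv_lim[OF that] kat])
  have Hl: "(\<lambda>n. H n x) \<longlonglongrightarrow> h x" for x
  proof (cases "x \<in> G")
    case True
    then show ?thesis unfolding H_def h_def by (intro tendsto_intros Ql) (auto simp: G_def)
  qed (simp add: H_def h_def)
  have hb: "h \<in> borel_measurable borel"
    by (rule borel_measurable_LIMSEQ_real[OF Hl Hb])
  define C where "C = L * norm (u + v) + L * norm u + L * norm v"
  have C0: "C \<ge> 0" using lipschitz_UNIV_const_nonneg by (simp add: C_def)
  have HC: "\<bar>H n x\<bar> \<le> C" for n x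
  proof -
    have "\<bar>Q (u + v) x n - Q u x n - Q v x n\<bar> \<le> \<bar>Q (u + v) x n\<bar> + \<bar>Q u x n\<bar> + \<bar>Q v x n\<bar>" by linarith
    also have "\<dots> \<le> C" unfolding C_def Q_def by (intro add_mono lipschitz_difference_quotient_bound)
    finally show ?thesis using C0 by (simp add: H_def indicator_def)
  qed
  have hC: "\<bar>h x\<bar> \<le> C" for x
    by (rule tendsto_le[OF _ tendsto_const tendsto_rabs[OF Hl]]) (use HC in auto)
  have "AE x in lebesgue. h x = 0"
  proof (rule AE_eq_0_if_Lipschitz_tests)
    show "h \<in> borel_measurable lebesgue" using hb by (intro measurable_completion) simp
    show "\<bar>h x\<bar> \<le> C" for x by (rule hC)
    fix \<psi> :: "'a \<Rightarrow> real" and M and S :: "'a set" assume \<psi>: "M-lipschitz_on UNIV \<psi>" "bounded S" "\<And>x. x \<notin> S \<Longrightarrow> \<psi> x = 0"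
    have c\<psi>: "continuous_on UNIV \<psi>" using lipschitz_on_continuous_on[OF \<psi>(1)] .
    obtain r where r: "S \<subseteq> ball 0 r" using bounded_subset_ballD[OF \<psi>(2), of 0] by blast
    have supp: "\<psi> x = 0" if "x \<notin> cball 0 r" for x using r \<psi>(3)[of x] that ball_subset_cball by blast
    have bm: "\<psi> \<in> borel_measurable borel" using c\<psi> by (rule borel_measurable_continuous_onI)
    have "integrable lebesgue \<psi>" using lipschitz_integrable[OF \<psi>] .
    then have i\<psi>: "integrable lborel \<psi>" using bm by (simp add: integrable_completion)
    have "(\<lambda>n. \<integral>x. H n x * \<psi> x \<partial>lborel) \<longlonglongrightarrow> (\<integral>x. h x * \<psi> x \<partial>lborel)"
    proof (rule integral_dominated_convergence[where w = "\<lambda>x. C * \<bar>\<psi> x\<bar>"])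
      show "AE x in lborel. (\<lambda>n. H n x * \<psi> x) \<longlonglongrightarrow> h x * \<psi> x"
        by (intro AE_I2 tendsto_intros Hl)
      show "AE x in lborel. norm (H n x * \<psi> x) \<le> C * \<bar>\<psi> x\<bar>" for n
        using HC by (intro AE_I2) (auto simp: abs_mult intro!: mult_right_mono)
    qed (use hb Hb bm i\<psi> in auto)
    moreover have "(\<lambda>n. \<integral>x. H n x * \<psi> x \<partial>lborel) \<longlonglongrightarrow> 0"
    proof (rule Lim_null_comparison)
      define D where "D = L * norm u * (M * norm v) * measure lborel (cball (0::'a) (r + norm v))"
      show "\<forall>\<^sub>F n in sequentially. norm (\<integral>x. H n x * \<psi> x \<partial>lborel) \<le> k n * D"
      proof (rule always_eventually, rule allI)
        fix n
        have "(\<integral>x. H n x * \<psi> x \<partial>lborel) = (\<integral>x. (f (x + k n *\<^sub>R u + k n *\<^sub>R v) - f (x + k n *\<^sub>R u) - f (x + k n *\<^sub>R v) + f x) / k n * \<psi> x \<partial>lborel)"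
        proof (rule integral_cong_AE)
          show "AE x in lborel. H n x * \<psi> x = (f (x + k n *\<^sub>R u + k n *\<^sub>R v) - f (x + k n *\<^sub>R u) - f (x + k n *\<^sub>R v) + f x) / k n * \<psi> x"
            using AE_G
          proof eventually_elim
            fix x assume "x \<in> G"
            then have "H n x = (f (x + k n *\<^sub>R u + k n *\<^sub>R v) - f (x + k n *\<^sub>R u) - f (x + k n *\<^sub>R v) + f x) / k n"
              by (simp add: H_def Q_def diff_divide_distrib add_divide_distrib scaleR_add_right add.assoc)
            then show "H n x * \<psi> x = (f (x + k n *\<^sub>R u + k n *\<^sub>R v) - f (x + k n *\<^sub>R u) - f (x + k n *\<^sub>R v) + f x) / k n * \<psi> x"
              by simp
          qed
          show "(\<lambda>x. (f (x + k n *\<^sub>R u + k n *\<^sub>R v) - f (x + k n *\<^sub>R u) - f (x + k n *\<^sub>R v) + f x) / k n * \<psi> x) \<in> borel_measurable lborel"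
          proof -
            have "continuous_on UNIV (\<lambda>x. (f (x + k n *\<^sub>R u + k n *\<^sub>R v) - f (x + k n *\<^sub>R u) - f (x + k n *\<^sub>R v) + f x) / k n * \<psi> x)"
              using k[of n] by (intro continuous_intros c\<psi> continuous_on_compose2[OF lipschitz_UNIV_continuous_on[of UNIV]]) auto
            from borel_measurable_continuous_onI[OF this] show ?thesis by simp
          qed
        qed (use Hb bm in auto)
        then show "norm (\<integral>x. H n x * \<psi> x \<partial>lborel) \<le> k n * D"
          using second_difference_test[OF \<psi>(1) refl supp k] unfolding D_def by simp
      qed
      show "(\<lambda>n. k n * D) \<longlonglongrightarrow> 0" using tendsto_mult_left_zero[OF k0] by simp
    qed
    ultimately have "(\<integral>x. h x * \<psi> x \<partial>lborel) = 0" by (rule LIMSEQ_unique)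
    then show "(\<integral>x. h x * \<psi> x \<partial>lebesgue) = 0" using hb bm by (simp add: integral_completion)
  qed
  then have "AE x in lborel. h x = 0" by (simp add: AE_completion_iff)
  then show ?thesis using AE_G by eventually_elim (auto simp: h_def)
qed

lemma AE_line_deriv_sum:
  assumes "finite B"
  shows "AE x in lborel. line_deriv (\<Sum>b\<in>B. c b *\<^sub>R b) x = (\<Sum>b\<in>B. c b * line_deriv b x)"
  using assms
proof (induct rule: finite_induct)
  case empty
  then show ?case by (simp add: line_deriv_def)
next
  case (insert b B)
  show ?case
    using insert(3) AE_line_deriv_add[of "c b *\<^sub>R b" "\<Sum>b\<in>B. c b *\<^sub>R b"] AE_line_differentiable[of b]
    by eventually_elim (use insert(1,2) in \<open>simp add: line_deriv_scale\<close>)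
qed

text \<open>By compactness of the unit sphere, finitely many directions of D form an \<eta>-net; the
  quotients converge uniformly over these, and the Lipschitz bound covers all remaining
  directions.\<close>

lemma differentiable_if_dense_directions:
  assumes D: "\<And>X. open X \<Longrightarrow> X \<noteq> {} \<Longrightarrow> \<exists>d\<in>D. d \<in> X"
    and v: "\<And>v. v \<in> D \<Longrightarrow> ((\<lambda>t. f (x + t *\<^sub>R v)) has_real_derivative (v \<bullet> g)) (at 0)"
  shows "(f has_derivative (\<lambda>y. y \<bullet> g)) (at x)"
  unfolding has_derivative_at_alt
proof (intro conjI allI impI)
  show "bounded_linear (\<lambda>y. y \<bullet> g)" by (rule bounded_linear_inner_left)
  fix e :: real assume e: "e > 0"
  \<comment> \<open>Replacing a unit direction by one at distance \<eta> costs at most (L + norm g)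
    \<eta> per unit of length, here at most e/2; the added 1 avoids division by zero.\<close>
  define \<eta> where "\<eta> = e / (2 * (L + norm g + 1))"
  define M where "M = L + norm g"
  have M: "M \<ge> 0" using lipschitz_UNIV_const_nonneg by (simp add: M_def)
  have "\<eta> = e / (2 * (M + 1))" by (simp add: \<eta>_def M_def)
  moreover have "e / (2 * (M + 1)) > 0" "M * (e / (2 * (M + 1))) \<le> e / 2"
    using e M by (auto simp: field_simps)
  ultimately have "\<eta> > 0" "M * \<eta> \<le> e / 2" by auto
  then have \<eta>: "\<eta> > 0" "(L + norm g) * \<eta> \<le> e / 2" by (auto simp: M_def)
  have "sphere (0::'a) 1 \<subseteq> (\<Union>v\<in>D. ball v \<eta>)"
  proof
    fix w :: 'a
    obtain d where "d \<in> D" "d \<in> ball w \<eta>" using D[of "ball w \<eta>"] \<eta> by auto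
    then show "w \<in> (\<Union>v\<in>D. ball v \<eta>)" by (auto simp: dist_commute)
  qed
  then obtain V where V: "V \<subseteq> D" "finite V" "sphere (0::'a) 1 \<subseteq> (\<Union>v\<in>V. ball v \<eta>)"
    using compactE_image[OF compact_sphere, of D "\<lambda>v. ball v \<eta>" 0 1] by auto
  have "\<forall>\<^sub>F t in at 0. \<forall>v\<in>V. \<bar>(f (x + t *\<^sub>R v) - f x) / t - v \<bullet> g\<bar> < e / 2"
    unfolding eventually_ball_finite_distrib[OF V(2)]
  proof
    fix w assume "w \<in> V"
    then have "((\<lambda>t. (f (x + t *\<^sub>R w) - f x) / t) \<longlongrightarrow> w \<bullet> g) (at 0)"
      using v[of w] V by (auto simp: DERIV_def)
    from tendstoD[OF this, of "e/2"] show "\<forall>\<^sub>F t in at 0. \<bar>(f (x + t *\<^sub>R w) - f x) / t - w \<bullet> g\<bar> < e / 2"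
      using e by (simp add: dist_real_def)
  qed
  then obtain d where d: "d > 0" "\<And>t w. t \<noteq> 0 \<Longrightarrow> \<bar>t\<bar> < d \<Longrightarrow> w \<in> V \<Longrightarrow> \<bar>(f (x + t *\<^sub>R w) - f x) / t - w \<bullet> g\<bar> < e / 2"
    unfolding eventually_at by (auto simp: dist_real_def)
  show "\<exists>d>0. \<forall>y. norm (y - x) < d \<longrightarrow> norm (f y - f x - (y - x) \<bullet> g) \<le> e * norm (y - x)"
  proof (intro exI[of _ d] conjI allI impI d(1))
    fix y assume y: "norm (y - x) < d"
    show "norm (f y - f x - (y - x) \<bullet> g) \<le> e * norm (y - x)"
    proof (cases "y = x")
      case False
      define t where "t = norm (y - x)"
      define w where "w = (y - x) /\<^sub>R t"
      have t: "t > 0" "t < d" using False y by (auto simp: t_def)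
      have w: "norm w = 1" "y = x + t *\<^sub>R w" using t by (auto simp: w_def) (simp add: t_def)
      obtain z where z: "z \<in> V" "norm (w - z) < \<eta>"
        using V(3) w(1) by (auto simp: dist_norm norm_minus_commute subset_iff)
      have "\<bar>(f (x + t *\<^sub>R z) - f x) / t - z \<bullet> g\<bar> * t \<le> e / 2 * t"
        using d(2)[of t z] t z by (intro mult_right_mono) auto
      moreover have "\<bar>(f (x + t *\<^sub>R z) - f x) / t - z \<bullet> g\<bar> * t = \<bar>f (x + t *\<^sub>R z) - f x - t * (z \<bullet> g)\<bar>"
      proof -
        have "((f (x + t *\<^sub>R z) - f x) / t - z \<bullet> g) * t = f (x + t *\<^sub>R z) - f x - t * (z \<bullet> g)"
          using t by (simp add: field_simps)
        then show ?thesis using t by (metis abs_mult abs_of_pos)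
      qed
      ultimately have 1: "\<bar>f (x + t *\<^sub>R z) - f x - t * (z \<bullet> g)\<bar> \<le> e / 2 * t" by simp
      have "\<bar>f y - f (x + t *\<^sub>R z)\<bar> \<le> L * norm (t *\<^sub>R (w - z))"
        using lipschitz_UNIV_abs_diff_le[of y "x + t *\<^sub>R z"] by (simp add: w(2) algebra_simps)
      also have "\<dots> \<le> L * (t * \<eta>)" using t z lipschitz_UNIV_const_nonneg by (intro mult_left_mono) auto
      finally have 2: "\<bar>f y - f (x + t *\<^sub>R z)\<bar> \<le> L * (t * \<eta>)" .
      have "\<bar>t * ((z - w) \<bullet> g)\<bar> \<le> t * (norm (z - w) * norm g)"
        using Cauchy_Schwarz_ineq2[of "z - w" g] t by (simp add: abs_mult)
      also have "\<dots> \<le> t * (\<eta> * norm g)"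
        using t z by (intro mult_left_mono mult_right_mono) (auto simp: norm_minus_commute)
      finally have 3: "\<bar>t * ((z - w) \<bullet> g)\<bar> \<le> t * (\<eta> * norm g)" .
      have "f y - f x - (y - x) \<bullet> g = (f y - f (x + t *\<^sub>R z)) + (f (x + t *\<^sub>R z) - f x - t * (z \<bullet> g)) + t * ((z - w) \<bullet> g)"
        using w(2) by (simp add: inner_diff_left algebra_simps)
      then have "\<bar>f y - f x - (y - x) \<bullet> g\<bar> \<le> L * (t * \<eta>) + e / 2 * t + t * (\<eta> * norm g)"
        using 1 2 3 by linarith
      also have "\<dots> = t * ((L + norm g) * \<eta> + e / 2)" by (simp add: algebra_simps)
      also have "\<dots> \<le> t * e" using \<eta>(2) t by (intro mult_left_mono) auto
      finally show ?thesis by (simp add: t_def mult.commute)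
    qed simp
  qed
qed

text \<open>Linearity of the derivative in the direction holds almost everywhere for each single
  direction; a countable dense set of directions allows one common null set.\<close>

theorem Rademacher: "AE x in lebesgue. f differentiable (at x)"
proof -
  obtain D :: "'a set" where D: "countable D" "\<And>X. open X \<Longrightarrow> X \<noteq> {} \<Longrightarrow> \<exists>d\<in>D. d \<in> X"
    by (rule countable_dense_setE) blast
  have "AE x in lborel. \<forall>v\<in>D. x \<in> line_differentiable v \<and> line_deriv v x = (\<Sum>b\<in>Basis. (v \<bullet> b) * line_deriv b x)"
  proof (rule AE_ball_countable'[OF _ D(1)])
    fix v :: 'a
    show "AE x in lborel. x \<in> line_differentiable v \<and> line_deriv v x = (\<Sum>b\<in>Basis. (v \<bullet> b) * line_deriv b x)"
      using AE_line_differentiable[of v] AE_line_deriv_sum[OF finite_Basis, of "\<lambda>b. v \<bullet> b"]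
      by eventually_elim (simp add: euclidean_representation)
  qed
  then have "AE x in lborel. f differentiable (at x)"
  proof eventually_elim
    fix x assume *: "\<forall>v\<in>D. x \<in> line_differentiable v \<and> line_deriv v x = (\<Sum>b\<in>Basis. (v \<bullet> b) * line_deriv b x)"
    define g where "g = (\<Sum>b\<in>Basis. line_deriv b x *\<^sub>R b)"
    have "(f has_derivative (\<lambda>y. y \<bullet> g)) (at x)"
    proof (rule differentiable_if_dense_directions[OF D(2)])
      fix v assume "v \<in> D"
      then have "v \<bullet> g = line_deriv v x" "x \<in> line_differentiable v"
        using * by (auto simp: g_def inner_sum_right mult.commute)
      then show "((\<lambda>t. f (x + t *\<^sub>R v)) has_real_derivative (v \<bullet> g)) (at 0)"
        using line_deriv_DERIV by simp
    qed auto
    then show "f differentiable (at x)" by (auto simp: differentiable_def)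
  qed
  then show ?thesis by (rule AE_completion)
qed

end

section \<open>The derivative of a Lipschitz function as a bounded measurable function\<close>

lemma has_derivative_along_line:
  fixes f :: "'a::euclidean_space \<Rightarrow> real"
  assumes "(f has_derivative f') (at x)"
  shows "((\<lambda>t. f (x + t *\<^sub>R v)) has_real_derivative f' v) (at 0)"
proof -
  have "((\<lambda>t. x + t *\<^sub>R v) has_derivative (\<lambda>t. t *\<^sub>R v)) (at (0::real))"
    by (auto intro!: derivative_eq_intros)
  moreover have "(f has_derivative f') (at (x + (0::real) *\<^sub>R v))" using assms by simp
  ultimately have "((\<lambda>t. f (x + t *\<^sub>R v)) has_derivative (\<lambda>t. f' (t *\<^sub>R v))) (at (0::real))"
    by (rule has_derivative_compose)
  moreover have "f' (t *\<^sub>R v) = f' v * t" for t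
    using has_derivative_bounded_linear[OF assms] by (simp add: linear_simps)
  ultimately show ?thesis by (simp add: has_field_derivative_def)
qed

lemma lipschitz_derivative_bound:
  fixes f :: "'a::euclidean_space \<Rightarrow> real"
  assumes lip: "L-lipschitz_on UNIV f" and d: "(f has_derivative f') (at x)"
  shows "\<bar>f' v\<bar> \<le> L * norm v"
proof -
  have "((\<lambda>t. (f (x + t *\<^sub>R v) - f x) / t) \<longlongrightarrow> f' v) (at (0::real))"
    using has_derivative_along_line[OF d, of v] by (simp add: DERIV_def)
  from tendsto_rabs[OF this] show ?thesis
    by (rule tendsto_upperbound) (use lipschitz_difference_quotient_bound[OF lip] in auto)
qed

lemma differentiable_imp_has_frechet_derivative:
  "f differentiable (at x) \<Longrightarrow> (f has_derivative frechet_derivative f (at x)) (at x)"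
  by (simp add: frechet_derivative_works)

text \<open>The derivative is almost everywhere the limit of continuous difference quotients along
  1/(n+1). Completeness of \<open>lebesgue\<close> absorbs the arbitrary values of
  \<open>frechet_derivative\<close> and \<open>lim\<close> on the exceptional set.\<close>

lemma borel_measurable_frechet_derivative:
  fixes f :: "'a::euclidean_space \<Rightarrow> real"
  assumes lip: "L-lipschitz_on UNIV f"
  shows "(\<lambda>x. frechet_derivative f (at x) v) \<in> borel_measurable lebesgue"
proof -
  define k where "k = (\<lambda>n. 1 / real (Suc n))"
  have k: "0 < k n" for n by (auto simp: k_def)
  have k0: "k \<longlonglongrightarrow> 0" unfolding k_def using LIMSEQ_inverse_real_of_nat by (simp add: inverse_eq_divide)
  have kat: "filterlim k (at 0) sequentially"
    using k0 k by (auto simp: filterlim_at eventually_sequentially) (metis less_irrefl)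
  define q where "q = (\<lambda>n x. (f (x + k n *\<^sub>R v) - f x) / k n)"
  have "(\<lambda>x. lim (\<lambda>n. q n x)) \<in> borel_measurable lebesgue"
  proof (rule borel_measurable_lim_metric)
    fix n
    have "continuous_on UNIV (q n)" unfolding q_def
      using k[of n] by (intro continuous_intros continuous_on_compose2[OF lipschitz_UNIV_continuous_on[OF lip, of UNIV]]) auto
    then show "q n \<in> borel_measurable lebesgue"
      by (intro measurable_completion) (simp add: borel_measurable_continuous_onI)
  qed
  then show ?thesis
  proof (rule borel_measurable_AE)
    show "AE x in lebesgue. lim (\<lambda>n. q n x) = frechet_derivative f (at x) v"
      using Rademacher[OF lip]
    proof eventually_elim
      fix x assume "f differentiable (at x)"
      from has_derivative_along_line[OF differentiable_imp_has_frechet_derivative[OF this], of v]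
      have "((\<lambda>t. (f (x + t *\<^sub>R v) - f x) / t) \<longlongrightarrow> frechet_derivative f (at x) v) (at (0::real))"
        by (simp add: DERIV_def)
      from filterlim_compose[OF this kat] show "lim (\<lambda>n. q n x) = frechet_derivative f (at x) v"
        by (intro limI) (simp add: q_def)
    qed
  qed
qed

lemma AE_frechet_derivative_bound:
  fixes f :: "'a::euclidean_space \<Rightarrow> real"
  assumes lip: "L-lipschitz_on UNIV f"
  shows "AE x in lebesgue. \<bar>frechet_derivative f (at x) v\<bar> \<le> L * norm v"
  using Rademacher[OF lip]
  by eventually_elim (rule lipschitz_derivative_bound[OF lip differentiable_imp_has_frechet_derivative])

section \<open>Contractive perturbations of the identity\<close>

text \<open>Solving y = x + \<Phi> x means finding a fixed point of the contraction sending x to y -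
  \<Phi> x.\<close>

lemma contraction_perturbation_bij:
  fixes \<Phi> :: "'a::euclidean_space \<Rightarrow> 'a"
  assumes lip: "c-lipschitz_on UNIV \<Phi>" and c: "c < 1" and zero: "\<And>x. norm x > R \<Longrightarrow> \<Phi> x = 0"
  shows "inj (\<lambda>x. x + \<Phi> x)" "(\<lambda>x. x + \<Phi> x) ` cball 0 R = cball 0 R"
proof -
  define h where "h = (\<lambda>x. x + \<Phi> x)"
  have c0: "0 \<le> c" using lip lipschitz_on_nonneg by blast
  have inj: "inj h"
  proof (rule injI)
    fix x y assume "h x = h y"
    then have "x - y = \<Phi> y - \<Phi> x" by (simp add: h_def algebra_simps)
    then have "norm (x - y) = dist (\<Phi> y) (\<Phi> x)" by (simp add: dist_norm)
    also have "\<dots> \<le> c * norm (x - y)"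
      using lipschitz_onD[OF lip, of y x] by (simp add: dist_norm norm_minus_commute)
    finally have "(1 - c) * norm (x - y) \<le> 0" by (simp add: algebra_simps)
    then show "x = y" using c by (simp add: mult_le_0_iff)
  qed
  then show "inj (\<lambda>x. x + \<Phi> x)" by (simp add: h_def)
  have "h ` cball 0 R = cball 0 R"
  proof
    show "h ` cball 0 R \<subseteq> cball 0 R"
    proof clarify
      fix x assume x: "x \<in> cball (0::'a) R"
      show "h x \<in> cball 0 R"
      proof (rule ccontr)
        assume n: "h x \<notin> cball 0 R"
        \<comment> \<open>The map is the identity outside the ball, so a point leaving the ball
          would have the same image as its own image, against injectivity.\<close>
        then have "h (h x) = h x" using zero[of "h x"] by (simp add: h_def)
        then have "h x = x" using inj by (simp add: inj_eq)
        then show False using n x by simp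
      qed
    qed
    show "cball 0 R \<subseteq> h ` cball 0 R"
    proof
      fix y assume y: "y \<in> cball (0::'a) R"
      have "\<exists>!x. y - \<Phi> x = x"
      proof (rule banach_fix_type[OF c0 c], intro allI)
        fix x z
        have "dist (y - \<Phi> x) (y - \<Phi> z) = dist (\<Phi> x) (\<Phi> z)" by (simp add: dist_norm norm_minus_commute)
        then show "dist (y - \<Phi> x) (y - \<Phi> z) \<le> c * dist x z" using lipschitz_onD[OF lip, of x z] by simp
      qed
      then obtain x where x: "y - \<Phi> x = x" by blast
      have "x \<in> cball 0 R"
      proof (rule ccontr)
        assume "x \<notin> cball 0 R"
        then have "\<Phi> x = 0" using zero[of x] by simp
        then show False using x y \<open>x \<notin> cball 0 R\<close> by simp
      qed
      moreover have "y = h x" using x by (simp add: h_def algebra_simps)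
      ultimately show "y \<in> h ` cball 0 R" by blast
    qed
  qed
  then show "(\<lambda>x. x + \<Phi> x) ` cball 0 R = cball 0 R" by (simp add: h_def)
qed

section \<open>The determinant of a perturbed identity as a polynomial\<close>

text \<open>The determinant of the matrix with the rows in X taken from A and the others from the
  identity, that is, the principal minor of A on X. The Leibniz form suits both expansion and
  estimates.\<close>

definition det_minor_sum :: "'n set \<Rightarrow> real^'n^'n \<Rightarrow> real" where
  "det_minor_sum X A = (\<Sum>p | p permutes UNIV. of_int (sign p) *
     ((\<Prod>i\<in>X. A $ i $ p i) * (\<Prod>i\<in>UNIV - X. mat 1 $ i $ p i)))"

lemma det_minor_sum_UNIV: "det_minor_sum UNIV A = det A"
  by (simp add: det_minor_sum_def det_def)

lemma det_mat_1_add: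
  fixes A :: "real^'n^'n"
  shows "det (mat 1 + s *\<^sub>R A) = (\<Sum>X\<in>UNIV. s ^ card X * det_minor_sum X A)"
proof -
  have "det (mat 1 + s *\<^sub>R A) = (\<Sum>p | p permutes UNIV. of_int (sign p) * (\<Prod>i\<in>UNIV. s * A $ i $ p i + mat 1 $ i $ p i))"
    by (simp add: det_def add.commute)
  also have "\<dots> = (\<Sum>p | p permutes UNIV. \<Sum>X\<in>UNIV. s ^ card X * (of_int (sign p) *
     ((\<Prod>i\<in>X. A $ i $ p i) * (\<Prod>i\<in>UNIV - X. mat 1 $ i $ p i))))"
    by (intro sum.cong refl, subst prod_add) (simp_all add: sum_distrib_left prod.distrib mult_ac)
  also have "\<dots> = (\<Sum>X\<in>UNIV. s ^ card X * det_minor_sum X A)"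
    by (subst sum.swap) (simp add: det_minor_sum_def sum_distrib_left)
  finally show ?thesis .
qed

lemma abs_det_minor_sum_le:
  fixes A :: "real^'n^'n"
  assumes "\<And>i j. \<bar>A $ i $ j\<bar> \<le> B"
  shows "\<bar>det_minor_sum X A\<bar> \<le> real (card {p. p permutes (UNIV::'n set)}) * B ^ card X"
proof -
  have "\<bar>det_minor_sum X A\<bar> \<le> (\<Sum>p | p permutes (UNIV::'n set). B ^ card X)"
    unfolding det_minor_sum_def
  proof (rule order_trans[OF sum_abs sum_mono])
    fix p :: "'n \<Rightarrow> 'n"
    have "\<bar>\<Prod>i\<in>X. A $ i $ p i\<bar> \<le> (\<Prod>i\<in>X. B)"
      unfolding abs_prod by (intro prod_mono) (use assms in auto)
    moreover have "\<bar>\<Prod>i\<in>UNIV - X. mat 1 $ i $ p i :: real\<bar> \<le> (\<Prod>i\<in>UNIV - X. 1)"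
      unfolding abs_prod by (intro prod_mono) (auto simp: mat_def)
    ultimately have "\<bar>\<Prod>i\<in>X. A $ i $ p i\<bar> * \<bar>\<Prod>i\<in>UNIV - X. mat 1 $ i $ p i :: real\<bar> \<le> (\<Prod>i\<in>X. B) * (\<Prod>i\<in>UNIV - X. 1)"
      by (intro mult_mono) (auto intro: order_trans[OF abs_ge_zero])
    then show "\<bar>of_int (sign p) * ((\<Prod>i\<in>X. A $ i $ p i) * (\<Prod>i\<in>UNIV - X. mat 1 $ i $ p i))\<bar> \<le> B ^ card X"
      by (simp add: abs_mult sign_def)
  qed
  then show ?thesis by simp
qed

text \<open>Grouped by cardinality the sum is a polynomial in s, and it takes the value C infinitely
  often. Its top coefficient comes from the full index set alone.\<close>

lemma sum_power_card_eq_const_imp: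
  fixes d :: "'n::finite set \<Rightarrow> real"
  assumes eq: "\<And>s. 0 \<le> s \<Longrightarrow> s \<le> s0 \<Longrightarrow> (\<Sum>X\<in>UNIV. s ^ card X * d X) = C" and "s0 > 0"
  shows "d UNIV = 0"
proof -
  define n where "n = CARD('n)"
  have n: "n > 0" by (simp add: n_def)
  define c where "c = (\<lambda>k. \<Sum>X | card X = k. d X)"
  \<comment> \<open>The constant C is absorbed into degree 0; the top degree is positive, so the
    coefficient of interest is untouched.\<close>
  define c' where "c' = (\<lambda>k. if k = 0 then c 0 - C else c k)"
  have grp: "(\<Sum>X\<in>UNIV. s ^ card X * d X) = (\<Sum>k\<le>n. c k * s ^ k)" for s :: real
  proof -
    have "(\<Sum>X\<in>UNIV. s ^ card X * d X) = (\<Sum>k\<le>n. \<Sum>X | X \<in> UNIV \<and> card X = k. s ^ card X * d X)"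
      by (rule sum.group[symmetric]) (auto simp: n_def card_mono)
    also have "\<dots> = (\<Sum>k\<le>n. c k * s ^ k)"
      by (intro sum.cong refl) (simp add: c_def sum_distrib_left mult.commute)
    finally show ?thesis .
  qed
  have c': "(\<Sum>k\<le>n. c' k * s ^ k) = (\<Sum>k\<le>n. c k * s ^ k) - C" for s :: real
    by (simp add: c'_def sum.atMost_shift)
  have "{0..s0} \<subseteq> {s. (\<Sum>k\<le>n. c' k * s ^ k) = 0}"
    using eq by (auto simp: c' grp)
  then have "infinite {s. (\<Sum>k\<le>n. c' k * s ^ k) = 0}"
    using \<open>s0 > 0\<close> by (meson finite_subset infinite_Icc)
  then have "c' n = 0" using polyfun_finite_roots[of c' n] by auto
  moreover have "{X::'n set. card X = n} = {UNIV}"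
    using card_eq_UNIV_imp_eq_UNIV[of "_::'n set"] by (auto simp: n_def)
  ultimately show ?thesis using n by (simp add: c'_def c_def)
qed

section \<open>The integral of a Jacobian determinant\<close>

text \<open>Change of variables is applied on D, the part of the ball where every \<open>g i\<close>
  is differentiable. The perturbed identity is Lipschitz and sends the discarded null set to a null
  set, so the image of D still has the full measure of the ball.\<close>

lemma integral_det_jacobian_eq_0_cart:
  fixes g :: "'m::{finite,wellorder} \<Rightarrow> (real,'m) vec \<Rightarrow> real"
  assumes lip: "\<And>i. L-lipschitz_on UNIV (g i)" and zero: "\<And>i x. norm x > R \<Longrightarrow> g i x = 0"
  shows "(\<integral>x. det (\<chi> i j. frechet_derivative (g i) (at x) (axis j 1)) \<partial>lebesgue) = 0"
proof -
  define A where "A = (\<lambda>x. \<chi> i j. frechet_derivative (g i) (at x) (axis j 1) :: ((real,'m) vec,'m) vec)"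
  define G where "G = (\<lambda>x. \<chi> i. g i x)"
  \<comment> \<open>The norm of a vector is at most the sum of its coordinates in absolute value, so
    M is a Lipschitz constant for the whole map G.\<close>
  define M where "M = real CARD('m) * L"
  have L0: "L \<ge> 0" using lip lipschitz_on_nonneg by blast
  have M0: "M \<ge> 0" using L0 by (simp add: M_def)
  have G: "M-lipschitz_on UNIV G"
  proof (rule lipschitz_onI)
    fix x y :: "(real,'m) vec"
    have "norm (G x - G y) \<le> (\<Sum>i\<in>UNIV. \<bar>(G x - G y) $ i\<bar>)" by (rule norm_le_l1_cart)
    also have "\<dots> \<le> (\<Sum>i\<in>(UNIV::'m set). L * dist x y)"
      using lipschitz_onD[OF lip, of x y] by (intro sum_mono) (auto simp: G_def dist_real_def)
    finally show "dist (G x) (G y) \<le> M * dist x y" by (simp add: M_def dist_norm)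
  qed (rule M0)
  define Df where "Df = {x. \<forall>i. g i differentiable (at x)}"
  define D where "D = cball 0 R \<inter> Df"
  have AE_Df: "AE x in lebesgue. x \<in> Df"
    unfolding Df_def mem_Collect_eq by (intro AE_all_countable[THEN iffD2] allI Rademacher[OF lip])
  have negD: "negligible (cball 0 R - D)"
  proof -
    obtain N where "\<And>x. x \<in> space lebesgue - N \<Longrightarrow> x \<in> Df" "N \<in> null_sets lebesgue"
      using AE_E3[OF AE_Df] by blast
    then show ?thesis unfolding negligible_iff_null_sets[symmetric]
      by (elim negligible_subset) (auto simp: D_def)
  qed
  have mD: "D \<in> lmeasurable" "D \<in> sets lebesgue"
  proof -
    have "D = cball 0 R - (cball 0 R - D)" by (auto simp: D_def)
    then show "D \<in> lmeasurable" using negD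
      by (metis fmeasurable_Diff lmeasurable_cball negligible_imp_sets)
    then show "D \<in> sets lebesgue" by auto
  qed
  have mv: "A x *v w = (\<chi> i. frechet_derivative (g i) (at x) w)" if "x \<in> D" for x w
  proof -
    have "(A x *v w) $ i = frechet_derivative (g i) (at x) w" for i
    proof -
      have "bounded_linear (frechet_derivative (g i) (at x))"
        by (rule has_derivative_bounded_linear[OF differentiable_imp_has_frechet_derivative])
          (use that in \<open>auto simp: D_def Df_def\<close>)
      then have lin: "linear (frechet_derivative (g i) (at x))" by (rule bounded_linear.linear)
      have "(A x *v w) $ i = (\<Sum>j\<in>UNIV. w $ j *\<^sub>R frechet_derivative (g i) (at x) (axis j 1))"
        by (simp add: A_def matrix_vector_mult_def mult.commute)
      also have "\<dots> = frechet_derivative (g i) (at x) (\<Sum>j\<in>UNIV. w $ j *\<^sub>R axis j 1)"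
        using lin by (simp add: linear_sum linear_cmul)
      also have "(\<Sum>j\<in>UNIV. w $ j *\<^sub>R axis j 1) = w"
        by (simp add: vec_eq_iff axis_def if_distrib cong: if_cong)
      finally show ?thesis .
    qed
    then show ?thesis by (simp add: vec_eq_iff)
  qed
  have derG: "(G has_derivative (\<lambda>w. A x *v w)) (at x)" if "x \<in> D" for x
  proof -
    have "((\<lambda>y. G y \<bullet> b) has_derivative (\<lambda>w. (A x *v w) \<bullet> b)) (at x)" if "b \<in> Basis" for b
    proof -
      obtain i where b: "b = axis i 1" using \<open>b \<in> Basis\<close> by (auto simp: Basis_vec_def)
      show ?thesis using differentiable_imp_has_frechet_derivative[of "g i" x] \<open>x \<in> D\<close>
        by (simp add: b inner_axis G_def mv D_def Df_def)
    qed
    then show ?thesis by (subst has_derivative_componentwise_within) auto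
  qed
  have bnd: "norm (A x *v w) \<le> M * norm w" if "x \<in> D" for x w
  proof -
    have "norm (A x *v w) \<le> (\<Sum>i\<in>UNIV. \<bar>(A x *v w) $ i\<bar>)" by (rule norm_le_l1_cart)
    also have "\<dots> \<le> (\<Sum>i\<in>(UNIV::'m set). L * norm w)"
      using that lipschitz_derivative_bound[OF lip differentiable_imp_has_frechet_derivative]
      by (intro sum_mono) (auto simp: mv D_def Df_def)
    finally show ?thesis by (simp add: M_def)
  qed
  have bndA: "\<bar>A x $ i $ j\<bar> \<le> L" if "x \<in> D" for x i j
    using that lipschitz_derivative_bound[OF lip differentiable_imp_has_frechet_derivative, of i x "axis j 1"]
    by (auto simp: A_def D_def Df_def)
  \<comment> \<open>With \<open>s1\<close> half of this, s M stays below 1 for all s up to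
    \<open>s1\<close>: the perturbation is a contraction and I + s A is injective.\<close>
  define s0 where "s0 = 1 / (M + 1)"
  define s1 where "s1 = s0 / 2"
  have s1: "s1 > 0" using M0 by (simp add: s1_def s0_def)
  have sM: "s * M < 1" if "0 \<le> s" "s \<le> s1" for s
  proof -
    have "s * M \<le> s1 * M" using that M0 by (intro mult_right_mono)
    also have "\<dots> < 1" using M0 by (simp add: s1_def s0_def field_simps)
    finally show ?thesis .
  qed
  have det_nz: "det (mat 1 + s *\<^sub>R A x) \<noteq> 0" if s: "0 \<le> s" "s \<le> s1" and x: "x \<in> D" for s x
  proof -
    have "inj ((*v) (mat 1 + s *\<^sub>R A x))"
    proof (rule linear_injective_0[THEN iffD2, rule_format])
      fix w assume "(mat 1 + s *\<^sub>R A x) *v w = 0"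
      then have "w = - (s *\<^sub>R (A x *v w))"
        by (simp add: matrix_vector_mult_add_rdistrib scaleR_matrix_vector_assoc[symmetric] eq_neg_iff_add_eq_0)
      then have "norm w = s * norm (A x *v w)" using s by (metis norm_minus_cancel norm_scaleR abs_of_nonneg)
      also have "\<dots> \<le> s * (M * norm w)" using bnd[OF x] s by (intro mult_left_mono) auto
      finally have "(1 - s * M) * norm w \<le> 0" by (simp add: algebra_simps)
      then show "w = 0" using sM[OF s] by (simp add: mult_le_0_iff)
    qed simp
    then have "invertible (mat 1 + s *\<^sub>R A x)"
      by (simp add: invertible_left_inverse matrix_left_invertible_injective)
    then show ?thesis by (simp add: invertible_det_nz)
  qed
  \<comment> \<open>The determinant is 1 at s = 0 and has no zero up to \<open>s1\<close>, so it
    stays positive. This removes the absolute value from the change of variables formula.\<close>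
  have det_pos: "det (mat 1 + s *\<^sub>R A x) > 0" if s: "0 \<le> s" "s \<le> s1" and x: "x \<in> D" for s x
  proof (rule ccontr)
    define \<delta> where "\<delta> = (\<lambda>s. det (mat 1 + s *\<^sub>R A x))"
    assume "\<not> 0 < det (mat 1 + s *\<^sub>R A x)"
    then have "\<delta> s \<le> 0" by (simp add: \<delta>_def)
    moreover have "0 \<le> \<delta> 0" by (simp add: \<delta>_def)
    moreover have "continuous_on {0..s} \<delta>"
      unfolding \<delta>_def det_mat_1_add by (intro continuous_intros)
    ultimately obtain \<sigma> where "0 \<le> \<sigma>" "\<sigma> \<le> s" "\<delta> \<sigma> = 0"
      using IVT2'[of \<delta> s 0 0] s by auto
    then show False using det_nz[of \<sigma> x] s x by (simp add: \<delta>_def)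
  qed
  \<comment> \<open>Off D the entries of \<open>A x\<close> may be arbitrary; the indicator makes
    the polynomial expansion below an identity at every point.\<close>
  define f where "f = (\<lambda>X x. indicator D x * det_minor_sum X (A x))"
  have mA: "(\<lambda>x. A x $ i $ j) \<in> borel_measurable lebesgue" for i j
    using borel_measurable_frechet_derivative[OF lip] by (simp add: A_def)
  have mf: "f X \<in> borel_measurable lebesgue" for X
    unfolding f_def det_minor_sum_def using mA mD
    by (intro borel_measurable_times borel_measurable_sum borel_measurable_prod borel_measurable_const borel_measurable_indicator)
  have fi: "integrable lebesgue (f X)" for X
  proof (rule integrable_bounded_support[OF mf bounded_cball[of 0 R]])
    show "f X x = 0" if "x \<notin> cball 0 R" for x using that by (simp add: f_def D_def)
    show "AE x in lebesgue. \<bar>f X x\<bar> \<le> real (card {p. p permutes (UNIV::'m set)}) * L ^ card X"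
      using abs_det_minor_sum_le[OF bndA] L0 by (intro AE_I2) (auto simp: f_def indicator_def)
  qed
  have key: "(\<Sum>X\<in>UNIV. s ^ card X * (\<integral>x. f X x \<partial>lebesgue)) = measure lebesgue (cball (0::(real,'m) vec) R)"
    if s: "0 \<le> s" "s \<le> s1" for s
  proof -
    define h where "h = (\<lambda>x. x + s *\<^sub>R G x)"
    have lips: "(s * M)-lipschitz_on UNIV (\<lambda>x. s *\<^sub>R G x)"
      using lipschitz_on_cmult_nonneg[OF G] s by simp
    have z: "s *\<^sub>R G x = 0" if "norm x > R" for x using zero[OF that] by (simp add: G_def vec_eq_iff)
    have injh: "inj h" and hB: "h ` cball 0 R = cball 0 R"
      unfolding h_def using contraction_perturbation_bij[OF lips sM[OF s] z] by auto
    have h': "(h has_derivative (\<lambda>w. (mat 1 + s *\<^sub>R A x) *v w)) (at x within D)" if "x \<in> D" for x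
      unfolding h_def
      by (rule has_derivative_at_withinI)
        (auto intro!: derivative_eq_intros derG[OF that] simp: matrix_vector_mult_add_rdistrib scaleR_matrix_vector_assoc[symmetric])
    have neg: "negligible (h ` (cball 0 R - D))"
    proof (rule negligible_locally_Lipschitz_image[OF _ negD])
      fix x assume "x \<in> cball 0 R - D"
      have "1-lipschitz_on UNIV (\<lambda>x::(real,'m) vec. x)" by (rule lipschitz_on_id)
      from lipschitz_on_add[OF this lips] have "(1 + s * M)-lipschitz_on UNIV h" by (simp add: h_def)
      then show "\<exists>T B. open T \<and> x \<in> T \<and> (\<forall>y\<in>(cball 0 R - D) \<inter> T. norm (h y - h x) \<le> B * norm (y - x))"
        by (intro exI[of _ UNIV] exI[of _ "1 + s * M"]) (auto dest: lipschitz_onD simp: dist_norm)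
    qed simp
    have hD: "h ` D = cball 0 R - h ` (cball 0 R - D)"
    proof -
      have "h ` D = h ` (cball 0 R - (cball 0 R - D))" by (rule arg_cong[of _ _ "\<lambda>X. h ` X"]) (auto simp: D_def)
      also have "\<dots> = h ` cball 0 R - h ` (cball 0 R - D)" using injh by (rule image_set_diff)
      finally show ?thesis using hB by simp
    qed
    have "h ` D \<in> lmeasurable \<and> measure lebesgue (h ` D) = measure lebesgue (cball (0::(real,'m) vec) R)"
    proof -
      have null: "h ` (cball 0 R - D) \<in> null_sets lebesgue" using neg by (simp add: negligible_iff_null_sets)
      have "cball 0 R - h ` (cball 0 R - D) \<in> lmeasurable"
        by (rule fmeasurable_Diff[OF lmeasurable_cball null_setsD2[OF null]])
      moreover have "measure lebesgue (cball 0 R - h ` (cball 0 R - D)) = measure lebesgue (cball (0::(real,'m) vec) R)"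
        by (rule measure_Diff_null_set[OF _ null]) simp
      ultimately show ?thesis unfolding hD by blast
    qed
    then have "((\<lambda>x. \<bar>det (matrix (\<lambda>w. (mat 1 + s *\<^sub>R A x) *v w))\<bar>) has_integral measure lebesgue (cball (0::(real,'m) vec) R)) D"
      by (subst has_measure_differentiable_image[OF mD(2) h' inj_on_subset[OF injh], symmetric]) auto
    then have "((\<lambda>x. if x \<in> D then \<bar>det (mat 1 + s *\<^sub>R A x)\<bar> else 0) has_integral measure lebesgue (cball (0::(real,'m) vec) R)) UNIV"
      by (simp add: has_integral_restrict_UNIV)
    moreover have "(\<lambda>x. if x \<in> D then \<bar>det (mat 1 + s *\<^sub>R A x)\<bar> else 0) = (\<lambda>x. \<Sum>X\<in>UNIV. s ^ card X * f X x)"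
    proof
      fix x show "(if x \<in> D then \<bar>det (mat 1 + s *\<^sub>R A x)\<bar> else 0) = (\<Sum>X\<in>UNIV. s ^ card X * f X x)"
        using det_pos[OF s, of x] by (auto simp: f_def det_mat_1_add)
    qed
    ultimately have "((\<lambda>x. \<Sum>X\<in>UNIV. s ^ card X * f X x) has_integral measure lebesgue (cball (0::(real,'m) vec) R)) UNIV"
      by simp
    moreover have "((\<lambda>x. \<Sum>X\<in>UNIV. s ^ card X * f X x) has_integral (\<Sum>X\<in>UNIV. s ^ card X * (\<integral>x. f X x \<partial>lebesgue))) UNIV"
      by (intro has_integral_sum has_integral_mult_right has_integral_integral_lebesgue fi) auto
    ultimately show ?thesis by (rule has_integral_unique[symmetric])
  qed
  have "(\<integral>x. f UNIV x \<partial>lebesgue) = 0"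
    by (rule sum_power_card_eq_const_imp[OF key s1])
  moreover have "(\<integral>x. f UNIV x \<partial>lebesgue) = (\<integral>x. det (A x) \<partial>lebesgue)"
  proof (rule integral_cong_AE[OF mf])
    show "(\<lambda>x. det (A x)) \<in> borel_measurable lebesgue"
      unfolding det_def using mA
      by (intro borel_measurable_times borel_measurable_sum borel_measurable_prod borel_measurable_const)
    show "AE x in lebesgue. f UNIV x = det (A x)"
      using AE_Df
    proof eventually_elim
      fix x assume x: "x \<in> Df"
      show "f UNIV x = det (A x)"
      proof (cases "x \<in> cball 0 R")
        case True
        then show ?thesis using x by (simp add: f_def D_def det_minor_sum_UNIV)
      next
        case False
        have "frechet_derivative (g i) (at x) = (\<lambda>w. 0)" for i
        proof (rule frechet_derivative_at[symmetric])
          show "(g i has_derivative (\<lambda>w. 0)) (at x)"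
          proof (rule has_derivative_transform_within_open[of "\<lambda>x. 0"])
            show "open (- cball (0::(real,'m) vec) R)" by auto
          qed (use False zero in auto)
        qed
        then have "A x = 0" by (simp add: A_def vec_eq_iff)
        moreover have "det (0 :: ((real,'m) vec,'m) vec) = 0" by (simp add: det_def power_0_left)
        ultimately show ?thesis using False by (simp add: f_def D_def)
      qed
    qed
  qed
  ultimately show ?thesis by (simp add: A_def)
qed

section \<open>Reindexing determinants\<close>

text \<open>The reindexing is conjugation of p by f, extended by the identity. Plain injectivity
  lets one lemma serve bijective relabelling and also the embedding \<open>Some\<close>.\<close>

lemma sum_permutes_range:
  fixes f :: "'k::finite \<Rightarrow> 'l"
  assumes "inj f"
  shows "(\<Sum>q | q permutes range f. F q) = (\<Sum>p | p permutes (UNIV::'k set). F (map_permutation UNIV f p))"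
proof (rule sum.reindex_bij_betw[symmetric])
  have bij: "bij_betw f UNIV (range f)" using assms by (simp add: bij_betw_def)
  have bij': "bij_betw (inv f) (range f) UNIV" using bij by (rule bij_betw_inv_into)
  show "bij_betw (map_permutation UNIV f) {p. p permutes UNIV} {q. q permutes range f}"
  proof (rule bij_betw_byWitness[where f' = "map_permutation (range f) (inv f)"])
    show "\<forall>p\<in>{p. p permutes UNIV}. map_permutation (range f) (inv f) (map_permutation UNIV f p) = p"
      using map_permutation_compose_inv[OF bij, of _ "inv f"] assms by auto
    show "\<forall>q\<in>{q. q permutes range f}. map_permutation UNIV f (map_permutation (range f) (inv f) q) = q"
      using map_permutation_compose_inv[OF bij', of _ f] by (auto simp: f_inv_into_f)
  qed (use map_permutation_permutes[OF bij] map_permutation_permutes[OF bij'] in auto)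
qed

lemma det_reindex:
  fixes A :: "real^'l^'l" and f :: "'k::finite \<Rightarrow> 'l"
  assumes "bij f"
  shows "det (\<chi> i j. A $ f i $ f j) = det A"
proof -
  have "det A = (\<Sum>q | q permutes range f. of_int (sign q) * (\<Prod>i\<in>UNIV. A $ i $ q i))"
    using assms by (simp add: det_def bij_is_surj)
  also have "\<dots> = (\<Sum>p | p permutes UNIV. of_int (sign p) * (\<Prod>i\<in>UNIV. A $ f i $ f (p i)))"
  proof (subst sum_permutes_range[OF bij_is_inj[OF assms]], intro sum.cong refl)
    fix p :: "'k \<Rightarrow> 'k" assume "p \<in> {p. p permutes UNIV}"
    then have "sign (map_permutation UNIV f p) = sign p"
      using assms by (intro sign_map_permutation) (auto simp: bij_is_inj)
    moreover have "(\<Prod>i\<in>UNIV. A $ i $ map_permutation UNIV f p i) = (\<Prod>i\<in>UNIV. A $ f i $ map_permutation UNIV f p (f i))"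
      by (rule prod.reindex_bij_betw[OF assms, symmetric])
    ultimately show "of_int (sign (map_permutation UNIV f p)) * (\<Prod>i\<in>UNIV. A $ i $ map_permutation UNIV f p i)
       = of_int (sign p) * (\<Prod>i\<in>UNIV. A $ f i $ f (p i))"
      using assms by (simp add: map_permutation_apply bij_is_inj)
  qed
  finally show ?thesis by (simp add: det_def)
qed

lemma UNIV_option_prod: "(\<Prod>i\<in>(UNIV::'k::finite option set). f i) = f None * (\<Prod>i\<in>UNIV. f (Some i))"
  by (simp add: UNIV_option_conv prod.reindex)

text \<open>A permutation moving \<open>None\<close> sends some \<open>Some k\<close> to
  \<open>None\<close>, so its product contains a zero entry. The surviving permutations are exactly
  those of \<open>range Some\<close>.\<close>

lemma det_option_block:
  fixes A :: "real^('k::finite option)^('k option)"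
  assumes "\<And>i. A $ Some i $ None = 0"
  shows "det A = A $ None $ None * det (\<chi> i j. A $ Some i $ Some j)"
proof -
  have "det A = (\<Sum>q | q permutes range Some. of_int (sign q) * (\<Prod>i\<in>UNIV. A $ i $ q i))"
    unfolding det_def
  proof (rule sum.mono_neutral_right)
    show "{q. q permutes range (Some :: 'k \<Rightarrow> _)} \<subseteq> {p. p permutes UNIV}"
      by (auto intro: permutes_subset)
    show "\<forall>q\<in>{p. p permutes UNIV} - {q. q permutes range Some}. of_int (sign q) * (\<Prod>i\<in>UNIV. A $ i $ q i) = 0"
    proof
      fix q assume q: "q \<in> {p. p permutes UNIV} - {q. q permutes range (Some :: 'k \<Rightarrow> _)}"
      then have qU: "q permutes UNIV" by simp
      have "q None \<noteq> None"
      proof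
        assume "q None = None"
        have "q permutes range Some"
        proof (rule permutes_superset[OF qU])
          fix x :: "'k option" assume "x \<in> UNIV - range Some"
          then have "x = None" by (cases x) auto
          then show "q x = x" using \<open>q None = None\<close> by simp
        qed
        then show False using q by blast
      qed
      moreover have "surj q" by (rule permutes_surj[OF qU])
      then obtain i where "None = q i" by (rule surjE)
      then have i: "q i = None" ..
      ultimately obtain k where "i = Some k" by (cases i) auto
      then have "A $ i $ q i = 0" using assms i by simp
      then have "(\<Prod>i\<in>UNIV. A $ i $ q i) = 0" by (intro prod_zero) auto
      then show "of_int (sign q) * (\<Prod>i\<in>UNIV. A $ i $ q i) = 0" by simp
    qed
  qed (simp add: finite_permutations)
  also have "\<dots> = (\<Sum>p | p permutes UNIV. A $ None $ None * (of_int (sign p) * (\<Prod>i\<in>UNIV. A $ Some i $ Some (p i))))"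
  proof (subst sum_permutes_range[OF inj_Some], intro sum.cong refl)
    fix p :: "'k \<Rightarrow> 'k" assume "p \<in> {p. p permutes UNIV}"
    then have "sign (map_permutation UNIV Some p) = sign p"
      by (intro sign_map_permutation) auto
    moreover have "map_permutation UNIV Some p None = None"
      by (simp add: map_permutation_def restrict_id_def image_iff)
    ultimately show "of_int (sign (map_permutation UNIV Some p)) * (\<Prod>i\<in>UNIV. A $ i $ map_permutation UNIV Some p i)
       = A $ None $ None * (of_int (sign p) * (\<Prod>i\<in>UNIV. A $ Some i $ Some (p i)))"
      by (simp add: UNIV_option_prod map_permutation_apply)
  qed
  finally show ?thesis by (simp add: det_def sum_distrib_left)
qed

section \<open>Coordinates indexed by an arbitrary finite type\<close>

text \<open>The change of variables theorem requires a well-ordered index type; \<open>'k wo\<close> is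
  a copy of \<open>'k\<close> carrying an arbitrary well-order.\<close>

datatype 'k wo = Wo (unwo: 'k)

lemma bij_unwo: "bij unwo"
  by (rule bij_betw_byWitness[where f' = Wo]) auto

instance wo :: (finite) finite
  by standard (simp add: bij_betw_finite[OF bij_unwo])

definition wo_rank :: "'k::finite wo \<Rightarrow> nat" where
  "wo_rank = (SOME f. inj f)"

lemma inj_wo_rank: "inj (wo_rank :: 'k::finite wo \<Rightarrow> nat)"
proof -
  have "\<exists>f :: 'k wo \<Rightarrow> nat. inj f"
    using finite_imp_inj_to_nat_seg[of "UNIV :: 'k wo set"] by auto
  then show ?thesis unfolding wo_rank_def by (rule someI_ex)
qed

instantiation wo :: (finite) wellorder
begin
definition less_eq_wo :: "'a wo \<Rightarrow> 'a wo \<Rightarrow> bool" where "less_eq_wo x y \<longleftrightarrow> wo_rank x \<le> wo_rank y"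
definition less_wo :: "'a wo \<Rightarrow> 'a wo \<Rightarrow> bool" where "less_wo x y \<longleftrightarrow> wo_rank x < wo_rank y"
instance
proof
  fix P :: "'a wo \<Rightarrow> bool" and a
  assume *: "\<And>x. (\<And>y. y < x \<Longrightarrow> P y) \<Longrightarrow> P x"
  show "P a"
    by (induct a rule: measure_induct_rule[of wo_rank]) (rule *, simp add: less_wo_def)
qed (auto simp: less_eq_wo_def less_wo_def dest: injD[OF inj_wo_rank])
end

section \<open>Isometric coordinates on a Euclidean space\<close>

context
  fixes e :: "'k::finite \<Rightarrow> 'a::euclidean_space"
  assumes e: "bij_betw e UNIV Basis"
begin

definition from_coords :: "real^('k wo) \<Rightarrow> 'a" where
  "from_coords y = (\<Sum>b\<in>UNIV. y $ b *\<^sub>R e (unwo b))"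

lemma index_image_in_Basis: "e k \<in> Basis" using e by (auto simp: bij_betw_def)

lemma inner_from_coords: "from_coords y \<bullet> e k = y $ Wo k"
proof -
  have "from_coords y \<bullet> e k = (\<Sum>b\<in>UNIV. y $ b * (e (unwo b) \<bullet> e k))"
    by (simp add: from_coords_def inner_sum_left)
  also have "\<dots> = (\<Sum>b\<in>UNIV. if b = Wo k then y $ b else 0)"
  proof (rule sum.cong[OF refl])
    fix b :: "'k wo"
    have "e (unwo b) = e k \<longleftrightarrow> b = Wo k"
      using e by (metis bij_betw_def injD wo.collapse wo.sel)
    then show "y $ b * (e (unwo b) \<bullet> e k) = (if b = Wo k then y $ b else 0)"
      using inner_Basis[OF index_image_in_Basis index_image_in_Basis, of "unwo b" k] by simp
  qed
  finally show ?thesis by simp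
qed

lemma bounded_linear_from_coords: "bounded_linear from_coords"
  unfolding from_coords_def by (intro bounded_linear_sum bounded_linear_scaleR_left bounded_linear_compose[OF bounded_linear_scaleR_left] bounded_linear_vec_nth)

lemma bij_betw_wo_Basis: "bij_betw (\<lambda>b. e (unwo b)) UNIV Basis"
  using bij_betw_trans[OF bij_unwo e] by (simp add: o_def)

lemma norm_from_coords: "norm (from_coords y) = norm y"
proof -
  have "from_coords y \<bullet> from_coords y = (\<Sum>b\<in>Basis. (from_coords y \<bullet> b) * (from_coords y \<bullet> b))"
    by (rule euclidean_inner)
  also have "\<dots> = (\<Sum>b\<in>UNIV. (from_coords y \<bullet> e (unwo b)) * (from_coords y \<bullet> e (unwo b)))"
    by (rule sum.reindex_bij_betw[OF bij_betw_wo_Basis, symmetric])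
  also have "\<dots> = y \<bullet> y" by (simp add: inner_from_coords inner_vec_def)
  finally show ?thesis by (simp add: norm_eq_sqrt_inner)
qed

lemma from_coords_axis: "from_coords (axis b 1) = e (unwo b)"
  by (simp add: from_coords_def axis_def if_distrib[of "\<lambda>c. c *\<^sub>R _"] cong: if_cong)

text \<open>The map carries coordinate axes to basis vectors, so preimages of boxes are boxes with
  the same side lengths, and boxes determine Lebesgue measure.\<close>

lemma distr_from_coords: "distr lborel borel from_coords = lborel"
proof (rule lborel_eqI[symmetric])
  have bm: "from_coords \<in> borel_measurable borel"
    using linear_continuous_on[OF bounded_linear_from_coords] by (rule borel_measurable_continuous_onI)
  fix l u :: 'a assume lu: "\<And>b. b \<in> Basis \<Longrightarrow> l \<bullet> b \<le> u \<bullet> b"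
  define l' where "l' = (\<chi> b. l \<bullet> e (unwo b))"
  define u' where "u' = (\<chi> b. u \<bullet> e (unwo b))"
  have "from_coords -` box l u = box l' u'"
  proof (intro set_eqI)
    fix y
    have "from_coords y \<in> box l u \<longleftrightarrow> (\<forall>b. l \<bullet> e (unwo b) < from_coords y \<bullet> e (unwo b) \<and> from_coords y \<bullet> e (unwo b) < u \<bullet> e (unwo b))"
    proof -
      have BE: "(Basis :: 'a set) = range (\<lambda>b. e (unwo b))" using bij_betw_wo_Basis by (simp add: bij_betw_def)
      show ?thesis unfolding mem_box BE by simp
    qed
    also have "\<dots> \<longleftrightarrow> y \<in> box l' u'"
      by (simp add: inner_from_coords mem_box_cart l'_def u'_def)
    finally show "y \<in> from_coords -` box l u \<longleftrightarrow> y \<in> box l' u'" by simp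
  qed
  then have "emeasure (distr lborel borel from_coords) (box l u) = emeasure lborel (box l' u')"
    using bm by (subst emeasure_distr) auto
  also have "\<dots> = (\<Prod>b\<in>Basis. (u' - l') \<bullet> b)"
    by (rule emeasure_lborel_box) (use lu index_image_in_Basis in \<open>auto simp: Basis_vec_def inner_axis l'_def u'_def\<close>)
  also have "(\<Prod>b\<in>Basis. (u' - l') \<bullet> b) = (\<Prod>b\<in>UNIV. (u' - l') \<bullet> axis b 1)"
    by (rule prod.reindex_bij_betw[symmetric])
      (auto simp: bij_betw_def inj_on_def axis_eq_axis Basis_vec_def)
  also have "\<dots> = (\<Prod>b\<in>UNIV. (u - l) \<bullet> e (unwo b))"
    by (simp add: inner_axis l'_def u'_def inner_diff_left)
  also have "\<dots> = (\<Prod>b\<in>Basis. (u - l) \<bullet> b)"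
    by (rule prod.reindex_bij_betw[OF bij_betw_wo_Basis])
  finally show "emeasure (distr lborel borel from_coords) (box l u) = (\<Prod>b\<in>Basis. (u - l) \<bullet> b)" .
qed simp

lemma from_coords_borel [measurable]: "from_coords \<in> borel_measurable borel"
  using linear_continuous_on[OF bounded_linear_from_coords] by (rule borel_measurable_continuous_onI)

lemma AE_from_coords:
  assumes "AE x in lebesgue. P x"
  shows "AE y in lebesgue. P (from_coords y)"
proof -
  have "AE x in distr lborel borel from_coords. P x"
    using assms unfolding distr_from_coords AE_completion_iff .
  then have "AE y in lborel. P (from_coords y)" by (rule AE_distrD[rotated]) simp
  then show ?thesis by (rule AE_completion)
qed

text \<open>The image measure formula concerns Borel functions, so F is replaced by a Borel
  representative. For the Jacobian, the assumption on the composed function comes from its a.e.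
  equality with the coordinate determinant.\<close>

lemma integral_from_coords:
  fixes F :: "'a \<Rightarrow> real"
  assumes F: "F \<in> borel_measurable lebesgue" and FL: "(\<lambda>y. F (from_coords y)) \<in> borel_measurable lebesgue"
  shows "(\<integral>y. F (from_coords y) \<partial>lebesgue) = (\<integral>x. F x \<partial>lebesgue)"
proof -
  obtain F' where F': "F' \<in> borel_measurable borel" "AE x in lborel. F x = F' x"
    using completion_ex_borel_measurable_real[OF F] by auto
  have AE: "AE x in lebesgue. F x = F' x" using F'(2) by (rule AE_completion)
  have F'c: "(\<lambda>y. F' (from_coords y)) \<in> borel_measurable borel"
    using F'(1) by measurable
  have "(\<integral>y. F (from_coords y) \<partial>lebesgue) = (\<integral>y. F' (from_coords y) \<partial>lebesgue)"
    by (rule integral_cong_AE[OF FL _ AE_from_coords[OF AE]]) (use F'c in \<open>intro measurable_completion, simp\<close>)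
  also have "\<dots> = (\<integral>y. F' (from_coords y) \<partial>lborel)" using F'c by (simp add: integral_completion)
  also have "\<dots> = (\<integral>x. F' x \<partial>distr lborel borel from_coords)"
    by (rule integral_distr[symmetric]) (use F'(1) in auto)
  also have "\<dots> = (\<integral>x. F' x \<partial>lebesgue)" using F'(1) by (simp add: distr_from_coords integral_completion)
  also have "\<dots> = (\<integral>x. F x \<partial>lebesgue)"
    by (rule integral_cong_AE[symmetric, OF F _ AE]) (use F'(1) in \<open>intro measurable_completion, simp\<close>)
  finally show ?thesis .
qed

definition jacobian :: "('k \<Rightarrow> 'a \<Rightarrow> real) \<Rightarrow> 'a \<Rightarrow> real^'k^'k" where
  "jacobian g x = (\<chi> i j. frechet_derivative (g i) (at x) (e j))"

lemma borel_measurable_det: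
  fixes A :: "'b \<Rightarrow> real^'m^'m"
  assumes "\<And>i j. (\<lambda>x. A x $ i $ j) \<in> borel_measurable M"
  shows "(\<lambda>x. det (A x)) \<in> borel_measurable M"
  unfolding det_def using assms
  by (intro borel_measurable_times borel_measurable_sum borel_measurable_prod borel_measurable_const)

lemma borel_measurable_det_jacobian:
  assumes "\<And>i. \<exists>L. L-lipschitz_on UNIV (g i)"
  shows "(\<lambda>x. det (jacobian g x)) \<in> borel_measurable lebesgue"
proof (rule borel_measurable_det)
  fix i j
  obtain L where "L-lipschitz_on UNIV (g i)" using assms by blast
  from borel_measurable_frechet_derivative[OF this]
  show "(\<lambda>x. jacobian g x $ i $ j) \<in> borel_measurable lebesgue" by (simp add: jacobian_def)
qed

lemma integral_det_jacobian_eq_0: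
  assumes lip: "\<And>i. L-lipschitz_on UNIV (g i)" and zero: "\<And>i x. norm x > R \<Longrightarrow> g i x = 0"
  shows "(\<integral>x. det (jacobian g x) \<partial>lebesgue) = 0"
proof -
  define g' where "g' = (\<lambda>b y. g (unwo b) (from_coords y))"
  define A' where "A' = (\<lambda>y. \<chi> b c. frechet_derivative (g' b) (at y) (axis c 1))"
  have lin: "linear from_coords" using bounded_linear_from_coords by (rule bounded_linear.linear)
  have lip': "L-lipschitz_on UNIV (g' b)" for b
  proof (rule lipschitz_onI)
    fix y z :: "real^'k wo"
    have "dist (from_coords y) (from_coords z) = dist y z"
      using norm_from_coords[of "y - z"] lin by (simp add: dist_norm linear_diff)
    then show "dist (g' b y) (g' b z) \<le> L * dist y z"
      using lipschitz_onD[OF lip, of "from_coords y" "from_coords z"] by (simp add: g'_def)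
  qed (use lip lipschitz_on_nonneg in blast)
  have AE_diff: "AE x in lebesgue. \<forall>i. g i differentiable (at x)"
    by (intro AE_all_countable[THEN iffD2] allI Rademacher[OF lip])
  have AE: "AE y in lebesgue. det (A' y) = det (jacobian g (from_coords y))"
    using AE_from_coords[OF AE_diff]
  proof eventually_elim
    fix y assume y: "\<forall>i. g i differentiable (at (from_coords y))"
    have "A' y = (\<chi> b c. jacobian g (from_coords y) $ unwo b $ unwo c)"
    proof -
      have "frechet_derivative (g' b) (at y) (axis c 1) = jacobian g (from_coords y) $ unwo b $ unwo c" for b c
      proof -
        have "(g' b has_derivative (\<lambda>w. frechet_derivative (g (unwo b)) (at (from_coords y)) (from_coords w))) (at y)"
          unfolding g'_def
          by (rule has_derivative_compose[OF bounded_linear_imp_has_derivative[OF bounded_linear_from_coords]])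
            (use y in \<open>simp add: frechet_derivative_works[symmetric]\<close>)
        from frechet_derivative_at[OF this, symmetric] show ?thesis
          by (simp add: jacobian_def from_coords_axis)
      qed
      then show ?thesis by (simp add: A'_def vec_eq_iff)
    qed
    then show "det (A' y) = det (jacobian g (from_coords y))" using det_reindex[OF bij_unwo] by simp
  qed
  have mA': "(\<lambda>y. det (A' y)) \<in> borel_measurable lebesgue"
    by (rule borel_measurable_det) (use borel_measurable_frechet_derivative[OF lip'] in \<open>simp add: A'_def\<close>)
  have mJ: "(\<lambda>x. det (jacobian g x)) \<in> borel_measurable lebesgue"
    using lip by (intro borel_measurable_det_jacobian) blast
  have mJ': "(\<lambda>y. det (jacobian g (from_coords y))) \<in> borel_measurable lebesgue"
    using mA' AE by (rule borel_measurable_AE)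
  have "(\<integral>y. det (A' y) \<partial>lebesgue) = 0"
    unfolding A'_def
    by (rule integral_det_jacobian_eq_0_cart[OF lip', of R]) (use zero norm_from_coords in \<open>auto simp: g'_def\<close>)
  moreover have "(\<integral>y. det (A' y) \<partial>lebesgue) = (\<integral>y. det (jacobian g (from_coords y)) \<partial>lebesgue)"
    by (rule integral_cong_AE[OF mA' mJ' AE])
  ultimately show ?thesis using integral_from_coords[OF mJ mJ'] by simp
qed

end

section \<open>Integration by parts for Jacobian determinants\<close>

lemma lipschitz_on_mult_bounded:
  fixes f g :: "'a::metric_space \<Rightarrow> real"
  assumes f: "L-lipschitz_on S f" "\<And>x. x \<in> S \<Longrightarrow> \<bar>f x\<bar> \<le> B"
    and g: "M-lipschitz_on S g" "\<And>x. x \<in> S \<Longrightarrow> \<bar>g x\<bar> \<le> C" and "B \<ge> 0" "C \<ge> 0"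
  shows "(B * M + C * L)-lipschitz_on S (\<lambda>x. f x * g x)"
proof (rule lipschitz_onI)
  fix x y assume xy: "x \<in> S" "y \<in> S"
  have "\<bar>f x\<bar> * \<bar>g x - g y\<bar> \<le> B * (M * dist x y)"
    using f(2)[OF xy(1)] lipschitz_onD[OF g(1) xy] \<open>B \<ge> 0\<close> by (intro mult_mono) (auto simp: dist_real_def)
  moreover have "\<bar>g y\<bar> * \<bar>f x - f y\<bar> \<le> C * (L * dist x y)"
    using g(2)[OF xy(2)] lipschitz_onD[OF f(1) xy] \<open>C \<ge> 0\<close> by (intro mult_mono) (auto simp: dist_real_def)
  moreover have "\<bar>f x * g x - f y * g y\<bar> \<le> \<bar>f x\<bar> * \<bar>g x - g y\<bar> + \<bar>g y\<bar> * \<bar>f x - f y\<bar>"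
  proof -
    have "f x * g x - f y * g y = f x * (g x - g y) + g y * (f x - f y)" by (simp add: algebra_simps)
    then show ?thesis by (metis abs_mult abs_triangle_ineq)
  qed
  ultimately show "dist (f x * g x) (f y * g y) \<le> (B * M + C * L) * dist x y"
    by (simp add: dist_real_def algebra_simps)
qed (use assms lipschitz_on_nonneg in \<open>auto intro!: add_nonneg_nonneg mult_nonneg_nonneg\<close>)

text \<open>Bound for an n x n determinant with entries at most L in absolute value: the factorial
  counts the terms of the Leibniz expansion.\<close>

definition leibniz_bound :: "nat \<Rightarrow> real \<Rightarrow> real" where
  "leibniz_bound n L = fact n * L ^ n"

lemma leibniz_bound_nonneg: "L \<ge> 0 \<Longrightarrow> leibniz_bound n L \<ge> 0"
  by (simp add: leibniz_bound_def)

section \<open>Estimates for Jacobian integrals under changes of one component\<close>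

context
  fixes e :: "'k::finite \<Rightarrow> 'a::euclidean_space"
  assumes e: "bij_betw e UNIV Basis"
begin

abbreviation det_jacobian :: "('k \<Rightarrow> 'a \<Rightarrow> real) \<Rightarrow> 'a \<Rightarrow> real" where
  "det_jacobian g x \<equiv> det (jacobian e g x)"

lemma abs_det_jacobian_le:
  assumes lip: "\<And>i. L-lipschitz_on UNIV (g i)"
  shows "AE x in lebesgue. \<bar>det_jacobian g x\<bar> \<le> leibniz_bound CARD('k) L"
proof -
  have "AE x in lebesgue. \<forall>i j. \<bar>frechet_derivative (g i) (at x) (e j)\<bar> \<le> L * norm (e j)"
    by (intro AE_all_countable[THEN iffD2] allI AE_frechet_derivative_bound[OF lip])
  then show ?thesis
  proof eventually_elim
    fix x assume "\<forall>i j. \<bar>frechet_derivative (g i) (at x) (e j)\<bar> \<le> L * norm (e j)"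
    moreover have "norm (e j) = 1" for j using index_image_in_Basis[OF e] by simp
    ultimately have "\<bar>jacobian e g x $ i $ j\<bar> \<le> L" for i j by (simp add: jacobian_def[OF e])
    from abs_det_minor_sum_le[OF this, of UNIV] show "\<bar>det_jacobian g x\<bar> \<le> leibniz_bound CARD('k) L"
      by (simp add: leibniz_bound_def card_permutations[OF refl] det_minor_sum_UNIV)
  qed
qed

lemma lipschitz_measurable_det_jacobian:
  assumes "\<And>i. L-lipschitz_on UNIV (g i)"
  shows "det_jacobian g \<in> borel_measurable lebesgue"
  using assms by (intro borel_measurable_det_jacobian[OF e]) blast

lemma integrable_mult_det_jacobian:
  assumes lip: "\<And>i. L-lipschitz_on UNIV (g i)" and \<psi>: "M-lipschitz_on UNIV \<psi>"
    and zero: "\<And>x. norm x > R \<Longrightarrow> \<psi> x = 0"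
  shows "integrable lebesgue (\<lambda>x. \<psi> x * det_jacobian g x)"
proof -
  obtain B where B: "B \<ge> 0" "\<And>x. \<bar>\<psi> x\<bar> \<le> B"
    using lipschitz_bounded_range[OF \<psi> bounded_cball[of 0 R]] zero by auto
  have m: "(\<lambda>x. \<psi> x * det_jacobian g x) \<in> borel_measurable lebesgue"
    by (intro borel_measurable_times lipschitz_borel_measurable[OF \<psi>] lipschitz_measurable_det_jacobian[OF lip])
  show ?thesis
  proof (rule integrable_bounded_support[OF m bounded_cball[of 0 R]])
    show "AE x in lebesgue. \<bar>\<psi> x * det_jacobian g x\<bar> \<le> B * leibniz_bound CARD('k) L"
      using abs_det_jacobian_le[OF lip]
      by eventually_elim (auto simp: abs_mult intro!: mult_mono B)
  qed (use zero in auto)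
qed

text \<open>Linearity of the determinant in row k, in the form shared by the product rule (\<alpha>
  and \<beta> are the values of the factors) and by differences (1 and -1).\<close>

lemma det_jacobian_update:
  assumes f: "(f has_derivative (\<lambda>w. \<alpha> * frechet_derivative u (at x) w + \<beta> * frechet_derivative v (at x) w)) (at x)"
  shows "det_jacobian (g(k := f)) x = \<alpha> * det_jacobian (g(k := u)) x + \<beta> * det_jacobian (g(k := v)) x"
proof -
  define r where "r = (\<lambda>h. (\<chi> j. frechet_derivative h (at x) (e j)) :: real^'k)"
  have jac: "jacobian e (g(k := h)) x = (\<chi> i. if i = k then r h else r (g i))" for h
    by (simp add: jacobian_def[OF e] r_def vec_eq_iff)
  have rf: "r f = \<alpha> *s r u + \<beta> *s r v"
    by (simp add: r_def vec_eq_iff frechet_derivative_at[OF f, symmetric])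
  show ?thesis
    using det_row_add[of k "\<lambda>i. \<alpha> *s r u" "\<lambda>i. \<beta> *s r v" "\<lambda>i. r (g i)"]
      det_row_mul[of k \<alpha> "\<lambda>i. r u" "\<lambda>i. r (g i)"] det_row_mul[of k \<beta> "\<lambda>i. r v" "\<lambda>i. r (g i)"]
    unfolding jac rf by simp
qed

lemma det_jacobian_integration_by_parts:
  assumes lip: "\<And>i. L-lipschitz_on UNIV (w i)" and zero: "\<And>i x. norm x > R \<Longrightarrow> w i x = 0"
    and \<psi>: "M-lipschitz_on UNIV \<psi>" "\<And>x. norm x > R \<Longrightarrow> \<psi> x = 0"
  shows "(\<integral>x. \<psi> x * det_jacobian w x \<partial>lebesgue) = - (\<integral>x. w k x * det_jacobian (w(k := \<psi>)) x \<partial>lebesgue)"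
proof -
  have L0: "L \<ge> 0" "M \<ge> 0" using lip \<psi> lipschitz_on_nonneg by blast+
  obtain B where B: "B \<ge> 0" "\<And>x. \<bar>\<psi> x\<bar> \<le> B"
    using lipschitz_bounded_range[OF \<psi>(1) bounded_cball[of 0 R]] \<psi>(2) by auto
  obtain C where C: "C \<ge> 0" "\<And>x. \<bar>w k x\<bar> \<le> C"
    using lipschitz_bounded_range[OF lip bounded_cball[of 0 R]] zero by auto
  define f where "f = (\<lambda>x. \<psi> x * w k x)"
  have flip: "(B * L + C * M)-lipschitz_on UNIV f"
    unfolding f_def by (rule lipschitz_on_mult_bounded) (use \<psi> lip B C in auto)
  \<comment> \<open>The identity asks for one Lipschitz constant valid for all components; the sum
    dominates those of the \<open>w i\<close>, of \<psi> and of their product.\<close>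
  define N where "N = L + M + (B * L + C * M)"
  have N: "L \<le> N" "M \<le> N" "B * L + C * M \<le> N" using L0 B C by (auto simp: N_def)
  have lipf: "N-lipschitz_on UNIV ((w(k := f)) i)" for i
    using lipschitz_on_leI lip[of i] flip N by (auto intro: lipschitz_on_le)
  have lip\<psi>: "N-lipschitz_on UNIV ((w(k := \<psi>)) i)" for i
    using lip[of i] \<psi>(1) N by (auto intro: lipschitz_on_le)
  have i1: "integrable lebesgue (\<lambda>x. \<psi> x * det_jacobian w x)"
    by (rule integrable_mult_det_jacobian[OF lip \<psi>])
  have i2: "integrable lebesgue (\<lambda>x. w k x * det_jacobian (w(k := \<psi>)) x)"
    by (rule integrable_mult_det_jacobian[OF lip\<psi> lip zero])
  have "0 = (\<integral>x. det_jacobian (w(k := f)) x \<partial>lebesgue)"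
    by (rule integral_det_jacobian_eq_0[OF e lipf, symmetric, of R]) (use zero in \<open>auto simp: f_def\<close>)
  also have "\<dots> = (\<integral>x. \<psi> x * det_jacobian w x + w k x * det_jacobian (w(k := \<psi>)) x \<partial>lebesgue)"
  proof (rule integral_cong_AE[OF lipschitz_measurable_det_jacobian[OF lipf]])
    show "(\<lambda>x. \<psi> x * det_jacobian w x + w k x * det_jacobian (w(k := \<psi>)) x) \<in> borel_measurable lebesgue"
      using i1 i2 by auto
    show "AE x in lebesgue. det_jacobian (w(k := f)) x = \<psi> x * det_jacobian w x + w k x * det_jacobian (w(k := \<psi>)) x"
      using Rademacher[OF lip[of k]] Rademacher[OF \<psi>(1)]
    proof eventually_elim
      fix x assume d: "w k differentiable (at x)" "\<psi> differentiable (at x)"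
      have "(f has_derivative (\<lambda>z. \<psi> x * frechet_derivative (w k) (at x) z + w k x * frechet_derivative \<psi> (at x) z)) (at x)"
        unfolding f_def
        by (rule has_derivative_eq_rhs[OF has_derivative_mult[OF differentiable_imp_has_frechet_derivative[OF d(2)] differentiable_imp_has_frechet_derivative[OF d(1)]]])
          (simp add: mult.commute)
      from det_jacobian_update[OF this, of w k] show "det_jacobian (w(k := f)) x = \<psi> x * det_jacobian w x + w k x * det_jacobian (w(k := \<psi>)) x"
        by simp
    qed
  qed
  also have "\<dots> = (\<integral>x. \<psi> x * det_jacobian w x \<partial>lebesgue) + (\<integral>x. w k x * det_jacobian (w(k := \<psi>)) x \<partial>lebesgue)"
    using i1 i2 by simp
  finally show ?thesis by simp
qed

text \<open>By linearity in row k the difference is the Jacobian integral with d = u - w k in that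
  row. Integration by parts exchanges d with \<psi>, so d enters only through its size \<delta>. The
  constant 2 L + M dominates the Lipschitz constants of d, \<psi> and the other rows.\<close>

lemma integral_det_jacobian_update_diff_le:
  assumes lip: "\<And>i. L-lipschitz_on UNIV (w i)" and zero: "\<And>i x. norm x > R \<Longrightarrow> w i x = 0"
    and u: "L-lipschitz_on UNIV u" "\<And>x. norm x > R \<Longrightarrow> u x = 0"
    and \<psi>: "M-lipschitz_on UNIV \<psi>" "\<And>x. norm x > R \<Longrightarrow> \<psi> x = 0"
    and \<delta>: "\<And>x. \<bar>u x - w k x\<bar> \<le> \<delta>"
  shows "\<bar>(\<integral>x. \<psi> x * det_jacobian (w(k := u)) x \<partial>lebesgue) - (\<integral>x. \<psi> x * det_jacobian w x \<partial>lebesgue)\<bar>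
    \<le> \<delta> * (leibniz_bound CARD('k) (2 * L + M) * measure lebesgue (cball (0::'a) R))"
proof -
  have L0: "L \<ge> 0" "M \<ge> 0" using lip \<psi> lipschitz_on_nonneg by blast+
  have \<delta>0: "\<delta> \<ge> 0" using \<delta>[of 0] by linarith
  define d where "d = (\<lambda>x. u x - w k x)"
  have d: "(2 * L)-lipschitz_on UNIV d"
    using lipschitz_on_diff[OF u(1) lip[of k]] by (simp add: d_def)
  have dz: "d x = 0" if "norm x > R" for x using that u zero by (simp add: d_def)
  define N where "N = 2 * L + M"
  have N: "L \<le> N" "2 * L \<le> N" "M \<le> N" "N \<ge> 0" using L0 by (auto simp: N_def)
  have lipd: "(2 * L)-lipschitz_on UNIV ((w(k := d)) i)" for i
    using d lip[of i] L0 by (auto intro: lipschitz_on_le)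
  have lipu: "L-lipschitz_on UNIV ((w(k := u)) i)" for i
    using u lip[of i] by auto
  have lip\<psi>: "N-lipschitz_on UNIV ((w(k := \<psi>)) i)" for i
    using lip[of i] \<psi>(1) N by (auto intro: lipschitz_on_le)
  have zd: "(w(k := d)) i x = 0" if "norm x > R" for i x using that zero dz by auto
  have "(\<integral>x. \<psi> x * det_jacobian (w(k := u)) x \<partial>lebesgue) - (\<integral>x. \<psi> x * det_jacobian w x \<partial>lebesgue)
    = (\<integral>x. \<psi> x * det_jacobian (w(k := u)) x - \<psi> x * det_jacobian w x \<partial>lebesgue)"
    by (rule Bochner_Integration.integral_diff[OF integrable_mult_det_jacobian[OF lipu \<psi>] integrable_mult_det_jacobian[OF lip \<psi>], symmetric])
  also have "\<dots> = (\<integral>x. \<psi> x * det_jacobian (w(k := d)) x \<partial>lebesgue)"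
  proof (rule integral_cong_AE)
    show "AE x in lebesgue. \<psi> x * det_jacobian (w(k := u)) x - \<psi> x * det_jacobian w x = \<psi> x * det_jacobian (w(k := d)) x"
      using Rademacher[OF lip[of k]] Rademacher[OF u(1)]
    proof eventually_elim
      fix x assume df: "w k differentiable (at x)" "u differentiable (at x)"
      have "(d has_derivative (\<lambda>z. 1 * frechet_derivative u (at x) z + (-1) * frechet_derivative (w k) (at x) z)) (at x)"
        unfolding d_def
        by (rule has_derivative_eq_rhs[OF has_derivative_diff[OF differentiable_imp_has_frechet_derivative[OF df(2)] differentiable_imp_has_frechet_derivative[OF df(1)]]])
          simp
      from det_jacobian_update[OF this, of w k] have "det_jacobian (w(k := d)) x = det_jacobian (w(k := u)) x - det_jacobian w x" by simp
      then show "\<psi> x * det_jacobian (w(k := u)) x - \<psi> x * det_jacobian w x = \<psi> x * det_jacobian (w(k := d)) x"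
        by (simp only: right_diff_distrib)
    qed
    show "(\<lambda>x. \<psi> x * det_jacobian (w(k := d)) x) \<in> borel_measurable lebesgue"
      by (rule borel_measurable_integrable[OF integrable_mult_det_jacobian[OF lipd \<psi>]])
    show "(\<lambda>x. \<psi> x * det_jacobian (w(k := u)) x - \<psi> x * det_jacobian w x) \<in> borel_measurable lebesgue"
      by (rule borel_measurable_diff[OF borel_measurable_integrable[OF integrable_mult_det_jacobian[OF lipu \<psi>]]
          borel_measurable_integrable[OF integrable_mult_det_jacobian[OF lip \<psi>]]])
  qed
  also have "\<dots> = - (\<integral>x. d x * det_jacobian (w(k := \<psi>)) x \<partial>lebesgue)"
    using det_jacobian_integration_by_parts[where k = k and w = "w(k := d)" and R = R, OF lipd zd \<psi>] by simp
  also have "\<bar>- (\<integral>x. d x * det_jacobian (w(k := \<psi>)) x \<partial>lebesgue)\<bar> \<le> (\<integral>x. \<bar>d x * det_jacobian (w(k := \<psi>)) x\<bar> \<partial>lebesgue)"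
    using integral_abs_bound by simp
  also have "\<dots> \<le> (\<integral>x. indicator (cball (0::'a) R) x * (\<delta> * leibniz_bound CARD('k) N) \<partial>lebesgue)"
  proof (rule integral_mono_AE)
    show "integrable lebesgue (\<lambda>x. \<bar>d x * det_jacobian (w(k := \<psi>)) x\<bar>)"
      by (intro integrable_abs integrable_mult_det_jacobian[OF lip\<psi> d dz])
    show "integrable lebesgue (\<lambda>x::'a. indicator (cball 0 R) x * (\<delta> * leibniz_bound CARD('k) N))"
      using lmeasurable_cball[of "0::'a" R]
      by (intro integrable_mult_left integrable_real_indicator) (auto simp: fmeasurable_def)
    show "AE x in lebesgue. \<bar>d x * det_jacobian (w(k := \<psi>)) x\<bar> \<le> indicator (cball 0 R) x * (\<delta> * leibniz_bound CARD('k) N)"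
      using abs_det_jacobian_le[OF lip\<psi>]
    proof eventually_elim
      fix x assume *: "\<bar>det_jacobian (w(k := \<psi>)) x\<bar> \<le> leibniz_bound CARD('k) N"
      show "\<bar>d x * det_jacobian (w(k := \<psi>)) x\<bar> \<le> indicator (cball 0 R) x * (\<delta> * leibniz_bound CARD('k) N)"
      proof (cases "norm x \<le> R")
        case True
        have "\<bar>d x\<bar> * \<bar>det_jacobian (w(k := \<psi>)) x\<bar> \<le> \<delta> * leibniz_bound CARD('k) N"
          using \<delta> * \<delta>0 by (intro mult_mono) (auto simp: d_def)
        then show ?thesis using True by (simp add: abs_mult)
      qed (use dz in auto)
    qed
  qed
  also have "\<dots> = \<delta> * (leibniz_bound CARD('k) N * measure lebesgue (cball (0::'a) R))"
    by simp
  finally show ?thesis by (simp add: N_def)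
qed

text \<open>The components are exchanged one at a time, S being the set already exchanged; each
  exchange costs the same bound, whence the factor \<open>CARD('k)\<close>.\<close>

lemma integral_det_jacobian_diff_le:
  assumes u: "\<And>i. L-lipschitz_on UNIV (u i)" "\<And>i x. norm x > R \<Longrightarrow> u i x = 0"
    and v: "\<And>i. L-lipschitz_on UNIV (v i)" "\<And>i x. norm x > R \<Longrightarrow> v i x = 0"
    and \<psi>: "M-lipschitz_on UNIV \<psi>" "\<And>x. norm x > R \<Longrightarrow> \<psi> x = 0"
    and \<delta>: "\<And>i x. \<bar>u i x - v i x\<bar> \<le> \<delta>"
  shows "\<bar>(\<integral>x. \<psi> x * det_jacobian u x \<partial>lebesgue) - (\<integral>x. \<psi> x * det_jacobian v x \<partial>lebesgue)\<bar>
    \<le> real CARD('k) * (\<delta> * (leibniz_bound CARD('k) (2 * L + M) * measure lebesgue (cball (0::'a) R)))"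
proof -
  define D where "D = \<delta> * (leibniz_bound CARD('k) (2 * L + M) * measure lebesgue (cball (0::'a) R))"
  have "\<bar>(\<integral>x. \<psi> x * det_jacobian (\<lambda>i. if i \<in> S then u i else v i) x \<partial>lebesgue) - (\<integral>x. \<psi> x * det_jacobian v x \<partial>lebesgue)\<bar>
    \<le> real (card S) * D" for S :: "'k set"
    using finite[of S]
  proof (induct rule: finite_induct)
    case (insert k S)
    define w where "w = (\<lambda>i. if i \<in> S then u i else v i)"
    have "(\<lambda>i. if i \<in> insert k S then u i else v i) = w(k := u k)"
      by (auto simp: w_def fun_eq_iff)
    moreover have "\<bar>(\<integral>x. \<psi> x * det_jacobian (w(k := u k)) x \<partial>lebesgue) - (\<integral>x. \<psi> x * det_jacobian w x \<partial>lebesgue)\<bar> \<le> D"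
      unfolding D_def
      by (rule integral_det_jacobian_update_diff_le) (use u v \<psi> \<delta> insert(2) in \<open>auto simp: w_def\<close>)
    ultimately show ?case using insert by (simp add: w_def algebra_simps)
  qed simp
  from this[of UNIV] show ?thesis by (simp add: D_def)
qed

end

section \<open>Cutoffs\<close>

text \<open>Equal to 1 up to radius R + 1 and to 0 beyond R + 2. The margin beyond R provides an
  open neighbourhood of the ball of radius R on which multiplication by the cutoff changes no
  derivative.\<close>

definition cutoff :: "real \<Rightarrow> 'a::euclidean_space \<Rightarrow> real" where
  "cutoff R = infdist_bump (cball 0 (R + 1)) 1"

lemma lipschitz_cutoff: "1-lipschitz_on UNIV (cutoff R)"
  unfolding cutoff_def by (rule lipschitz_infdist_bump) simp

lemma abs_cutoff_le: "\<bar>cutoff R x\<bar> \<le> 1"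
  using infdist_bump_bounds[of 1 "cball 0 (R + 1)" x] by (simp add: cutoff_def)

lemma cutoff_eq_1: "norm x \<le> R + 1 \<Longrightarrow> cutoff R x = 1"
  by (simp add: cutoff_def infdist_bump_eq_1)

lemma cutoff_eq_0:
  fixes x :: "'a::euclidean_space"
  assumes "R \<ge> 0" "norm x > R + 2"
  shows "cutoff R x = 0"
proof -
  have ne: "cball (0::'a) (R + 1) \<noteq> {}" using assms by simp
  have "1 \<le> infdist x (cball 0 (R + 1))"
    unfolding infdist_notempty[OF ne]
  proof (rule cINF_greatest[OF ne])
    fix y :: 'a assume "y \<in> cball 0 (R + 1)"
    then show "1 \<le> dist x y" using norm_triangle_ineq2[of x y] assms by (simp add: dist_norm)
  qed
  then show ?thesis by (simp add: cutoff_def infdist_bump_def)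
qed

text \<open>The closest-point retraction onto a convex set is 1-Lipschitz, which makes extending a
  Lipschitz function trivial.\<close>
lemma lipschitz_cutoff_extension:
  fixes f :: "'a::euclidean_space \<Rightarrow> real"
  assumes f: "L-lipschitz_on Q f" "\<And>x. x \<in> Q \<Longrightarrow> \<bar>f x\<bar> \<le> B"
    and Q: "closed Q" "convex Q" "Q \<noteq> {}"
  shows "(L + B)-lipschitz_on UNIV (\<lambda>x. cutoff R x * f (closest_point Q x))"
proof -
  have inQ: "closest_point Q x \<in> Q" for x using Q by (simp add: closest_point_in_set)
  have B: "B \<ge> 0" using f(2)[OF inQ[of 0]] by linarith
  have L: "L \<ge> 0" using f(1) lipschitz_on_nonneg by blast
  have "L-lipschitz_on UNIV (\<lambda>x. f (closest_point Q x))"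
  proof (rule lipschitz_onI[OF _ L])
    fix x y
    have "dist (f (closest_point Q x)) (f (closest_point Q y)) \<le> L * dist (closest_point Q x) (closest_point Q y)"
      by (rule lipschitz_onD[OF f(1) inQ inQ])
    also have "\<dots> \<le> L * dist x y" using Q L by (intro mult_left_mono closest_point_lipschitz)
    finally show "dist (f (closest_point Q x)) (f (closest_point Q y)) \<le> L * dist x y" .
  qed
  from lipschitz_on_mult_bounded[OF lipschitz_cutoff abs_cutoff_le this f(2)[OF inQ]] show ?thesis
    using B by simp
qed

text \<open>Both functions have the same candidate derivatives at x, so the choice made by
  \<open>frechet_derivative\<close> coincides even when there is none. Localised Jacobians therefore
  agree at every point and not just almost everywhere.\<close>

lemma frechet_derivative_cong_open:
  assumes "open S" "x \<in> S" "\<And>y. y \<in> S \<Longrightarrow> f y = g y"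
  shows "frechet_derivative f (at x) = frechet_derivative g (at x)"
proof -
  have "(f has_derivative D) (at x) \<longleftrightarrow> (g has_derivative D) (at x)" for D
  proof
    show "(g has_derivative D) (at x)" if "(f has_derivative D) (at x)"
      by (rule has_derivative_transform_within_open[OF that assms])
    show "(f has_derivative D) (at x)" if "(g has_derivative D) (at x)"
      by (rule has_derivative_transform_within_open[OF that assms(1,2)]) (rule assms(3)[symmetric])
  qed
  then show ?thesis by (simp add: frechet_derivative_def)
qed

lemma Lip_loc_uniform:
  fixes p :: "'n::finite \<Rightarrow> real \<Rightarrow> real^'n \<Rightarrow> real"
  assumes lip: "\<And>i. Lip_loc T (p i)" and K: "compact K" "K \<subseteq> {0..T} \<times> UNIV"
  obtains L B where "L \<ge> 0" "B \<ge> 0" "\<forall>i. L-lipschitz_on K (\<lambda>z. p i (fst z) (snd z))"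
    "\<forall>i. \<forall>z\<in>K. \<bar>p i (fst z) (snd z)\<bar> \<le> B"
proof -
  have "\<forall>i. \<exists>L. L-lipschitz_on K (\<lambda>z. p i (fst z) (snd z))" using lip K by (auto simp: Lip_loc_def)
  then obtain L where L: "\<And>i. (L i)-lipschitz_on K (\<lambda>z. p i (fst z) (snd z))" by metis
  have L0: "L i \<ge> 0" for i using L lipschitz_on_nonneg by blast
  have "\<exists>B. \<forall>z\<in>K. \<bar>p i (fst z) (snd z)\<bar> \<le> B" for i
  proof -
    have "compact ((\<lambda>z. p i (fst z) (snd z)) ` K)"
      by (rule compact_continuous_image[OF lipschitz_on_continuous_on[OF L] K(1)])
    from compact_imp_bounded[OF this] show ?thesis by (simp add: bounded_iff)
  qed
  then obtain B where B: "\<And>i. \<forall>z\<in>K. \<bar>p i (fst z) (snd z)\<bar> \<le> B i" by metis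
  show thesis
  proof (rule that[of "\<Sum>i\<in>UNIV. L i" "\<Sum>i\<in>UNIV. \<bar>B i\<bar>"]; (intro allI ballI)?)
    show "(\<Sum>i\<in>UNIV. L i)-lipschitz_on K (\<lambda>z. p i (fst z) (snd z))" for i
      by (rule lipschitz_on_le[OF L]) (use L0 in \<open>auto intro: member_le_sum\<close>)
    show "\<bar>p i (fst z) (snd z)\<bar> \<le> (\<Sum>i\<in>UNIV. \<bar>B i\<bar>)" if "z \<in> K" for i z
      using B[of i] that member_le_sum[of i UNIV "\<lambda>i. \<bar>B i\<bar>"] by force
  qed (auto intro: sum_nonneg L0)
qed

section \<open>Weak-* continuity in time\<close>

lemma bij_axis: "bij_betw (\<lambda>i. axis i (1::real)) UNIV (Basis :: (real^'n) set)"
  by (auto simp: bij_betw_def inj_on_def axis_eq_axis Basis_vec_def)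

abbreviation spatial_det_jacobian :: "('n::finite \<Rightarrow> real^'n \<Rightarrow> real) \<Rightarrow> real^'n \<Rightarrow> real" where
  "spatial_det_jacobian g x \<equiv> det (jacobian (\<lambda>i. axis i 1) g x)"

lemma jac_eq_spatial_det_jacobian: "jac p t x = spatial_det_jacobian (\<lambda>i. p i t) x"
  by (simp add: jac_def sgrad_def jacobian_def[OF bij_axis])

text \<open>Globally Lipschitz, boundedly supported substitutes for the time slices. The constant N
  is independent of time and also bounds the change in time; agreement of the Jacobians holds at
  every time, as weak-* continuity allows no exceptional times.\<close>

lemma spatial_slices:
  fixes p :: "'n::finite \<Rightarrow> real \<Rightarrow> real^'n \<Rightarrow> real"
  assumes T: "T > 0" and lip: "\<And>i. Lip_loc T (p i)" and R: "R \<ge> 0"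
  obtains N and u :: "real \<Rightarrow> 'n \<Rightarrow> real^'n \<Rightarrow> real" where
    "\<forall>t\<in>{0..T}. \<forall>i. N-lipschitz_on UNIV (u t i)"
    "\<forall>t i x. norm x > R + 2 \<longrightarrow> u t i x = 0"
    "\<forall>t\<in>{0..T}. \<forall>x. norm x < R + 1 \<longrightarrow> jac p t x = spatial_det_jacobian (u t) x"
    "\<forall>s\<in>{0..T}. \<forall>t\<in>{0..T}. \<forall>i x. \<bar>u t i x - u s i x\<bar> \<le> N * \<bar>t - s\<bar>"
proof -
  define Q where "Q = cball (0::real^'n) (R + 2)"
  have Q: "closed Q" "convex Q" "Q \<noteq> {}" using R by (auto simp: Q_def)
  have inQ: "closest_point Q x \<in> Q" for x using Q by (simp add: closest_point_in_set)
  define K where "K = {0..T} \<times> Q"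
  have "compact K" "K \<subseteq> {0..T} \<times> UNIV" by (auto simp: K_def Q_def intro: compact_Times)
  then obtain L B where L': "L \<ge> 0" "B \<ge> 0" "\<forall>i. L-lipschitz_on K (\<lambda>z. p i (fst z) (snd z))"
    "\<forall>i. \<forall>z\<in>K. \<bar>p i (fst z) (snd z)\<bar> \<le> B"
    by (rule Lip_loc_uniform[where p = p, OF lip])
  note L = L'(1,2) L'(3,4)[rule_format]
  define u where "u = (\<lambda>t i x. cutoff R x * p i t (closest_point Q x))"
  show thesis
  proof (rule that[of "L + B" u]; intro allI ballI impI)
    fix t i assume t: "t \<in> {0..T}"
    have "L-lipschitz_on Q (p i t)"
    proof (rule lipschitz_onI[OF _ L(1)])
      fix x y assume "x \<in> Q" "y \<in> Q"
      then show "dist (p i t x) (p i t y) \<le> L * dist x y"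
        using lipschitz_onD[OF L(3)[of i], of "(t, x)" "(t, y)"] t by (simp add: K_def dist_Pair_Pair)
    qed
    moreover have "\<bar>p i t x\<bar> \<le> B" if "x \<in> Q" for x
      using L(4)[of "(t, x)" i] that t by (simp add: K_def)
    ultimately show "(L + B)-lipschitz_on UNIV (u t i)"
      unfolding u_def by (rule lipschitz_cutoff_extension[OF _ _ Q])
  next
    fix t i and x :: "real^'n" assume "norm x > R + 2"
    then show "u t i x = 0" using cutoff_eq_0[OF R, of x] by (simp add: u_def)
  next
    fix t and x :: "real^'n" assume t: "t \<in> {0..T}" and x: "norm x < R + 1"
    have "frechet_derivative (p i t) (at x) = frechet_derivative (u t i) (at x)" for i
    proof (rule frechet_derivative_cong_open[of "ball 0 (R + 1)"])
      fix y :: "real^'n" assume "y \<in> ball 0 (R + 1)"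
      then show "p i t y = u t i y"
        using cutoff_eq_1[of y R] closest_point_self[of y Q] by (simp add: u_def Q_def)
    qed (use x in auto)
    then show "jac p t x = spatial_det_jacobian (u t) x" by (simp add: jac_eq_spatial_det_jacobian jacobian_def[OF bij_axis])
  next
    fix s t i and x :: "real^'n" assume st: "s \<in> {0..T}" "t \<in> {0..T}"
    have "\<bar>p i t (closest_point Q x) - p i s (closest_point Q x)\<bar> \<le> L * \<bar>t - s\<bar>"
      using lipschitz_onD[OF L(3)[of i], of "(t, closest_point Q x)" "(s, closest_point Q x)"] st inQ[of x]
      by (simp add: K_def dist_Pair_Pair dist_real_def)
    then have "\<bar>cutoff R x\<bar> * \<bar>p i t (closest_point Q x) - p i s (closest_point Q x)\<bar> \<le> 1 * (L * \<bar>t - s\<bar>)"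
      using abs_cutoff_le[of R x] by (intro mult_mono) auto
    also have "\<dots> \<le> (L + B) * \<bar>t - s\<bar>" using L by (simp add: mult_right_mono)
    finally show "\<bar>u t i x - u s i x\<bar> \<le> (L + B) * \<bar>t - s\<bar>"
      by (simp add: u_def abs_mult[symmetric] right_diff_distrib)
  qed
qed

lemma Linfty_loc_jac:
  fixes p :: "'n::finite \<Rightarrow> real \<Rightarrow> real^'n \<Rightarrow> real"
  assumes T: "T > 0" and lip: "\<And>i. Lip_loc T (p i)" and t: "t \<in> {0..T}"
  shows "Linfty_loc (jac p t)"
  unfolding Linfty_loc_def
proof (intro conjI allI impI)
  have "\<exists>v. v \<in> borel_measurable lebesgue \<and> (\<forall>x. norm x < real n \<longrightarrow> jac p t x = v x)" for n :: nat
  proof -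
    have "real n \<ge> 0" by simp
    then obtain N and u :: "real \<Rightarrow> 'n \<Rightarrow> real^'n \<Rightarrow> real" where u':
      "\<forall>t\<in>{0..T}. \<forall>i. N-lipschitz_on UNIV (u t i)"
      "\<forall>t i x. norm x > real n + 2 \<longrightarrow> u t i x = 0"
      "\<forall>t\<in>{0..T}. \<forall>x. norm x < real n + 1 \<longrightarrow> jac p t x = spatial_det_jacobian (u t) x"
      "\<forall>s\<in>{0..T}. \<forall>t\<in>{0..T}. \<forall>i x. \<bar>u t i x - u s i x\<bar> \<le> N * \<bar>t - s\<bar>"
      by (rule spatial_slices[where p = p, OF T lip])
    note u = u'(1,3)[rule_format]
    show ?thesis
      using lipschitz_measurable_det_jacobian[where g = "u t", OF bij_axis u(1)[OF t]] u(2)[OF t]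
      by (intro exI[of _ "spatial_det_jacobian (u t)"]) auto
  qed
  then obtain v where v: "\<And>n. v n \<in> borel_measurable lebesgue" "\<And>n x. norm x < real n \<Longrightarrow> jac p t x = v n x"
    by metis
  show "jac p t \<in> borel_measurable lebesgue"
  \<comment> \<open>At each x the sequence \<open>v n x\<close> is eventually equal to
    \<open>jac p t x\<close>, once the ball of radius n contains x.\<close>
  proof (rule borel_measurable_LIMSEQ_real[OF _ v(1)])
    fix x :: "real^'n"
    have "\<forall>\<^sub>F n in sequentially. norm x < real n"
      using eventually_gt_at_top[of "nat \<lceil>norm x\<rceil>"] by eventually_elim linarith
    then have "\<forall>\<^sub>F n in sequentially. v n x = jac p t x" by eventually_elim (use v in auto)
    then show "(\<lambda>n. v n x) \<longlonglongrightarrow> jac p t x" by (rule tendsto_eventually)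
  qed
next
  fix K :: "(real^'n) set" assume "compact K"
  then obtain R where R: "R > 0" "K \<subseteq> ball 0 R"
    using bounded_subset_ballD[OF compact_imp_bounded[OF \<open>compact K\<close>], of 0] by blast
  then have "R \<ge> 0" by simp
  then obtain N and u :: "real \<Rightarrow> 'n \<Rightarrow> real^'n \<Rightarrow> real" where u':
      "\<forall>t\<in>{0..T}. \<forall>i. N-lipschitz_on UNIV (u t i)"
      "\<forall>t i x. norm x > R + 2 \<longrightarrow> u t i x = 0"
      "\<forall>t\<in>{0..T}. \<forall>x. norm x < R + 1 \<longrightarrow> jac p t x = spatial_det_jacobian (u t) x"
      "\<forall>s\<in>{0..T}. \<forall>t\<in>{0..T}. \<forall>i x. \<bar>u t i x - u s i x\<bar> \<le> N * \<bar>t - s\<bar>"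
    by (rule spatial_slices[where p = p, OF T lip])
  note u = u'(1,3)[rule_format]
  have "AE x in lebesgue. x \<in> K \<longrightarrow> \<bar>jac p t x\<bar> \<le> leibniz_bound CARD('n) N"
    using abs_det_jacobian_le[OF bij_axis u(1)[OF t]]
  proof eventually_elim
    fix x assume *: "\<bar>spatial_det_jacobian (u t) x\<bar> \<le> leibniz_bound CARD('n) N"
    show "x \<in> K \<longrightarrow> \<bar>jac p t x\<bar> \<le> leibniz_bound CARD('n) N"
    proof
      assume "x \<in> K"
      then have "norm x < R + 1" using R by fastforce
      then show "\<bar>jac p t x\<bar> \<le> leibniz_bound CARD('n) N" using * u(2)[OF t] by simp
    qed
  qed
  then show "\<exists>C. AE x in lebesgue. x \<in> K \<longrightarrow> \<bar>jac p t x\<bar> \<le> C" by blast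
qed

text \<open>The sup bound C for the Jacobians is uniform in time, so replacing \<phi> by a Lipschitz
  \<psi> close in \<open>L^1\<close> costs a small error at all times at once; the pairing with
  \<psi> is then Lipschitz in time.\<close>

lemma C_weakstar_jac:
  fixes p :: "'n::finite \<Rightarrow> real \<Rightarrow> real^'n \<Rightarrow> real"
  assumes T: "T > 0" and lip: "\<And>i. Lip_loc T (p i)"
  shows "C_weakstar T (jac p)"
  unfolding C_weakstar_def
proof (intro conjI ballI allI impI)
  show "Linfty_loc (jac p t)" if "t \<in> {0..T}" for t by (rule Linfty_loc_jac[OF T lip that])
next
  fix \<phi> :: "real^'n \<Rightarrow> real"
  assume \<phi>: "integrable lebesgue \<phi> \<and> bounded {x. \<phi> x \<noteq> 0}"
  then obtain R where R: "R > 0" "{x. \<phi> x \<noteq> 0} \<subseteq> ball 0 R"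
    using bounded_subset_ballD[of "{x. \<phi> x \<noteq> 0}" 0] by blast
  define U where "U = ball (0::real^'n) R"
  have supp: "\<phi> x = 0" if "x \<notin> U" for x using that R by (auto simp: U_def)
  have i\<phi>: "integrable lebesgue \<phi>" using \<phi> by blast
  have U: "open U" "bounded U" by (auto simp: U_def)
  have "R \<ge> 0" using R by simp
  then obtain N and u :: "real \<Rightarrow> 'n \<Rightarrow> real^'n \<Rightarrow> real" where u':
      "\<forall>t\<in>{0..T}. \<forall>i. N-lipschitz_on UNIV (u t i)"
      "\<forall>t i x. norm x > R + 2 \<longrightarrow> u t i x = 0"
      "\<forall>t\<in>{0..T}. \<forall>x. norm x < R + 1 \<longrightarrow> jac p t x = spatial_det_jacobian (u t) x"
      "\<forall>s\<in>{0..T}. \<forall>t\<in>{0..T}. \<forall>i x. \<bar>u t i x - u s i x\<bar> \<le> N * \<bar>t - s\<bar>"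
    by (rule spatial_slices[where p = p, OF T lip])
  note u = u'[rule_format]
  have N: "N \<ge> 0" using lipschitz_on_nonneg[OF u(1)[of 0]] T by simp
  define C where "C = leibniz_bound CARD('n) N"
  have C: "C \<ge> 0" using N leibniz_bound_nonneg by (auto simp: C_def)
  define f where "f = (\<lambda>t. \<integral>x. spatial_det_jacobian (u t) x * \<phi> x \<partial>lebesgue)"
  have f: "f t = (\<integral>x. jac p t x * \<phi> x \<partial>lebesgue)" if "t \<in> {0..T}" for t
    unfolding f_def
  proof (rule Bochner_Integration.integral_cong[OF refl])
    fix x show "spatial_det_jacobian (u t) x * \<phi> x = jac p t x * \<phi> x"
      using u(3)[OF that, of x] supp[of x] by (cases "x \<in> U") (auto simp: U_def)
  qed
  have approx: "\<bar>f t - (\<integral>x. \<psi> x * spatial_det_jacobian (u t) x \<partial>lebesgue)\<bar> \<le> C * (\<integral>x. \<bar>\<phi> x - \<psi> x\<bar> \<partial>lebesgue)"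
    if t: "t \<in> {0..T}" and \<psi>: "integrable lebesgue \<psi>" for t \<psi>
  proof -
    have m: "spatial_det_jacobian (u t) \<in> borel_measurable lebesgue" by (rule lipschitz_measurable_det_jacobian[OF bij_axis u(1)[OF t]])
    have b: "AE x in lebesgue. \<bar>spatial_det_jacobian (u t) x\<bar> \<le> C"
      unfolding C_def by (rule abs_det_jacobian_le[OF bij_axis u(1)[OF t]])
    have int: "integrable lebesgue (\<lambda>x. spatial_det_jacobian (u t) x * h x)" if "integrable lebesgue h" for h
    proof (rule Bochner_Integration.integrable_bound)
      show "integrable lebesgue (\<lambda>x. C * \<bar>h x\<bar>)" using that by auto
      show "(\<lambda>x. spatial_det_jacobian (u t) x * h x) \<in> borel_measurable lebesgue" using m that by auto
      show "AE x in lebesgue. norm (spatial_det_jacobian (u t) x * h x) \<le> norm (C * \<bar>h x\<bar>)"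
        using b by eventually_elim (use C in \<open>auto simp: abs_mult intro!: mult_right_mono\<close>)
    qed
    have "f t - (\<integral>x. \<psi> x * spatial_det_jacobian (u t) x \<partial>lebesgue) = (\<integral>x. spatial_det_jacobian (u t) x * (\<phi> x - \<psi> x) \<partial>lebesgue)"
    proof -
      have "(\<integral>x. \<psi> x * spatial_det_jacobian (u t) x \<partial>lebesgue) = (\<integral>x. spatial_det_jacobian (u t) x * \<psi> x \<partial>lebesgue)"
        by (simp add: mult.commute)
      then show ?thesis using int[of \<phi>] int[of \<psi>] \<phi> \<psi> by (simp add: f_def right_diff_distrib)
    qed
    also have "\<bar>\<dots>\<bar> \<le> (\<integral>x. \<bar>spatial_det_jacobian (u t) x * (\<phi> x - \<psi> x)\<bar> \<partial>lebesgue)" by (rule integral_abs_bound)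
    also have "\<dots> \<le> (\<integral>x. C * \<bar>\<phi> x - \<psi> x\<bar> \<partial>lebesgue)"
    proof (rule integral_mono_AE)
      show "integrable lebesgue (\<lambda>x. \<bar>spatial_det_jacobian (u t) x * (\<phi> x - \<psi> x)\<bar>)"
        using \<phi> \<psi> by (intro integrable_abs int Bochner_Integration.integrable_diff) auto
      show "integrable lebesgue (\<lambda>x. C * \<bar>\<phi> x - \<psi> x\<bar>)" using \<phi> \<psi> by auto
      show "AE x in lebesgue. \<bar>spatial_det_jacobian (u t) x * (\<phi> x - \<psi> x)\<bar> \<le> C * \<bar>\<phi> x - \<psi> x\<bar>"
        using b by eventually_elim (auto simp: abs_mult intro!: mult_right_mono)
    qed
    finally show ?thesis by simp
  qed
  have "continuous_on {0..T} f"
    unfolding continuous_on_iff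
  proof (intro ballI allI impI)
    fix t \<epsilon> :: real assume t: "t \<in> {0..T}" and \<epsilon>: "\<epsilon> > 0"
    \<comment> \<open>Replacing \<phi> by \<psi> at the times s and t and changing the time cost at
      most \<epsilon>/4 each, leaving a strict margin below \<epsilon>.\<close>
    have "\<epsilon> / (4 * (C + 1)) > 0" using C \<epsilon> by simp
    then obtain \<psi> M where \<psi>: "M-lipschitz_on UNIV \<psi>" "\<And>x. x \<notin> U \<Longrightarrow> \<psi> x = 0"
      "(\<integral>x. \<bar>\<phi> x - \<psi> x\<bar> \<partial>lebesgue) < \<epsilon> / (4 * (C + 1))"
      by (rule Lipschitz_dense_L1[OF i\<phi> U, rotated]) (auto simp: supp)
    have \<psi>i: "integrable lebesgue \<psi>"
      by (rule lipschitz_integrable[OF \<psi>(1) U(2) \<psi>(2)])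
    have \<psi>z: "\<psi> x = 0" if "norm x > R + 2" for x using \<psi>(2)[of x] that by (simp add: U_def)
    \<comment> \<open>A Lipschitz constant in time of the pairing with \<psi>: the sup distance of
      the slices at s and t is at most N |s - t|, inserted into the Jacobian estimate.\<close>
    define D where "D = real CARD('n) * (N * (leibniz_bound CARD('n) (2 * N + M) * measure lebesgue (cball (0::real^'n) (R + 2))))"
    have M: "M \<ge> 0" using \<psi>(1) lipschitz_on_nonneg by blast
    have D: "D \<ge> 0" unfolding D_def
      using N M leibniz_bound_nonneg by (intro mult_nonneg_nonneg) auto
    have close: "C * (\<integral>x. \<bar>\<phi> x - \<psi> x\<bar> \<partial>lebesgue) \<le> \<epsilon> / 4"
    proof -
      have "C * (\<integral>x. \<bar>\<phi> x - \<psi> x\<bar> \<partial>lebesgue) \<le> C * (\<epsilon> / (4 * (C + 1)))"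
        using \<psi>(3) C by (intro mult_left_mono) auto
      also have "\<dots> \<le> \<epsilon> / 4" using C \<epsilon> by (simp add: field_simps)
      finally show ?thesis .
    qed
    show "\<exists>d>0. \<forall>s\<in>{0..T}. dist s t < d \<longrightarrow> dist (f s) (f t) < \<epsilon>"
    proof (intro exI[of _ "\<epsilon> / (4 * (D + 1))"] conjI ballI impI)
      show "\<epsilon> / (4 * (D + 1)) > 0" using D \<epsilon> by simp
      fix s assume s: "s \<in> {0..T}" and st: "dist s t < \<epsilon> / (4 * (D + 1))"
      have "\<bar>(\<integral>x. \<psi> x * spatial_det_jacobian (u s) x \<partial>lebesgue) - (\<integral>x. \<psi> x * spatial_det_jacobian (u t) x \<partial>lebesgue)\<bar>
        \<le> real CARD('n) * (N * \<bar>s - t\<bar> * (leibniz_bound CARD('n) (2 * N + M) * measure lebesgue (cball (0::real^'n) (R + 2))))"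
        by (rule integral_det_jacobian_diff_le[OF bij_axis u(1)[OF s] u(2) u(1)[OF t] u(2) \<psi>(1) \<psi>z u(4)[OF t s]])
      also have "\<dots> = \<bar>s - t\<bar> * D" by (simp add: D_def mult_ac)
      also have "\<dots> \<le> \<epsilon> / (4 * (D + 1)) * D"
        using st D by (intro mult_right_mono) (auto simp: dist_real_def)
      also have "\<dots> \<le> \<epsilon> / 4" using D \<epsilon> by (simp add: field_simps)
      finally show "dist (f s) (f t) < \<epsilon>"
        using approx[OF s \<psi>i] approx[OF t \<psi>i] close \<epsilon> unfolding dist_real_def by linarith
    qed
  qed
  then show "continuous_on {0..T} (\<lambda>t. \<integral>x. jac p t x * \<phi> x \<partial>lebesgue)"
    by (rule continuous_on_eq) (rule f)
qed

section \<open>The transport equation\<close>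

lemma smooth_differentiable: "smooth \<phi> \<Longrightarrow> \<phi> differentiable (at z)"
  unfolding smooth_def by (drule spec[of _ "[]"]) simp

lemma smooth_continuous_frechet:
  assumes "smooth \<phi>"
  shows "continuous_on UNIV (\<lambda>z. frechet_derivative \<phi> (at z) v)"
proof -
  have "(\<lambda>z. frechet_derivative \<phi> (at z) v) differentiable (at z)" for z
    using assms[unfolded smooth_def, rule_format, of "[v]" z] by simp
  then show ?thesis
    by (intro continuous_at_imp_continuous_on ballI differentiable_imp_continuous_within)
qed

lemma frechet_derivative_eq_0_off_support:
  assumes "z \<notin> closure {z. \<phi> z \<noteq> 0}"
  shows "frechet_derivative \<phi> (at z) = (\<lambda>w. 0)"
proof -
  have "frechet_derivative \<phi> (at z) = frechet_derivative (\<lambda>z. 0 :: 'b) (at z)"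
    by (rule frechet_derivative_cong_open[of "- closure {z. \<phi> z \<noteq> 0}"])
      (use assms closure_subset[of "{z. \<phi> z \<noteq> 0}"] in blast)+
  then show ?thesis by simp
qed

text \<open>Each directional derivative is continuous, hence bounded on the compact support, and it
  vanishes elsewhere; the bounds for the basis directions add up to a bound for the operator
  norm.\<close>

lemma smooth_compact_support_imp_lipschitz:
  fixes \<phi> :: "'a::euclidean_space \<Rightarrow> real"
  assumes "smooth \<phi>" and S: "compact (closure {z. \<phi> z \<noteq> 0})"
  obtains M where "M-lipschitz_on UNIV \<phi>"
proof -
  have "\<exists>B. \<forall>z. \<bar>frechet_derivative \<phi> (at z) b\<bar> \<le> B" for b
  proof -
    let ?S = "closure {z. \<phi> z \<noteq> 0}"
    have "compact ((\<lambda>z. frechet_derivative \<phi> (at z) b) ` ?S)"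
      by (intro compact_continuous_image S continuous_on_subset[OF smooth_continuous_frechet[OF assms(1)]]) simp
    from compact_imp_bounded[OF this]
    obtain B where B: "\<forall>z\<in>?S. \<bar>frechet_derivative \<phi> (at z) b\<bar> \<le> B" by (auto simp: bounded_iff)
    have "\<bar>frechet_derivative \<phi> (at z) b\<bar> \<le> \<bar>B\<bar>" for z
    proof (cases "z \<in> ?S")
      case True
      then have "\<bar>frechet_derivative \<phi> (at z) b\<bar> \<le> B" using B by blast
      then show ?thesis by linarith
    next
      case False
      then show ?thesis by (simp add: frechet_derivative_eq_0_off_support)
    qed
    then show ?thesis by blast
  qed
  then obtain B where B: "\<And>b z. \<bar>frechet_derivative \<phi> (at z) b\<bar> \<le> B b" by metis
  have B0: "B b \<ge> 0" for b using B[of 0 b] by linarith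
  have "(\<Sum>b\<in>Basis. B b)-lipschitz_on UNIV \<phi>"
  proof (rule bounded_derivative_imp_lipschitz)
    fix z
    show d: "(\<phi> has_derivative frechet_derivative \<phi> (at z)) (at z within UNIV)"
      using differentiable_imp_has_frechet_derivative[OF smooth_differentiable[OF assms(1)]] by simp
    have lin: "linear (frechet_derivative \<phi> (at z))"
      using d by (simp add: has_derivative_bounded_linear bounded_linear.linear)
    show "onorm (frechet_derivative \<phi> (at z)) \<le> (\<Sum>b\<in>Basis. B b)"
    proof (rule onorm_le)
      fix w
      have "frechet_derivative \<phi> (at z) w = frechet_derivative \<phi> (at z) (\<Sum>b\<in>Basis. (w \<bullet> b) *\<^sub>R b)"
        by (simp add: euclidean_representation)
      also have "\<dots> = (\<Sum>b\<in>Basis. (w \<bullet> b) * frechet_derivative \<phi> (at z) b)"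
        using lin by (simp add: linear_sum linear_cmul)
      also have "norm \<dots> \<le> (\<Sum>b\<in>Basis. norm w * B b)"
      proof (rule order_trans[OF norm_sum sum_mono])
        fix b :: 'a assume "b \<in> Basis"
        then show "norm ((w \<bullet> b) * frechet_derivative \<phi> (at z) b) \<le> norm w * B b"
          unfolding real_norm_def abs_mult by (intro mult_mono Basis_le_norm B) auto
      qed
      finally show "norm (frechet_derivative \<phi> (at z) w) \<le> (\<Sum>b\<in>Basis. B b) * norm w"
        by (simp add: sum_distrib_left mult.commute)
    qed
  qed (auto intro: sum_nonneg B0)
  then show thesis by (rule that)
qed

text \<open>The type \<open>'n option\<close> indexes both the directions and the functions of the
  space-time Jacobian: \<open>None\<close> stands for time among the former and for the test
  function among the latter.\<close>

definition st_basis :: "'n option \<Rightarrow> real \<times> (real^'n)" where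
  "st_basis k = (case k of None \<Rightarrow> (1, 0) | Some i \<Rightarrow> (0, axis i 1))"

lemma bij_st_basis: "bij_betw st_basis UNIV (Basis :: (real \<times> (real^'n)) set)"
proof -
  have "inj (st_basis :: 'n option \<Rightarrow> _)"
    by (auto simp: inj_on_def st_basis_def axis_eq_axis split: option.splits)
  moreover have "range (st_basis :: 'n option \<Rightarrow> _) = Basis"
    unfolding Basis_prod_def UNIV_option_conv Basis_vec_def by (auto simp: st_basis_def image_iff)
  ultimately show ?thesis by (simp add: bij_betw_def)
qed

lemma UNIV_option_sum: "(\<Sum>i\<in>(UNIV::'k::finite option set). f i) = f None + (\<Sum>i\<in>UNIV. f (Some i))"
  by (simp add: UNIV_option_conv sum.reindex)

text \<open>The kernel vector \<open>(1, a)\<close> of the space-time gradients of the \<open>p i\<close>: by Cramer's rule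
  replacing the time column of the Jacobian matrix by its product with \<open>(1, a)\<close> leaves the determinant
  unchanged, and the new column vanishes except in the first row.\<close>
lemma det_space_time_jacobian:
  fixes g :: "'n::finite option \<Rightarrow> real \<times> (real^'n) \<Rightarrow> real" and a :: "real^'n"
  assumes ker: "\<And>i. frechet_derivative (g (Some i)) (at z) (1, 0)
      + a \<bullet> (\<chi> j. frechet_derivative (g (Some i)) (at z) (0, axis j 1)) = 0"
  shows "det (jacobian st_basis g z) =
    (frechet_derivative (g None) (at z) (1, 0) + a \<bullet> (\<chi> j. frechet_derivative (g None) (at z) (0, axis j 1)))
    * det (\<chi> i j. frechet_derivative (g (Some i)) (at z) (0, axis j 1))"
proof -
  define M where "M = jacobian st_basis g z"
  define v :: "real^('n option)" where "v = (\<chi> k. case k of None \<Rightarrow> 1 | Some j \<Rightarrow> a $ j)"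
  have M: "M $ i $ None = frechet_derivative (g i) (at z) (1, 0)"
    "M $ i $ Some j = frechet_derivative (g i) (at z) (0, axis j 1)" for i j
    by (simp_all add: M_def jacobian_def[OF bij_st_basis] st_basis_def)
  have Mv: "(M *v v) $ i = frechet_derivative (g i) (at z) (1, 0) + a \<bullet> (\<chi> j. frechet_derivative (g i) (at z) (0, axis j 1))" for i
    by (simp add: matrix_vector_mult_def UNIV_option_sum M v_def inner_vec_def mult.commute)
  define N where "N = (\<chi> i j. if j = None then (M *v v) $ i else M $ i $ j)"
  \<comment> \<open>Cramer's lemma gives the factor \<open>v $ None\<close>, which is 1, the time
    component of (1, a).\<close>
  have "det N = det M" using cramer_lemma[of None M v] by (simp add: N_def v_def)
  moreover have "det N = N $ None $ None * det (\<chi> i j. N $ Some i $ Some j)"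
    by (rule det_option_block) (simp add: N_def Mv ker)
  ultimately show ?thesis by (simp add: N_def Mv M M_def[symmetric])
qed

lemma weak_sol_jac:
  fixes p :: "'n::finite \<Rightarrow> real \<Rightarrow> real^'n \<Rightarrow> real" and a :: "real \<Rightarrow> real^'n \<Rightarrow> real^'n"
  assumes T: "T > 0" and lip: "\<And>i. Lip_loc T (p i)"
    and pde: "\<And>i. AE z in lebesgue. z \<in> {0<..<T} \<times> UNIV \<longrightarrow>
        tderiv (p i) (fst z) (snd z) + a (fst z) (snd z) \<bullet> sgrad (p i) (fst z) (snd z) = 0"
  shows "weak_sol T a (jac p)"
  unfolding weak_sol_def Let_def
proof (rule allI, rule impI)
  fix \<phi> :: "real \<times> (real^'n) \<Rightarrow> real"
  assume \<phi>: "test_fun T \<phi>"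
  define S where "S = closure {z. \<phi> z \<noteq> 0}"
  have S: "compact S" "S \<subseteq> {0<..<T} \<times> UNIV" and sm: "smooth \<phi>"
    using \<phi> by (auto simp: test_fun_def S_def)
  obtain M where M: "M-lipschitz_on UNIV \<phi>"
    using smooth_compact_support_imp_lipschitz[OF sm] S(1) S_def by blast
  obtain R where R: "R > 0" "S \<subseteq> ball 0 R"
    using bounded_subset_ballD[OF compact_imp_bounded[OF S(1)], of 0] by blast
  define Q where "Q = {0..T} \<times> cball (0::real^'n) (R + 2)"
  have Q: "closed Q" "convex Q" "Q \<noteq> {}" using R T
    by (auto simp: Q_def intro: closed_Times convex_Times)
  have "compact Q" "Q \<subseteq> {0..T} \<times> UNIV" by (auto simp: Q_def intro: compact_Times)
  then obtain L B where L: "L \<ge> 0" "B \<ge> 0" "\<forall>i. L-lipschitz_on Q (\<lambda>z. p i (fst z) (snd z))"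
    "\<forall>i. \<forall>z\<in>Q. \<bar>p i (fst z) (snd z)\<bar> \<le> B"
    by (rule Lip_loc_uniform[where p = p, OF lip])
  define g where "g = (\<lambda>k. case k of None \<Rightarrow> \<phi>
     | Some i \<Rightarrow> (\<lambda>z. cutoff R z * p i (fst (closest_point Q z)) (snd (closest_point Q z))))"
  have gN: "g None = \<phi>" by (simp add: g_def)
  have M0: "M \<ge> 0" using M lipschitz_on_nonneg by blast
  have gS: "(L + B)-lipschitz_on UNIV (g (Some i))" for i
    using lipschitz_cutoff_extension[of L Q "\<lambda>z. p i (fst z) (snd z)" B R] L Q by (simp add: g_def)
  have glip: "(M + L + B)-lipschitz_on UNIV (g k)" for k
  proof (cases k)
    case None
    then show ?thesis using lipschitz_on_le[OF M] L(1,2) M0 by (simp add: gN)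
  next
    case (Some i)
    then show ?thesis using lipschitz_on_le[OF gS[of i]] M0 by simp
  qed
  have \<phi>0: "\<phi> z = 0" if "z \<notin> S" for z using that closure_subset[of "{z. \<phi> z \<noteq> 0}"] unfolding S_def by blast
  have gz: "g k z = 0" if "norm z > R + 2" for k z
  proof (cases k)
    case None
    have "z \<notin> S" using that R by fastforce
    then show ?thesis using None \<phi>0 by (simp add: gN)
  next
    case (Some i)
    then show ?thesis using cutoff_eq_0[of R z] R that by (simp add: g_def)
  qed
  \<comment> \<open>An open neighbourhood of the support of \<phi> inside the open time strip, on
    which the cutoff is 1 and the retraction onto Q is the identity.\<close>
  define V where "V = ({0<..<T} \<times> UNIV) \<inter> ball (0 :: real \<times> (real^'n)) (R + 1)"
  have V: "open V" unfolding V_def by (intro open_Int open_Times) auto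
  have SV: "S \<subseteq> V" using S R by (auto simp: V_def)
  have gV: "g (Some i) z = p i (fst z) (snd z)" if "z \<in> V" for i z
  proof -
    have "norm z < R + 1" using that by (simp add: V_def)
    moreover have "norm (snd z) \<le> norm z" by (cases z) (simp add: norm_Pair real_le_rsqrt)
    ultimately have "z \<in> Q" using that by (cases z) (auto simp: V_def Q_def)
    then show ?thesis using cutoff_eq_1[of z R] \<open>norm z < R + 1\<close> by (simp add: g_def closest_point_self)
  qed
  define G where "G = (\<lambda>z. jac p (fst z) (snd z) *
          (frechet_derivative \<phi> (at z) (1, 0)
           + a (fst z) (snd z) \<bullet> (\<chi> j. frechet_derivative \<phi> (at z) (0, axis j 1))))"
  define DJ where "DJ = (\<lambda>z. det (jacobian st_basis g z))"
  have AE_G: "AE z in lebesgue. DJ z = G z"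
  proof -
    have 1: "AE z in lebesgue. \<forall>k. g k differentiable (at z)"
      by (intro AE_all_countable[THEN iffD2] allI Rademacher[OF glip])
    have 2: "AE z in lebesgue. \<forall>i. z \<in> {0<..<T} \<times> UNIV \<longrightarrow>
        tderiv (p i) (fst z) (snd z) + a (fst z) (snd z) \<bullet> sgrad (p i) (fst z) (snd z) = 0"
      by (intro AE_all_countable[THEN iffD2] allI pde)
    from 1 2 show ?thesis
    proof eventually_elim
      fix z :: "real \<times> (real^'n)"
      assume d: "\<forall>k. g k differentiable (at z)"
        and eq: "\<forall>i. z \<in> {0<..<T} \<times> UNIV \<longrightarrow>
          tderiv (p i) (fst z) (snd z) + a (fst z) (snd z) \<bullet> sgrad (p i) (fst z) (snd z) = 0"
      show "DJ z = G z"
      proof (cases "z \<in> V")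
        case True
        obtain t x where z: "z = (t, x)" by (cases z)
        have t: "t \<in> {0<..<T}" using True z by (simp add: V_def)
        \<comment> \<open>Space-time differentiability of the extension passes to \<open>p i\<close>
          on V; then \<open>tderiv\<close> and \<open>sgrad\<close>, defined by separate
          derivatives, are the components of one linear map, as the determinant identity
          requires.\<close>
        define D where "D = (\<lambda>i. frechet_derivative (g (Some i)) (at z))"
        have D: "((\<lambda>z. p i (fst z) (snd z)) has_derivative D i) (at (t, x))" for i
          using has_derivative_transform_within_open[OF differentiable_imp_has_frechet_derivative[OF d[rule_format, of "Some i"]] V True gV]
          by (simp add: D_def z)
        have Dx: "(p i t has_derivative (\<lambda>w. D i (0, w))) (at x)" for i
        proof -
          have "((\<lambda>y. (t, y)) has_derivative (\<lambda>w. (0, w))) (at x)"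
            by (auto intro!: derivative_eq_intros)
          from has_derivative_compose[OF this D] show ?thesis by simp
        qed
        have Dt: "((\<lambda>s. p i s x) has_derivative (\<lambda>h. D i (h, 0))) (at t)" for i
        proof -
          have "((\<lambda>s. (s, x)) has_derivative (\<lambda>h. (h, 0))) (at t)"
            by (auto intro!: derivative_eq_intros)
          from has_derivative_compose[OF this D] show ?thesis by simp
        qed
        have sg: "sgrad (p i) t x = (\<chi> j. D i (0, axis j 1))" for i
          by (simp add: sgrad_def frechet_derivative_at[OF Dx, symmetric])
        have td: "tderiv (p i) t x = D i (1, 0)" for i
          by (simp add: tderiv_def frechet_derivative_at[OF Dt, symmetric])
        have "D i (1, 0) + a t x \<bullet> (\<chi> j. D i (0, axis j 1)) = 0" for i
          using eq[rule_format, of i] t by (simp add: z sg td)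
        then have "DJ z = (frechet_derivative (g None) (at z) (1, 0) + a t x \<bullet> (\<chi> j. frechet_derivative (g None) (at z) (0, axis j 1)))
          * det (\<chi> i j. D i (0, axis j 1))"
          unfolding DJ_def D_def by (rule det_space_time_jacobian)
        then show ?thesis by (simp add: G_def gN z jac_def sg mult.commute)
      next
        \<comment> \<open>Here the extensions need not satisfy the equation, but the row of \<phi>
          vanishes, so both sides are 0.\<close>
        case False
        then have "z \<notin> S" using SV by blast
        then have 0: "frechet_derivative \<phi> (at z) = (\<lambda>w. 0)"
          unfolding S_def by (rule frechet_derivative_eq_0_off_support)
        have "row None (jacobian st_basis g z) = 0"
          by (simp add: row_def jacobian_def[OF bij_st_basis] gN 0 vec_eq_iff)
        then have "DJ z = 0" unfolding DJ_def by (rule det_zero_row)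
        moreover have "(\<chi> j. 0) = (0 :: real^'n)" by (simp add: vec_eq_iff)
        ultimately show ?thesis by (simp add: G_def 0)
      qed
    qed
  qed
  have mD: "DJ \<in> borel_measurable lebesgue"
    unfolding DJ_def by (rule lipschitz_measurable_det_jacobian[where g = g, OF bij_st_basis glip])
  \<comment> \<open>Measurability and integrability of the weak integrand are inherited from the
    determinant of Lipschitz functions, to which it is equal almost everywhere.\<close>
  have mG: "G \<in> borel_measurable lebesgue" by (rule borel_measurable_AE[OF mD AE_G])
  have zD: "DJ z = 0" if "z \<notin> cball 0 (R + 2)" for z
  proof -
    have "z \<notin> S" using that R by fastforce
    then have 0: "frechet_derivative \<phi> (at z) = (\<lambda>w. 0)"
      unfolding S_def by (rule frechet_derivative_eq_0_off_support)
    have "row None (jacobian st_basis g z) = 0"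
      by (simp add: row_def jacobian_def[OF bij_st_basis] gN 0 vec_eq_iff)
    then show ?thesis unfolding DJ_def by (rule det_zero_row)
  qed
  have iD: "integrable lebesgue DJ"
    by (rule integrable_bounded_support[OF mD bounded_cball[of 0 "R + 2"] zD])
      (use abs_det_jacobian_le[where g = g, OF bij_st_basis glip] in \<open>simp_all add: DJ_def\<close>)
  have "integrable lebesgue G" by (rule integrable_cong_AE_imp[OF iD mG]) (use AE_G in eventually_elim, simp)
  moreover have "integral\<^sup>L lebesgue G = integral\<^sup>L lebesgue DJ"
    by (rule integral_cong_AE[OF mG mD]) (use AE_G in eventually_elim, simp)
  moreover have "integral\<^sup>L lebesgue DJ = 0"
    unfolding DJ_def by (rule integral_det_jacobian_eq_0[where g = g, OF bij_st_basis glip gz])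
  ultimately show "integrable lebesgue (\<lambda>z. jac p (fst z) (snd z) *
          (frechet_derivative \<phi> (at z) (1, 0)
           + a (fst z) (snd z) \<bullet> (\<chi> j. frechet_derivative \<phi> (at z) (0, axis j 1)))) \<and>
     (\<integral>z. jac p (fst z) (snd z) *
          (frechet_derivative \<phi> (at z) (1, 0)
           + a (fst z) (snd z) \<bullet> (\<chi> j. frechet_derivative \<phi> (at z) (0, axis j 1))) \<partial>lebesgue) = 0"
    unfolding G_def by simp
qed

theorem mainTheorem4:
  fixes T :: real
    and a :: "real \<Rightarrow> real^'n \<Rightarrow> real^'n"
    and p :: "'n \<Rightarrow> real \<Rightarrow> real^'n \<Rightarrow> real"
  assumes "T > 0"
    and "Linfty_field T a"
    and "\<And>i. Lip_loc T (p i)"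
    and "\<And>i. AE z in lebesgue. z \<in> {0<..<T} \<times> UNIV \<longrightarrow>
               tderiv (p i) (fst z) (snd z) + a (fst z) (snd z) \<bullet> sgrad (p i) (fst z) (snd z) = 0"
  shows "WT T a (jac p)"
  unfolding WT_def
  using C_weakstar_jac[where p = p, OF assms(1,3)] weak_sol_jac[where p = p, OF assms(1,3,4)] by blast

end
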